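(* Let $M$ be a manifold and let $J$ be the canonical tangent structure (vertical endomorphism) on $TM$. Let $\Gamma\in\Omega^1(TM;TTM)$ be a connection on $TM$. Then there exists a Lie algebroid structure $(TTM,q,[\![\cdot,\cdot]\!])$ on the manifold $TM$, where the anchor map is $q=v=\frac{1}{2}(\mathrm{Id}_{TTM}-\Gamma)$ and the bracket is $$[\![A,B]\!]=\frac{1}{2}\left([A,B]-[A,B]_\Gamma\right)+\frac{1}{4}T_\Gamma(A,B)$$ for all vector fields $A,B$ on $TM$.
   Context: Let $\pi:TM\to M$ be the tangent bundle and $\tau:TTM\to TM$ the second tangent bundle. The vertical endomorphism $J\in\Omega^1(TM;TTM)$ is $J=\iota\circ j$, where $j=(\tau,\pi_* ):TTM\to TM\times_M TM$ and $\iota:TM\times_M TM\to TTM$, $\iota(u,w)=\left.\frac{d}{dt}\right|_{t=0}(u+tw)$. A (nonlinear) connection on $TM$ is a smooth vector-valued $1$-form $\Gamma\in\Omega^1(TM;TTM)$, i.e. a vector bundle endomorphism of $TTM\to TM$ over the identity, such that $J\circ\Gamma=J=-\Gamma\circ J$. For an endomorphism $N$ of $TTM$ and vector fields $A,B$ on $TM$: the contracted bracket is $[A,B]_N=[NA,B]+[A,NB]-N[A,B]$ and the Nijenhuis torsion is $T_N(A,B)=[NA,NB]-N[NA,B]-N[A,NB]+N^2[A,B]$. A Lie algebroid on a manifold $Q$ is a triple $(E,q,[\![\cdot,\cdot]\!])$: a vector bundle $E\to Q$, a vector bundle map $q:E\to TQ$ over the identity (the anchor), and a Lie bracket $[\![\cdot,\cdot]\!]$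 on $\Gamma(E)$ satisfying $[\![A,fB]\!]=f[\![A,B]\!]+(qA)(f)\,B$ for all $A,B\in\Gamma(E)$, $f\in C^\infty(Q)$. Here $Q=TM$ and $E=TTM$. *)

theory Defs
  imports "HOL-Analysis.Analysis"
begin

section \<open>Smooth maps between open subsets of Euclidean spaces\<close>

text \<open>Only used for open \<open>S\<close>, where it is the usual notion of class $C^k$, expressed through
  directional derivatives.\<close>

primrec Ck_on :: "nat \<Rightarrow> 'a::euclidean_space set \<Rightarrow> ('a \<Rightarrow> 'b::real_normed_vector) \<Rightarrow> bool" where
  "Ck_on 0 S f \<longleftrightarrow> continuous_on S f"
| "Ck_on (Suc k) S f \<longleftrightarrow>
     f differentiable_on S \<and> (\<forall>v. Ck_on k S (\<lambda>x. frechet_derivative f (at x) v))"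

definition smooth_on :: "'a::euclidean_space set \<Rightarrow> ('a \<Rightarrow> 'b::real_normed_vector) \<Rightarrow> bool" where
  "smooth_on S f \<longleftrightarrow> (\<forall>k. Ck_on k S f)"


section \<open>Smooth manifolds\<close>

text \<open>A chart is a pair of its domain and its coordinate map; values of the coordinate map
  off the domain are irrelevant. A manifold is represented by an atlas: the underlying set and the
  topology are the ones determined by the atlas. The points of a manifold form a set,
  not a whole type, so that the tangent bundle construction can be iterated.\<close>

type_synonym ('p, 'e) chart = "'p set \<times> ('p \<Rightarrow> 'e)"
type_synonym ('p, 'e) atlas = "('p, 'e) chart set"

abbreviation chart_dom :: "('p, 'e) chart \<Rightarrow> 'p set" where
  "chart_dom c \<equiv> fst c"

abbreviation chart_map :: "('p, 'e) chart \<Rightarrow> 'p \<Rightarrow> 'e" where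
  "chart_map c \<equiv> snd c"

definition chart_inv :: "('p, 'e) chart \<Rightarrow> 'e \<Rightarrow> 'p" where
  "chart_inv c = inv_into (chart_dom c) (chart_map c)"

definition points :: "('p, 'e) atlas \<Rightarrow> 'p set" where
  "points M = (\<Union>c\<in>M. chart_dom c)"

definition transition :: "('p, 'e) chart \<Rightarrow> ('p, 'e) chart \<Rightarrow> 'e \<Rightarrow> 'e" where
  "transition c d = chart_map d \<circ> chart_inv c"

definition smooth_atlas :: "('p, 'e::euclidean_space) atlas \<Rightarrow> bool" where
  "smooth_atlas M \<longleftrightarrow>
     (\<forall>c\<in>M. inj_on (chart_map c) (chart_dom c) \<and> open (chart_map c ` chart_dom c)) \<and>
     (\<forall>c\<in>M. \<forall>d\<in>M. open (chart_map c ` (chart_dom c \<inter> chart_dom d)) \<and>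
        smooth_on (chart_map c ` (chart_dom c \<inter> chart_dom d)) (transition c d))"

definition manifold_topology :: "('p, 'e::euclidean_space) atlas \<Rightarrow> 'p topology" where
  "manifold_topology M =
     topology (\<lambda>W. W \<subseteq> points M \<and> (\<forall>c\<in>M. open (chart_map c ` (W \<inter> chart_dom c))))"

definition smooth_manifold :: "('p, 'e::euclidean_space) atlas \<Rightarrow> bool" where
  "smooth_manifold M \<longleftrightarrow> smooth_atlas M \<and>
     Hausdorff_space (manifold_topology M) \<and> second_countable (manifold_topology M)"

text \<open>Openness of the set in the last clause, for all charts, is continuity of \<open>f\<close>.\<close>

definition smooth_map ::
  "('p, 'e::euclidean_space) atlas \<Rightarrow> ('q, 'f::euclidean_space) atlas \<Rightarrow> ('p \<Rightarrow> 'q) \<Rightarrow> bool" where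
  "smooth_map M N f \<longleftrightarrow> f ` points M \<subseteq> points N \<and>
     (\<forall>c\<in>M. \<forall>d\<in>N. let S = chart_map c ` (chart_dom c \<inter> f -` chart_dom d) in
        open S \<and> smooth_on S (chart_map d \<circ> f \<circ> chart_inv c))"

definition diffeomorphism ::
  "('p, 'e::euclidean_space) atlas \<Rightarrow> ('q, 'f::euclidean_space) atlas \<Rightarrow> ('p \<Rightarrow> 'q) \<Rightarrow> bool" where
  "diffeomorphism M N f \<longleftrightarrow> bij_betw f (points M) (points N) \<and>
     smooth_map M N f \<and> smooth_map N M (inv_into (points M) f)"

definition euclidean_atlas :: "('e, 'e::euclidean_space) atlas" where
  "euclidean_atlas = {(UNIV, \<lambda>x. x)}"

definition open_submanifold :: "('p, 'e) atlas \<Rightarrow> 'p set \<Rightarrow> ('p, 'e) atlas" where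
  "open_submanifold M U = (\<lambda>c. (chart_dom c \<inter> U, chart_map c)) ` M"

definition product_atlas :: "('p, 'e) atlas \<Rightarrow> ('q, 'f) atlas \<Rightarrow> ('p \<times> 'q, 'e \<times> 'f) atlas" where
  "product_atlas M N =
     (\<lambda>(c, d). (chart_dom c \<times> chart_dom d, map_prod (chart_map c) (chart_map d))) ` (M \<times> N)"

definition smooth_functions :: "('p, 'e::euclidean_space) atlas \<Rightarrow> ('p \<Rightarrow> real) set" where
  "smooth_functions M = {f. smooth_map M euclidean_atlas f}"

definition chart_at :: "('p, 'e) atlas \<Rightarrow> 'p \<Rightarrow> ('p, 'e) chart" where
  "chart_at M p = (SOME c. c \<in> M \<and> p \<in> chart_dom c)"


section \<open>Tangent vectors and the tangent bundle\<close>

text \<open>A tangent vector at \<open>p\<close> is a family of coordinate vectors, one for each chart around \<open>p\<close>, which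
  are related by the derivatives of the transition maps. The family is set to 0 at all other
  arguments, so that a tangent vector is determined by its components.\<close>

definition tangent_space :: "('p, 'e::euclidean_space) atlas \<Rightarrow> 'p \<Rightarrow> (('p, 'e) chart \<Rightarrow> 'e) set" where
  "tangent_space M p = {v.
     (\<forall>c. \<not> (c \<in> M \<and> p \<in> chart_dom c) \<longrightarrow> v c = 0) \<and>
     (\<forall>c\<in>M. \<forall>d\<in>M. p \<in> chart_dom c \<inter> chart_dom d \<longrightarrow>
        v d = frechet_derivative (transition c d) (at (chart_map c p)) (v c))}"

text \<open>A point of the tangent bundle is a pair of a base point and a tangent vector there, so the
  bundle projection is \<open>fst\<close>.\<close>

type_synonym ('p, 'e) tvec = "'p \<times> (('p, 'e) chart \<Rightarrow> 'e)"

definition tangent_chart ::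
  "('p, 'e::euclidean_space) atlas \<Rightarrow> ('p, 'e) chart \<Rightarrow> (('p, 'e) tvec, 'e \<times> 'e) chart" where
  "tangent_chart M c = (Sigma (chart_dom c) (tangent_space M), \<lambda>(p, v). (chart_map c p, v c))"

definition tangent_manifold ::
  "('p, 'e::euclidean_space) atlas \<Rightarrow> (('p, 'e) tvec, 'e \<times> 'e) atlas" where
  "tangent_manifold M = tangent_chart M ` M"

text \<open>The tangent map and the action of a tangent vector on a function do not depend on the
  chart \<open>chart_at M p\<close> used to compute them.\<close>

definition tangent_map ::
  "('p, 'e::euclidean_space) atlas \<Rightarrow> ('q, 'f::euclidean_space) atlas \<Rightarrow> ('p \<Rightarrow> 'q) \<Rightarrow>
   ('p, 'e) tvec \<Rightarrow> ('q, 'f) tvec" where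
  "tangent_map M N f = (\<lambda>(p, v). (f p, \<lambda>d. if d \<in> N \<and> f p \<in> chart_dom d
     then let c = chart_at M p in
       frechet_derivative (chart_map d \<circ> f \<circ> chart_inv c) (at (chart_map c p)) (v c)
     else 0))"

definition derivation ::
  "('p, 'e::euclidean_space) atlas \<Rightarrow> ('p, 'e) tvec \<Rightarrow> ('p \<Rightarrow> real) \<Rightarrow> real" where
  "derivation M = (\<lambda>(p, v) f. let c = chart_at M p in
     frechet_derivative (f \<circ> chart_inv c) (at (chart_map c p)) (v c))"

definition velocity ::
  "('p, 'e::euclidean_space) atlas \<Rightarrow> (real \<Rightarrow> 'p) \<Rightarrow> real \<Rightarrow> ('p, 'e) tvec" where
  "velocity M \<gamma> t = (\<gamma> t, \<lambda>c. if c \<in> M \<and> \<gamma> t \<in> chart_dom c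
     then vector_derivative (chart_map c \<circ> \<gamma>) (at t) else 0)"


section \<open>Vector bundles\<close>

text \<open>The total space of a bundle of fibre type \<open>'f\<close> over a manifold modelled on \<open>'e\<close> is modelled on
  \<open>'e \<times> 'f\<close>. The fibre operations are only meaningful on vectors of the same fibre.\<close>

record ('q, 'e, 't, 'f) vbundle =
  vb_base :: "('q, 'e) atlas"
  vb_total :: "('t, 'e \<times> 'f) atlas"
  vb_proj :: "'t \<Rightarrow> 'q"
  vb_zero :: "'q \<Rightarrow> 't"
  vb_add :: "'t \<Rightarrow> 't \<Rightarrow> 't"
  vb_scale :: "real \<Rightarrow> 't \<Rightarrow> 't"

definition vb_fibre :: "('q, 'e, 't, 'f) vbundle \<Rightarrow> 'q \<Rightarrow> 't set" where
  "vb_fibre E p = {x \<in> points (vb_total E). vb_proj E x = p}"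

text \<open>In a local trivialization \<open>x \<mapsto> (vb_proj E x, \<Phi> x)\<close> over \<open>U\<close>, the map \<open>\<Phi>\<close> is a
  bijection from each fibre onto \<open>'f\<close>; as it respects the operations, the fibres are real
  vector spaces and \<open>\<Phi>\<close> is a fibrewise linear isomorphism.\<close>

definition local_trivialization ::
  "('q, 'e::euclidean_space, 't, 'f::euclidean_space) vbundle \<Rightarrow> 'q set \<Rightarrow> ('t \<Rightarrow> 'f) \<Rightarrow> bool" where
  "local_trivialization E U \<Phi> \<longleftrightarrow>
     openin (manifold_topology (vb_base E)) U \<and>
     diffeomorphism (open_submanifold (vb_total E) (vb_proj E -` U))
       (product_atlas (open_submanifold (vb_base E) U) euclidean_atlas)
       (\<lambda>x. (vb_proj E x, \<Phi> x)) \<and>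
     (\<forall>p\<in>U. \<Phi> (vb_zero E p) = 0 \<and>
        (\<forall>x\<in>vb_fibre E p. \<forall>y\<in>vb_fibre E p. \<Phi> (vb_add E x y) = \<Phi> x + \<Phi> y) \<and>
        (\<forall>x\<in>vb_fibre E p. \<forall>a. \<Phi> (vb_scale E a x) = a *\<^sub>R \<Phi> x))"

definition vector_bundle ::
  "('q, 'e::euclidean_space, 't, 'f::euclidean_space) vbundle \<Rightarrow> bool" where
  "vector_bundle E \<longleftrightarrow>
     smooth_manifold (vb_base E) \<and> smooth_manifold (vb_total E) \<and>
     smooth_map (vb_total E) (vb_base E) (vb_proj E) \<and>
     (\<forall>p\<in>points (vb_base E). vb_zero E p \<in> vb_fibre E p \<and>
        (\<forall>x\<in>vb_fibre E p. \<forall>y\<in>vb_fibre E p. vb_add E x y \<in> vb_fibre E p) \<and>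
        (\<forall>x\<in>vb_fibre E p. \<forall>a. vb_scale E a x \<in> vb_fibre E p)) \<and>
     (\<forall>p\<in>points (vb_base E). \<exists>U \<Phi>. p \<in> U \<and> local_trivialization E U \<Phi>)"

definition vb_diff :: "('q, 'e, 't, 'f) vbundle \<Rightarrow> 't \<Rightarrow> 't \<Rightarrow> 't" where
  "vb_diff E x y = vb_add E x (vb_scale E (-1) y)"

text \<open>Vector bundle maps over the identity of the base.\<close>

definition vbundle_map ::
  "('q, 'e::euclidean_space, 't, 'f::euclidean_space) vbundle \<Rightarrow>
   ('q, 'e, 's, 'g::euclidean_space) vbundle \<Rightarrow> ('t \<Rightarrow> 's) \<Rightarrow> bool" where
  "vbundle_map E F h \<longleftrightarrow> vb_base F = vb_base E \<and> smooth_map (vb_total E) (vb_total F) h \<and>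
     (\<forall>x\<in>points (vb_total E). vb_proj F (h x) = vb_proj E x) \<and>
     (\<forall>p\<in>points (vb_base E).
        (\<forall>x\<in>vb_fibre E p. \<forall>y\<in>vb_fibre E p. h (vb_add E x y) = vb_add F (h x) (h y)) \<and>
        (\<forall>x\<in>vb_fibre E p. \<forall>a. h (vb_scale E a x) = vb_scale F a (h x)))"

text \<open>Sections are extensional functions on the base, so that two sections with the same values on
  the base are equal.\<close>

definition sections :: "('q, 'e::euclidean_space, 't, 'f::euclidean_space) vbundle \<Rightarrow> ('q \<Rightarrow> 't) set" where
  "sections E = {A \<in> extensional (points (vb_base E)).
     smooth_map (vb_base E) (vb_total E) A \<and> (\<forall>p\<in>points (vb_base E). vb_proj E (A p) = p)}"

definition sec_zero :: "('q, 'e, 't, 'f) vbundle \<Rightarrow> 'q \<Rightarrow> 't" where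
  "sec_zero E = restrict (vb_zero E) (points (vb_base E))"

definition sec_add :: "('q, 'e, 't, 'f) vbundle \<Rightarrow> ('q \<Rightarrow> 't) \<Rightarrow> ('q \<Rightarrow> 't) \<Rightarrow> 'q \<Rightarrow> 't" where
  "sec_add E A B = (\<lambda>p\<in>points (vb_base E). vb_add E (A p) (B p))"

definition sec_mult :: "('q, 'e, 't, 'f) vbundle \<Rightarrow> ('q \<Rightarrow> real) \<Rightarrow> ('q \<Rightarrow> 't) \<Rightarrow> 'q \<Rightarrow> 't" where
  "sec_mult E f A = (\<lambda>p\<in>points (vb_base E). vb_scale E (f p) (A p))"

definition sec_scale :: "('q, 'e, 't, 'f) vbundle \<Rightarrow> real \<Rightarrow> ('q \<Rightarrow> 't) \<Rightarrow> 'q \<Rightarrow> 't" where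
  "sec_scale E a A = sec_mult E (\<lambda>_. a) A"

definition sec_diff :: "('q, 'e, 't, 'f) vbundle \<Rightarrow> ('q \<Rightarrow> 't) \<Rightarrow> ('q \<Rightarrow> 't) \<Rightarrow> 'q \<Rightarrow> 't" where
  "sec_diff E A B = sec_add E A (sec_scale E (-1) B)"

definition sec_apply :: "('q, 'e, 't, 'f) vbundle \<Rightarrow> ('t \<Rightarrow> 's) \<Rightarrow> ('q \<Rightarrow> 't) \<Rightarrow> 'q \<Rightarrow> 's" where
  "sec_apply E h A = (\<lambda>p\<in>points (vb_base E). h (A p))"

definition tangent_bundle ::
  "('p, 'e::euclidean_space) atlas \<Rightarrow> ('p, 'e, ('p, 'e) tvec, 'e) vbundle" where
  "tangent_bundle M = \<lparr>
     vb_base = M,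
     vb_total = tangent_manifold M,
     vb_proj = fst,
     vb_zero = (\<lambda>p. (p, \<lambda>_. 0)),
     vb_add = (\<lambda>(p, v) (_, w). (p, \<lambda>c. v c + w c)),
     vb_scale = (\<lambda>a (p, v). (p, \<lambda>c. a *\<^sub>R v c))\<rparr>"

abbreviation vector_fields ::
  "('p, 'e::euclidean_space) atlas \<Rightarrow> ('p \<Rightarrow> ('p, 'e) tvec) set" where
  "vector_fields M \<equiv> sections (tangent_bundle M)"


section \<open>Brackets of vector fields\<close>

text \<open>The Lie bracket: \<open>[X,Y]\<^sub>p f = X\<^sub>p(Yf) - Y\<^sub>p(Xf)\<close> for all smooth functions \<open>f\<close> on open
  neighbourhoods of \<open>p\<close>.\<close>

definition lie_bracket ::
  "('p, 'e::euclidean_space) atlas \<Rightarrow> ('p \<Rightarrow> ('p, 'e) tvec) \<Rightarrow> ('p \<Rightarrow> ('p, 'e) tvec) \<Rightarrow>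
   'p \<Rightarrow> ('p, 'e) tvec" where
  "lie_bracket M X Y = (\<lambda>p\<in>points M. THE \<xi>. \<xi> \<in> vb_fibre (tangent_bundle M) p \<and>
     (\<forall>U f. openin (manifold_topology M) U \<and> p \<in> U \<and> f \<in> smooth_functions (open_submanifold M U) \<longrightarrow>
        derivation M \<xi> f =
          derivation M (X p) (\<lambda>x. derivation M (Y x) f) -
          derivation M (Y p) (\<lambda>x. derivation M (X x) f)))"

definition contracted_bracket ::
  "('p, 'e::euclidean_space) atlas \<Rightarrow> (('p, 'e) tvec \<Rightarrow> ('p, 'e) tvec) \<Rightarrow>
   ('p \<Rightarrow> ('p, 'e) tvec) \<Rightarrow> ('p \<Rightarrow> ('p, 'e) tvec) \<Rightarrow> 'p \<Rightarrow> ('p, 'e) tvec" where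
  "contracted_bracket M N A B =
     (let E = tangent_bundle M; NN = sec_apply E N in
      sec_diff E (sec_add E (lie_bracket M (NN A) B) (lie_bracket M A (NN B)))
        (NN (lie_bracket M A B)))"

definition nijenhuis_torsion ::
  "('p, 'e::euclidean_space) atlas \<Rightarrow> (('p, 'e) tvec \<Rightarrow> ('p, 'e) tvec) \<Rightarrow>
   ('p \<Rightarrow> ('p, 'e) tvec) \<Rightarrow> ('p \<Rightarrow> ('p, 'e) tvec) \<Rightarrow> 'p \<Rightarrow> ('p, 'e) tvec" where
  "nijenhuis_torsion M N A B =
     (let E = tangent_bundle M; NN = sec_apply E N in
      sec_add E
        (sec_diff E
          (sec_diff E (lie_bracket M (NN A) (NN B)) (NN (lie_bracket M (NN A) B)))
          (NN (lie_bracket M A (NN B))))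
        (NN (NN (lie_bracket M A B))))"


section \<open>Lie algebroids\<close>

definition lie_algebra_on_sections ::
  "('q, 'e::euclidean_space, 't, 'f::euclidean_space) vbundle \<Rightarrow>
   (('q \<Rightarrow> 't) \<Rightarrow> ('q \<Rightarrow> 't) \<Rightarrow> 'q \<Rightarrow> 't) \<Rightarrow> bool" where
  "lie_algebra_on_sections E br \<longleftrightarrow>
     (\<forall>A\<in>sections E. \<forall>B\<in>sections E. br A B \<in> sections E) \<and>
     (\<forall>A\<in>sections E. \<forall>B\<in>sections E. \<forall>C\<in>sections E.
        br (sec_add E A B) C = sec_add E (br A C) (br B C) \<and>
        br C (sec_add E A B) = sec_add E (br C A) (br C B)) \<and>
     (\<forall>A\<in>sections E. \<forall>B\<in>sections E. \<forall>a.
        br (sec_scale E a A) B = sec_scale E a (br A B) \<and>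
        br A (sec_scale E a B) = sec_scale E a (br A B)) \<and>
     (\<forall>A\<in>sections E. br A A = sec_zero E) \<and>
     (\<forall>A\<in>sections E. \<forall>B\<in>sections E. \<forall>C\<in>sections E.
        sec_add E (br A (br B C)) (sec_add E (br B (br C A)) (br C (br A B))) = sec_zero E)"

definition lie_algebroid ::
  "('q, 'e::euclidean_space, 't, 'f::euclidean_space) vbundle \<Rightarrow> ('t \<Rightarrow> ('q, 'e) tvec) \<Rightarrow>
   (('q \<Rightarrow> 't) \<Rightarrow> ('q \<Rightarrow> 't) \<Rightarrow> 'q \<Rightarrow> 't) \<Rightarrow> bool" where
  "lie_algebroid E q br \<longleftrightarrow>
     vector_bundle E \<and>
     vbundle_map E (tangent_bundle (vb_base E)) q \<and>
     lie_algebra_on_sections E br \<and>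
     (\<forall>A\<in>sections E. \<forall>B\<in>sections E. \<forall>f\<in>smooth_functions (vb_base E).
        br A (sec_mult E f B) =
          sec_add E (sec_mult E f (br A B))
            (sec_mult E (\<lambda>p. derivation (vb_base E) (q (A p)) f) B))"


section \<open>Connections on the tangent bundle\<close>

text \<open>Points of the second tangent bundle are pairs whose first component is the foot point in the
  tangent bundle, so \<open>\<tau>\<close> is \<open>fst\<close>, as is \<open>\<pi>\<close> one level below.\<close>

definition tt_split ::
  "('p, 'e::euclidean_space) atlas \<Rightarrow> (('p, 'e) tvec, 'e \<times> 'e) tvec \<Rightarrow> ('p, 'e) tvec \<times> ('p, 'e) tvec" where
  "tt_split M \<xi> = (fst \<xi>, tangent_map (tangent_manifold M) M fst \<xi>)"

definition vertical_lift ::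
  "('p, 'e::euclidean_space) atlas \<Rightarrow> ('p, 'e) tvec \<times> ('p, 'e) tvec \<Rightarrow> (('p, 'e) tvec, 'e \<times> 'e) tvec" where
  "vertical_lift M = (\<lambda>(u, w). velocity (tangent_manifold M)
     (\<lambda>t. vb_add (tangent_bundle M) u (vb_scale (tangent_bundle M) t w)) 0)"

definition vertical_endomorphism ::
  "('p, 'e::euclidean_space) atlas \<Rightarrow> (('p, 'e) tvec, 'e \<times> 'e) tvec \<Rightarrow> (('p, 'e) tvec, 'e \<times> 'e) tvec" where
  "vertical_endomorphism M = vertical_lift M \<circ> tt_split M"

definition tm_connection ::
  "('p, 'e::euclidean_space) atlas \<Rightarrow>
   ((('p, 'e) tvec, 'e \<times> 'e) tvec \<Rightarrow> (('p, 'e) tvec, 'e \<times> 'e) tvec) \<Rightarrow> bool" where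
  "tm_connection M \<Gamma> \<longleftrightarrow>
     (let TTM = tangent_bundle (tangent_manifold M); J = vertical_endomorphism M in
      vbundle_map TTM TTM \<Gamma> \<and>
      (\<forall>\<xi>\<in>points (vb_total TTM). J (\<Gamma> \<xi>) = J \<xi> \<and> J \<xi> = vb_scale TTM (-1) (\<Gamma> (J \<xi>))))"

end

theory Submission
  imports Defs "HOL-Library.Function_Algebras"
begin

text \<open>The identity J \<open>\<circ>\<close> \<open>\<Gamma>\<close> = J says that \<open>\<Gamma>\<close> - 1 takes vertical values, and \<open>\<Gamma>\<close> \<open>\<circ>\<close> J = -J
  that \<open>\<Gamma>\<close> is -1 on vertical vectors. Hence \<open>\<Gamma>\<close> is an involution, and v = (1 - \<open>\<Gamma>\<close>)/2 and
  h = (1 + \<open>\<Gamma>\<close>)/2 are complementary projections with v onto the vertical subbundle. Substituting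
  \<open>\<Gamma>\<close> = h - v turns the bracket of the theorem into
  [vA, vB] + h[vA, B] + h[A, vB]. Vertical fields are closed under the Lie bracket, so
  h[vA, vB] = 0. The bracket is therefore the semidirect product of the Lie algebra of vertical
  fields with the horizontal fields, on which it acts through the flat Bott connection
  (V, H) \<open>\<mapsto>\<close> h[V, H]; this gives the Jacobi identity, and the Leibniz rule holds with anchor v
  because hv = 0.\<close>


section \<open>Calculus of smooth maps\<close>

text \<open>The Lie bracket is given by a definite description, through its action on functions, so
  its basic laws are obtained in coordinates once the described vector is known to exist and to be
  unique. As the test functions live on open neighbourhoods, the coordinate functions of one chart
  separate tangent vectors and no cut-off functions occur. Vertical vectors are recognised in a
  tangent chart by a vanishing first component. For a vertical field this component is identically
  zero on the chart, hence so is its derivative, which is why brackets of vertical fields stay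
  vertical. The identity \<open>\<Gamma> \<circ> J = -J\<close> speaks only of the image of J; it
  reaches every vertical vector because J reads (a, b) \<mapsto> (0, a) in coordinates. The
  algebraic half asks only for an involution whose (-1)-eigenbundle is closed under the bracket. The
  factor 1/4 of the torsion is the product of two factors 1/2, one from each v or h in the three
  terms of the projected bracket.\<close>

lemma second_difference_mean_value:
  fixes f :: "'a::real_normed_vector \<Rightarrow> real"
  assumes t: "t > 0"
    and r: "\<And>a b. \<lbrakk>0 \<le> a; a \<le> t; 0 \<le> b; b \<le> t\<rbrakk> \<Longrightarrow> x + a *\<^sub>R u + b *\<^sub>R v \<in> S"
    and f: "\<And>y. y \<in> S \<Longrightarrow> (f has_derivative f' y) (at y)"
    and fu: "\<And>y. y \<in> S \<Longrightarrow> ((\<lambda>z. f' z u) has_derivative f'' y) (at y)"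
  obtains a b where "0 \<le> a" "a \<le> t" "0 \<le> b" "b \<le> t"
    "f (x + t *\<^sub>R u + t *\<^sub>R v) - f (x + t *\<^sub>R u) - f (x + t *\<^sub>R v) + f x
       = t * t * f'' (x + a *\<^sub>R u + b *\<^sub>R v) v"
proof -
  \<comment> \<open>The mean value theorem is used twice: in \<open>a\<close> for this difference of
    values, and in \<open>b\<close> for the derivative along \<open>u\<close> that results. The
    summand \<open>0 *\<^sub>R v\<close> keeps both terms in the shape of the fact \<open>*\<close>
    below, at \<open>b = t\<close> and \<open>b = 0\<close>.\<close>
  define g where "g a = f (x + a *\<^sub>R u + t *\<^sub>R v) - f (x + a *\<^sub>R u + 0 *\<^sub>R v)" for a
  have g: "(g has_real_derivative f' (x + a *\<^sub>R u + t *\<^sub>R v) u - f' (x + a *\<^sub>R u + 0 *\<^sub>R v) u) (at a)"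
    if "0 \<le> a" "a \<le> t" for a
  proof -
    have *: "((\<lambda>a. f (x + a *\<^sub>R u + b *\<^sub>R v)) has_real_derivative f' (x + a *\<^sub>R u + b *\<^sub>R v) u) (at a)"
      if "0 \<le> b" "b \<le> t" for b
    proof -
      have F: "(f has_derivative f' (x + a *\<^sub>R u + b *\<^sub>R v)) (at (x + a *\<^sub>R u + b *\<^sub>R v))"
        using f r that \<open>0 \<le> a\<close> \<open>a \<le> t\<close> by blast
      have "((\<lambda>a. x + a *\<^sub>R u + b *\<^sub>R v) has_derivative (\<lambda>h. h *\<^sub>R u)) (at a)"
        by (auto intro!: derivative_eq_intros)
      note has_derivative_compose[OF this F]
      moreover have "(\<lambda>h. f' (x + a *\<^sub>R u + b *\<^sub>R v) (h *\<^sub>R u)) = (*) (f' (x + a *\<^sub>R u + b *\<^sub>R v) u)"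
        by (rule ext) (simp add: linear_cmul[OF has_derivative_linear[OF F]] mult.commute)
      ultimately show ?thesis unfolding has_field_derivative_def by simp
    qed
    show ?thesis unfolding g_def using t by (intro DERIV_diff *) auto
  qed
  have "\<exists>a. 0 < a \<and> a < t \<and> g t - g 0 = (t - 0) * (f' (x + a *\<^sub>R u + t *\<^sub>R v) u - f' (x + a *\<^sub>R u + 0 *\<^sub>R v) u)"
    by (rule MVT2[OF t g])
  then obtain a where a: "0 < a" "a < t"
    "g t - g 0 = t * (f' (x + a *\<^sub>R u + t *\<^sub>R v) u - f' (x + a *\<^sub>R u + 0 *\<^sub>R v) u)" by auto
  have h: "((\<lambda>b. f' (x + a *\<^sub>R u + b *\<^sub>R v) u) has_real_derivative f'' (x + a *\<^sub>R u + b *\<^sub>R v) v) (at b)"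
    if "0 \<le> b" "b \<le> t" for b
  proof -
    have F: "((\<lambda>z. f' z u) has_derivative f'' (x + a *\<^sub>R u + b *\<^sub>R v)) (at (x + a *\<^sub>R u + b *\<^sub>R v))"
      using fu r that a by auto
    have "((\<lambda>b. x + a *\<^sub>R u + b *\<^sub>R v) has_derivative (\<lambda>h. h *\<^sub>R v)) (at b)"
      by (auto intro!: derivative_eq_intros)
    note has_derivative_compose[OF this F]
    moreover have "(\<lambda>h. f'' (x + a *\<^sub>R u + b *\<^sub>R v) (h *\<^sub>R v)) = (*) (f'' (x + a *\<^sub>R u + b *\<^sub>R v) v)"
      by (rule ext) (simp add: linear_cmul[OF has_derivative_linear[OF F]] mult.commute)
    ultimately show ?thesis unfolding has_field_derivative_def by simp
  qed
  obtain b where b: "0 < b" "b < t"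
    "f' (x + a *\<^sub>R u + t *\<^sub>R v) u - f' (x + a *\<^sub>R u + 0 *\<^sub>R v) u
       = (t - 0) * f'' (x + a *\<^sub>R u + b *\<^sub>R v) v"
    using MVT2[OF t h] by blast
  show thesis
    using a b that[of a b] unfolding g_def by (auto simp: algebra_simps)
qed

text \<open>The second difference over the parallelogram with sides t u and t v is symmetric in u
  and v. The mean value theorem evaluates it in both orders as t * t times a mixed derivative at a
  point near x, and continuity of the mixed derivatives at x forces equality.\<close>

lemma second_derivative_symmetric_real:
  fixes f :: "'a::real_normed_vector \<Rightarrow> real"
  assumes S: "open S" "x \<in> S"
    and f: "\<And>y. y \<in> S \<Longrightarrow> (f has_derivative f' y) (at y)"
    and fu: "\<And>y. y \<in> S \<Longrightarrow> ((\<lambda>z. f' z u) has_derivative fu y) (at y)"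
    and fv: "\<And>y. y \<in> S \<Longrightarrow> ((\<lambda>z. f' z v) has_derivative fv y) (at y)"
    and cu: "continuous_on S (\<lambda>y. fu y v)" and cv: "continuous_on S (\<lambda>y. fv y u)"
  shows "fu x v = fv x u"
proof (rule ccontr)
  assume "fu x v \<noteq> fv x u"
  define e where "e = \<bar>fu x v - fv x u\<bar> / 2"
  have e: "e > 0" using \<open>fu x v \<noteq> fv x u\<close> by (simp add: e_def)
  obtain d0 where d0: "d0 > 0" "\<And>y. dist y x < d0 \<Longrightarrow> y \<in> S"
    using S openE by (metis dist_commute mem_ball subsetD)
  obtain d1 where d1: "d1 > 0" "\<And>y. y \<in> S \<Longrightarrow> dist y x < d1 \<Longrightarrow> dist (fu y v) (fu x v) < e"
    using cu S e unfolding continuous_on_iff by metis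
  obtain d2 where d2: "d2 > 0" "\<And>y. y \<in> S \<Longrightarrow> dist y x < d2 \<Longrightarrow> dist (fv y u) (fv x u) < e"
    using cv S e unfolding continuous_on_iff by metis
  define d where "d = min d0 (min d1 d2)"
  have d: "d > 0" using d0 d1 d2 by (simp add: d_def)
  \<comment> \<open>Small enough for the parallelogram with sides t u and t v to stay in the ball of
    radius d about x; the summand 1 keeps the denominator positive.\<close>
  define t where "t = d / (norm u + norm v + 1)"
  have pos: "norm u + norm v + 1 > 0" by (smt (verit) norm_ge_zero)
  have t: "t > 0" using d pos by (simp add: t_def)
  have tn: "t * (norm u + norm v) < d"
    using d pos by (simp add: t_def field_simps)
  have near: "dist (x + a *\<^sub>R u + b *\<^sub>R v) x < d" "dist (x + b *\<^sub>R v + a *\<^sub>R u) x < d"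
    if "0 \<le> a" "a \<le> t" "0 \<le> b" "b \<le> t" for a b
  proof -
    have "norm (a *\<^sub>R u + b *\<^sub>R v) \<le> a * norm u + b * norm v"
      using norm_triangle_ineq[of "a *\<^sub>R u" "b *\<^sub>R v"] that by simp
    also have "\<dots> \<le> t * norm u + t * norm v"
      using that by (intro add_mono mult_right_mono) auto
    finally have "norm (a *\<^sub>R u + b *\<^sub>R v) < d" using tn by (simp add: algebra_simps)
    then show "dist (x + a *\<^sub>R u + b *\<^sub>R v) x < d" "dist (x + b *\<^sub>R v + a *\<^sub>R u) x < d"
      by (simp_all add: dist_norm add.commute add.left_commute)
  qed
  have inS: "x + a *\<^sub>R u + b *\<^sub>R v \<in> S" "x + b *\<^sub>R v + a *\<^sub>R u \<in> S"
    if "0 \<le> a" "a \<le> t" "0 \<le> b" "b \<le> t" for a b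
    using near[OF that] d0(2) by (auto simp: d_def)
  obtain a b where ab: "0 \<le> a" "a \<le> t" "0 \<le> b" "b \<le> t"
    "f (x + t *\<^sub>R u + t *\<^sub>R v) - f (x + t *\<^sub>R u) - f (x + t *\<^sub>R v) + f x
       = t * t * fu (x + a *\<^sub>R u + b *\<^sub>R v) v"
    by (rule second_difference_mean_value[OF t inS(1) f fu])
  obtain a' b' where ab': "0 \<le> a'" "a' \<le> t" "0 \<le> b'" "b' \<le> t"
    "f (x + t *\<^sub>R v + t *\<^sub>R u) - f (x + t *\<^sub>R v) - f (x + t *\<^sub>R u) + f x
       = t * t * fv (x + a' *\<^sub>R v + b' *\<^sub>R u) u"
    by (rule second_difference_mean_value[where u=v and v=u, OF t inS(2) f fv]) auto
  have comm: "x + t *\<^sub>R v + t *\<^sub>R u = x + t *\<^sub>R u + t *\<^sub>R v" by simp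
  have "t * t * fu (x + a *\<^sub>R u + b *\<^sub>R v) v = t * t * fv (x + a' *\<^sub>R v + b' *\<^sub>R u) u"
    using ab(5) ab'(5) unfolding comm by linarith
  then have eq: "fu (x + a *\<^sub>R u + b *\<^sub>R v) v = fv (x + a' *\<^sub>R v + b' *\<^sub>R u) u"
    using t by simp
  have "dist (fu (x + a *\<^sub>R u + b *\<^sub>R v) v) (fu x v) < e"
    using ab near(1)[of a b] by (intro d1(2) inS) (auto simp: d_def)
  moreover have "dist (fv (x + a' *\<^sub>R v + b' *\<^sub>R u) u) (fv x u) < e"
    using ab' near(2)[of b' a'] by (intro d2(2) inS) (auto simp: d_def)
  ultimately show False unfolding eq e_def dist_real_def by (auto simp: abs_if split: if_splits)
qed

section \<open>Closure properties of the classes C^k\<close>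

lemma Ck_on_cong:
  assumes "open S" "\<And>x. x \<in> S \<Longrightarrow> f x = g x" "Ck_on k S f"
  shows "Ck_on k S g"
  using assms(2,3)
proof (induction k arbitrary: f g)
  case 0
  then show ?case by (auto cong: continuous_on_cong)
next
  case (Suc k)
  have d: "f differentiable (at x)" if "x \<in> S" for x
    using Suc.prems(2) that assms(1) by (auto simp: differentiable_on_eq_differentiable_at)
  then have "g differentiable_on S"
    unfolding differentiable_on_eq_differentiable_at[OF assms(1)] frechet_derivative_works
    using Suc.prems(1) by (metis has_derivative_transform_within_open assms(1) frechet_derivative_works differentiableI)
  moreover have "frechet_derivative f (at x) = frechet_derivative g (at x)" if "x \<in> S" for x
    using frechet_derivative_transform_within_open[OF d assms(1) that] that Suc.prems(1) by blast
  ultimately show ?case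
    using Suc.prems Suc.IH[of "\<lambda>x. frechet_derivative f (at x) _" "\<lambda>x. frechet_derivative g (at x) _"]
    by auto
qed

lemma Ck_on_subset: "Ck_on k S f \<Longrightarrow> T \<subseteq> S \<Longrightarrow> Ck_on k T f"
  by (induction k arbitrary: f) (auto intro: continuous_on_subset differentiable_on_subset)

lemma Ck_on_locally:
  assumes "\<And>x. x \<in> S \<Longrightarrow> \<exists>T. open T \<and> x \<in> T \<and> Ck_on k T f"
  shows "Ck_on k S f"
  using assms
proof (induction k arbitrary: f)
  case 0
  then show ?case
    by (metis Ck_on.simps(1) continuous_at_imp_continuous_on continuous_on_eq_continuous_at)
next
  case (Suc k)
  have "f differentiable_on S"
    using Suc.prems unfolding Ck_on.simps
    by (metis differentiable_at_imp_differentiable_on differentiable_on_eq_differentiable_at)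
  moreover have "Ck_on k S (\<lambda>x. frechet_derivative f (at x) v)" for v
    by (rule Suc.IH) (use Suc.prems in \<open>auto simp: Bex_def; blast\<close>)
  ultimately show ?case by simp
qed

lemma Ck_on_Suc_D: "Ck_on (Suc k) S f \<Longrightarrow> Ck_on k S f"
  by (induction k arbitrary: f) (auto intro: differentiable_imp_continuous_on)

lemma Ck_on_has_derivative:
  assumes "Ck_on (Suc k) S f" "open S" "x \<in> S"
  shows "(f has_derivative frechet_derivative f (at x)) (at x)"
  using assms by (simp add: differentiable_on_eq_differentiable_at frechet_derivative_works)

text \<open>Lets an explicit derivative replace the chosen \<open>frechet_derivative\<close>, so
  that each closure property below becomes an induction on \<open>k\<close> whose step is the
  corresponding rule of differentiation.\<close>

lemma Ck_on_SucI:
  assumes S: "open S" and "\<And>x. x \<in> S \<Longrightarrow> (f has_derivative f' x) (at x)"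
    and "\<And>v. Ck_on k S (\<lambda>x. f' x v)"
  shows "Ck_on (Suc k) S f"
proof -
  have "frechet_derivative f (at x) = f' x" if "x \<in> S" for x
    using frechet_derivative_at assms(2) that by metis
  then have "Ck_on k S (\<lambda>x. frechet_derivative f (at x) v)" for v
    by (intro Ck_on_cong[OF S _ assms(3)]) auto
  moreover have "f differentiable_on S"
    using assms(2) by (meson differentiable_at_imp_differentiable_on differentiableI)
  ultimately show ?thesis by simp
qed

lemma Ck_on_const: "open S \<Longrightarrow> Ck_on k S (\<lambda>x. c)"
  by (induction k arbitrary: c) (auto simp: differentiable_on_const)

lemma Ck_on_linear:
  fixes h :: "'b::real_normed_vector \<Rightarrow> 'c::real_normed_vector"
  assumes S: "open S" and h: "bounded_linear h" and f: "Ck_on k S f"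
  shows "Ck_on k S (\<lambda>x. h (f x))"
  using f
proof (induction k arbitrary: f)
  case 0
  then show ?case by (simp add: bounded_linear.continuous_on[OF h])
next
  case (Suc k)
  then show ?case
    by (intro Ck_on_SucI[OF S, where f'="\<lambda>x v. h (frechet_derivative f (at x) v)"]
        bounded_linear.has_derivative[OF h] Ck_on_has_derivative[OF Suc.prems S] Suc.IH) auto
qed

lemma Ck_on_id: "open S \<Longrightarrow> Ck_on k S (\<lambda>x. x)"
  by (cases k) (auto simp: Ck_on_const differentiable_on_id[unfolded id_def] simp del: Ck_on.simps
      intro!: Ck_on_SucI[where f'="\<lambda>x v. v"] has_derivative_ident, simp)

lemma Ck_on_add:
  assumes S: "open S" and "Ck_on k S f" "Ck_on k S g"
  shows "Ck_on k S (\<lambda>x. f x + g x)"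
  using assms(2,3)
proof (induction k arbitrary: f g)
  case 0
  then show ?case by (simp add: continuous_on_add)
next
  case (Suc k)
  have "((\<lambda>x. f x + g x) has_derivative
      (\<lambda>v. frechet_derivative f (at x) v + frechet_derivative g (at x) v)) (at x)" if "x \<in> S" for x
    using Ck_on_has_derivative[OF Suc.prems(1) S that] Ck_on_has_derivative[OF Suc.prems(2) S that]
    by (rule has_derivative_add)
  moreover have "Ck_on k S (\<lambda>x. frechet_derivative f (at x) v + frechet_derivative g (at x) v)" for v
    using Suc.prems by (intro Suc.IH) auto
  ultimately show ?case by (rule Ck_on_SucI[OF S])
qed

lemma Ck_on_sum:
  assumes S: "open S" and "\<And>i. i \<in> I \<Longrightarrow> Ck_on k S (f i)"
  shows "Ck_on k S (\<lambda>x. \<Sum>i\<in>I. f i x)"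
  using assms(2)
  by (induction I rule: infinite_finite_induct) (auto intro: Ck_on_const Ck_on_add S)

text \<open>Each summand of the product rule leaves one factor undifferentiated, so the induction
  step needs that factor at the lower order too; this is what \<open>Ck_on_Suc_D\<close>
  supplies.\<close>

lemma Ck_on_bilinear:
  assumes S: "open S" and p: "bounded_bilinear p" and "Ck_on k S f" "Ck_on k S g"
  shows "Ck_on k S (\<lambda>x. p (f x) (g x))"
  using assms(3,4)
proof (induction k arbitrary: f g)
  case 0
  then show ?case by (simp add: bounded_bilinear.continuous_on[OF p])
next
  case (Suc k)
  let ?D = "\<lambda>x v. p (f x) (frechet_derivative g (at x) v) + p (frechet_derivative f (at x) v) (g x)"
  have "((\<lambda>x. p (f x) (g x)) has_derivative ?D x) (at x)" if "x \<in> S" for x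
    using Ck_on_has_derivative[OF Suc.prems(1) S that] Ck_on_has_derivative[OF Suc.prems(2) S that]
    by (rule bounded_bilinear.FDERIV[OF p])
  moreover have "Ck_on k S (\<lambda>x. ?D x v)" for v
    using Suc.prems Suc.prems[THEN Ck_on_Suc_D] by (intro Ck_on_add[OF S] Suc.IH) auto
  ultimately show ?case by (rule Ck_on_SucI[OF S])
qed

lemma linear_euclidean_expand:
  fixes h :: "'b::euclidean_space \<Rightarrow> 'c::real_vector"
  assumes "linear h"
  shows "h w = (\<Sum>b\<in>Basis. (w \<bullet> b) *\<^sub>R h b)"
proof -
  have "h w = h (\<Sum>b\<in>Basis. (w \<bullet> b) *\<^sub>R b)" by (simp add: euclidean_representation)
  also have "\<dots> = (\<Sum>b\<in>Basis. h ((w \<bullet> b) *\<^sub>R b))" by (rule linear_sum[OF assms])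
  finally show ?thesis by (simp add: linear_scale[OF assms])
qed

lemma Ck_on_compose:
  fixes f :: "'a::euclidean_space \<Rightarrow> 'b::euclidean_space"
  assumes S: "open S" and T: "open T"
    and "Ck_on k T g" "Ck_on k S f" "f ` S \<subseteq> T"
  shows "Ck_on k S (\<lambda>x. g (f x))"
  using assms(3-)
proof (induction k arbitrary: f g)
  case 0
  then show ?case by (auto intro: continuous_on_compose2)
next
  case (Suc k)
  \<comment> \<open>The chain rule in matrix form: expanding over the basis separates the moving
    direction from the moving base point. What remains are scalar products of C^k functions and
    compositions of a directional derivative of \<open>g\<close> with \<open>f\<close>, to which the
    induction hypothesis applies.\<close>
  let ?D = "\<lambda>x v. \<Sum>b\<in>Basis. (frechet_derivative f (at x) v \<bullet> b) *\<^sub>R frechet_derivative g (at (f x)) b"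
  have "((\<lambda>x. g (f x)) has_derivative ?D x) (at x)" if "x \<in> S" for x
  proof -
    have g: "(g has_derivative frechet_derivative g (at (f x))) (at (f x))"
      using Suc.prems that by (intro Ck_on_has_derivative[OF _ T]) auto
    have f: "(f has_derivative frechet_derivative f (at x)) (at x)"
      using Suc.prems that by (intro Ck_on_has_derivative[OF _ S]) auto
    show ?thesis
      using has_derivative_compose[OF f g]
      by (subst (asm) linear_euclidean_expand[OF has_derivative_linear[OF g]])
  qed
  moreover have "Ck_on k S (\<lambda>x. ?D x v)" for v
    using Suc.prems Ck_on_Suc_D[OF Suc.prems(2)]
    by (intro Ck_on_sum[OF S] Ck_on_bilinear[OF S bounded_bilinear_scaleR]
        Ck_on_linear[OF S bounded_linear_inner_left] Suc.IH) auto
  ultimately show ?case by (rule Ck_on_SucI[OF S])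
qed

section \<open>Smooth functions on open sets\<close>

lemma smooth_on_cong: "open S \<Longrightarrow> (\<And>x. x \<in> S \<Longrightarrow> f x = g x) \<Longrightarrow> smooth_on S f \<Longrightarrow> smooth_on S g"
  unfolding smooth_on_def using Ck_on_cong by blast

lemma smooth_on_subset: "smooth_on S f \<Longrightarrow> T \<subseteq> S \<Longrightarrow> smooth_on T f"
  unfolding smooth_on_def using Ck_on_subset by blast

lemma smooth_on_locally:
  "(\<And>x. x \<in> S \<Longrightarrow> \<exists>T. open T \<and> x \<in> T \<and> smooth_on T f) \<Longrightarrow> smooth_on S f"
  unfolding smooth_on_def by (intro allI Ck_on_locally) metis

lemma smooth_on_const: "open S \<Longrightarrow> smooth_on S (\<lambda>x. c)"
  by (simp add: smooth_on_def Ck_on_const)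

lemma smooth_on_id: "open S \<Longrightarrow> smooth_on S (\<lambda>x. x)"
  by (simp add: smooth_on_def Ck_on_id)

lemma smooth_on_linear: "open S \<Longrightarrow> bounded_linear h \<Longrightarrow> smooth_on S f \<Longrightarrow> smooth_on S (\<lambda>x. h (f x))"
  by (simp add: smooth_on_def Ck_on_linear)

lemma smooth_on_add: "open S \<Longrightarrow> smooth_on S f \<Longrightarrow> smooth_on S g \<Longrightarrow> smooth_on S (\<lambda>x. f x + g x)"
  by (simp add: smooth_on_def Ck_on_add)

lemma smooth_on_sum:
  "open S \<Longrightarrow> (\<And>i. i \<in> I \<Longrightarrow> smooth_on S (f i)) \<Longrightarrow> smooth_on S (\<lambda>x. \<Sum>i\<in>I. f i x)"
  by (simp add: smooth_on_def Ck_on_sum)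

lemma smooth_on_scaleR: "open S \<Longrightarrow> smooth_on S f \<Longrightarrow> smooth_on S g \<Longrightarrow> smooth_on S (\<lambda>x. f x *\<^sub>R g x)"
  by (simp add: smooth_on_def Ck_on_bilinear[OF _ bounded_bilinear_scaleR])

lemma smooth_on_minus: "open S \<Longrightarrow> smooth_on S f \<Longrightarrow> smooth_on S (\<lambda>x. - f x)"
  by (rule smooth_on_linear[of S uminus]) (auto intro: bounded_linear_minus bounded_linear_ident)

lemma smooth_on_diff: "open S \<Longrightarrow> smooth_on S f \<Longrightarrow> smooth_on S g \<Longrightarrow> smooth_on S (\<lambda>x. f x - g x)"
  using smooth_on_add[of S f "\<lambda>x. - g x"] smooth_on_minus by fastforce

lemma smooth_on_Pair:
  assumes "open S" "smooth_on S f" "smooth_on S g"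
  shows "smooth_on S (\<lambda>x. (f x, g x))"
proof -
  have "smooth_on S (\<lambda>x. (f x, 0) + (0, g x))"
    by (intro smooth_on_add smooth_on_linear[of S "\<lambda>y. (y, 0)"] smooth_on_linear[of S "\<lambda>y. (0, y)"] assms
        bounded_linear_Pair bounded_linear_zero bounded_linear_ident)
  then show ?thesis by simp
qed

lemma smooth_on_fst: "open S \<Longrightarrow> smooth_on S f \<Longrightarrow> smooth_on S (\<lambda>x. fst (f x))"
  by (rule smooth_on_linear[OF _ bounded_linear_fst])

lemma smooth_on_snd: "open S \<Longrightarrow> smooth_on S f \<Longrightarrow> smooth_on S (\<lambda>x. snd (f x))"
  by (rule smooth_on_linear[OF _ bounded_linear_snd])

lemma smooth_on_compose:
  fixes f :: "'a::euclidean_space \<Rightarrow> 'b::euclidean_space"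
  assumes "open S" "open T" "smooth_on T g" "smooth_on S f" "f ` S \<subseteq> T"
  shows "smooth_on S (\<lambda>x. g (f x))"
  using assms Ck_on_compose unfolding smooth_on_def by blast

lemma smooth_on_has_derivative:
  assumes "smooth_on S f" "open S" "x \<in> S"
  shows "(f has_derivative frechet_derivative f (at x)) (at x)"
  using assms Ck_on_has_derivative unfolding smooth_on_def by blast

lemma smooth_on_imp_continuous_on: "smooth_on S f \<Longrightarrow> continuous_on S f"
  by (metis Ck_on.simps(1) smooth_on_def)

lemma smooth_on_frechet_derivative:
  "smooth_on S f \<Longrightarrow> smooth_on S (\<lambda>x. frechet_derivative f (at x) v)"
  unfolding smooth_on_def by (metis Ck_on.simps(2))

text \<open>Smoothness by definition controls derivatives in a fixed direction only. A direction
  that varies with the point is expanded over the basis, with smooth coefficients; transition maps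
  of the tangent atlas and coordinate brackets are of this kind.\<close>

lemma smooth_on_frechet_derivative_apply:
  fixes f :: "'a::euclidean_space \<Rightarrow> 'b::real_normed_vector"
    and g :: "'c::euclidean_space \<Rightarrow> 'a"
  assumes S: "open S" and T: "open T" and f: "smooth_on T f"
    and g: "smooth_on S g" "g ` S \<subseteq> T" and h: "smooth_on S h"
  shows "smooth_on S (\<lambda>x. frechet_derivative f (at (g x)) (h x))"
proof -
  have "smooth_on S (\<lambda>x. frechet_derivative f (at (g x)) b)" for b
    by (rule smooth_on_compose[OF S T smooth_on_frechet_derivative[OF f] g])
  then have "smooth_on S (\<lambda>x. \<Sum>b\<in>Basis. (h x \<bullet> b) *\<^sub>R frechet_derivative f (at (g x)) b)"
    by (intro smooth_on_sum S smooth_on_scaleR smooth_on_linear[OF S bounded_linear_inner_left h])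
  then show ?thesis
  proof (rule smooth_on_cong[OF S, rotated])
    fix x assume "x \<in> S"
    then have "linear (frechet_derivative f (at (g x)))"
      using smooth_on_has_derivative[OF f T] g by (blast intro: has_derivative_linear)
    then show "(\<Sum>b\<in>Basis. (h x \<bullet> b) *\<^sub>R frechet_derivative f (at (g x)) b)
      = frechet_derivative f (at (g x)) (h x)"
      by (metis linear_euclidean_expand)
  qed
qed

text \<open>Tested against each basis vector, because the mean value argument is one about
  real-valued functions.\<close>

lemma smooth_on_second_derivative_symmetric:
  fixes f :: "'a::euclidean_space \<Rightarrow> 'b::euclidean_space"
  assumes S: "open S" "x \<in> S" and f: "smooth_on S f"
  shows "frechet_derivative (\<lambda>y. frechet_derivative f (at y) u) (at x) v
       = frechet_derivative (\<lambda>y. frechet_derivative f (at y) v) (at x) u"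
proof (rule euclidean_eqI)
  fix b :: 'b assume "b \<in> Basis"
  have D2: "((\<lambda>y. frechet_derivative f (at y) w) has_derivative
      frechet_derivative (\<lambda>y. frechet_derivative f (at y) w) (at y)) (at y)" if "y \<in> S" for y w
    by (rule smooth_on_has_derivative[OF smooth_on_frechet_derivative[OF f] S(1) that])
  show "frechet_derivative (\<lambda>y. frechet_derivative f (at y) u) (at x) v \<bullet> b
      = frechet_derivative (\<lambda>y. frechet_derivative f (at y) v) (at x) u \<bullet> b"
  proof (rule second_derivative_symmetric_real[where f="\<lambda>y. f y \<bullet> b" and S=S
        and f'="\<lambda>y w. frechet_derivative f (at y) w \<bullet> b"
        and fu="\<lambda>y w. frechet_derivative (\<lambda>y. frechet_derivative f (at y) u) (at y) w \<bullet> b"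
        and fv="\<lambda>y w. frechet_derivative (\<lambda>y. frechet_derivative f (at y) v) (at y) w \<bullet> b"
        , OF S])
  qed (auto intro!: bounded_linear.has_derivative[OF bounded_linear_inner_left] D2 continuous_intros
        smooth_on_has_derivative[OF f S(1)] smooth_on_imp_continuous_on smooth_on_frechet_derivative f
        smooth_on_linear[OF S(1) bounded_linear_inner_left])
qed

section \<open>Atlases and transition maps\<close>

abbreviation chart_img :: "('p, 'e) chart \<Rightarrow> 'e set" where
  "chart_img c \<equiv> chart_map c ` chart_dom c"

lemma chart_inv_chart_map:
  "smooth_atlas M \<Longrightarrow> c \<in> M \<Longrightarrow> p \<in> chart_dom c \<Longrightarrow> chart_inv c (chart_map c p) = p"
  unfolding smooth_atlas_def chart_inv_def by (auto intro: inv_into_f_f)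

lemma chart_inv_in_dom: "y \<in> chart_img c \<Longrightarrow> chart_inv c y \<in> chart_dom c"
  unfolding chart_inv_def by (rule inv_into_into)

lemma chart_map_chart_inv: "y \<in> chart_img c \<Longrightarrow> chart_map c (chart_inv c y) = y"
  unfolding chart_inv_def by (rule f_inv_into_f)

lemma open_chart_img: "smooth_atlas M \<Longrightarrow> c \<in> M \<Longrightarrow> open (chart_img c)"
  by (simp add: smooth_atlas_def)

lemma chart_map_inj:
  "smooth_atlas M \<Longrightarrow> c \<in> M \<Longrightarrow> p \<in> chart_dom c \<Longrightarrow> q \<in> chart_dom c
    \<Longrightarrow> chart_map c p = chart_map c q \<longleftrightarrow> p = q"
  unfolding smooth_atlas_def by (auto dest: inj_onD)

lemma open_overlap:
  "smooth_atlas M \<Longrightarrow> c \<in> M \<Longrightarrow> d \<in> M \<Longrightarrow> open (chart_map c ` (chart_dom c \<inter> chart_dom d))"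
  by (simp add: smooth_atlas_def)

lemma smooth_on_transition:
  "smooth_atlas M \<Longrightarrow> c \<in> M \<Longrightarrow> d \<in> M
    \<Longrightarrow> smooth_on (chart_map c ` (chart_dom c \<inter> chart_dom d)) (transition c d)"
  by (simp add: smooth_atlas_def)

lemma transition_chart_map:
  "smooth_atlas M \<Longrightarrow> c \<in> M \<Longrightarrow> p \<in> chart_dom c \<Longrightarrow> transition c d (chart_map c p) = chart_map d p"
  by (simp add: transition_def chart_inv_chart_map)

lemma transition_has_derivative:
  assumes "smooth_atlas M" "c \<in> M" "d \<in> M" "p \<in> chart_dom c" "p \<in> chart_dom d"
  shows "(transition c d has_derivative frechet_derivative (transition c d) (at (chart_map c p)))
    (at (chart_map c p))"
  using smooth_on_has_derivative[OF smooth_on_transition open_overlap] assms by blast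

lemma linear_transition_derivative:
  assumes "smooth_atlas M" "c \<in> M" "d \<in> M" "p \<in> chart_dom c" "p \<in> chart_dom d"
  shows "linear (frechet_derivative (transition c d) (at (chart_map c p)))"
  using transition_has_derivative[OF assms] by (rule has_derivative_linear)

lemma transition_derivative_self:
  assumes "smooth_atlas M" "c \<in> M" "p \<in> chart_dom c"
  shows "frechet_derivative (transition c c) (at (chart_map c p)) w = w"
proof -
  have "((\<lambda>y. y) has_derivative (\<lambda>w. w)) (at (chart_map c p))" by (rule has_derivative_ident)
  then have "(transition c c has_derivative (\<lambda>w. w)) (at (chart_map c p))"
    by (rule has_derivative_transform_within_open[OF _ open_chart_img[OF assms(1,2)]])
      (use assms in \<open>auto simp: transition_chart_map\<close>)
  from frechet_derivative_at[OF this] show ?thesis by metis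
qed

text \<open>The cocycle condition behind the tangent bundle. It is the chain rule, since the two
  transitions compose to the direct one on the whole overlap of \<open>c\<close> and
  \<open>d\<close> and not only at p.\<close>

lemma transition_derivative_compose:
  assumes M: "smooth_atlas M" and c: "c \<in> M" "p \<in> chart_dom c"
    and d: "d \<in> M" "p \<in> chart_dom d" and e: "e \<in> M" "p \<in> chart_dom e"
  shows "frechet_derivative (transition d e) (at (chart_map d p))
      (frechet_derivative (transition c d) (at (chart_map c p)) w)
    = frechet_derivative (transition c e) (at (chart_map c p)) w"
proof -
  let ?S = "chart_map c ` (chart_dom c \<inter> chart_dom d)"
  have "((\<lambda>y. transition d e (transition c d y)) has_derivative
      (\<lambda>w. frechet_derivative (transition d e) (at (chart_map d p))
      (frechet_derivative (transition c d) (at (chart_map c p)) w))) (at (chart_map c p))"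
    using has_derivative_compose[OF transition_has_derivative[OF M c(1) d(1) c(2) d(2)],
        of "transition d e"] transition_has_derivative[OF M d(1) e(1) d(2) e(2)]
    by (simp add: transition_chart_map[OF M c])
  then have "(transition c e has_derivative
      (\<lambda>w. frechet_derivative (transition d e) (at (chart_map d p))
      (frechet_derivative (transition c d) (at (chart_map c p)) w))) (at (chart_map c p))"
    by (rule has_derivative_transform_within_open[OF _ open_overlap[OF M c(1) d(1)]])
      (use c d M in \<open>auto simp: transition_chart_map[OF M]\<close>)
  from frechet_derivative_at[OF this] show ?thesis by metis
qed

lemma points_iff: "p \<in> points M \<longleftrightarrow> (\<exists>c\<in>M. p \<in> chart_dom c)"
  by (simp add: points_def)

lemma chart_at:
  assumes "p \<in> points M"
  shows "chart_at M p \<in> M" "p \<in> chart_dom (chart_at M p)"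
proof -
  have "\<exists>c. c \<in> M \<and> p \<in> chart_dom c" using assms by (simp add: points_iff Bex_def)
  from someI_ex[OF this] show "chart_at M p \<in> M" "p \<in> chart_dom (chart_at M p)"
    by (simp_all add: chart_at_def)
qed

lemma open_preimage_smooth: "smooth_on S f \<Longrightarrow> open S \<Longrightarrow> open T \<Longrightarrow> open {x \<in> S. f x \<in> T}"
  using continuous_open_preimage[OF smooth_on_imp_continuous_on] by (fastforce simp: vimage_def Int_def)

section \<open>Topology of a manifold\<close>

text \<open>The abstract \<open>topology\<close> returns the given open sets only if they satisfy
  the axioms, which are therefore checked here. Injectivity of the charts enters for intersections,
  where images have to commute with them.\<close>

lemma openin_manifold_topology:
  assumes "smooth_atlas M"
  shows "openin (manifold_topology M) W \<longleftrightarrow>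
    W \<subseteq> points M \<and> (\<forall>c\<in>M. open (chart_map c ` (W \<inter> chart_dom c)))"
proof -
  have "istopology (\<lambda>W. W \<subseteq> points M \<and> (\<forall>c\<in>M. open (chart_map c ` (W \<inter> chart_dom c))))"
    unfolding istopology_def
  proof (intro conjI allI impI ballI)
    fix S T c
    assume S: "S \<subseteq> points M \<and> (\<forall>c\<in>M. open (chart_map c ` (S \<inter> chart_dom c)))"
      and T: "T \<subseteq> points M \<and> (\<forall>c\<in>M. open (chart_map c ` (T \<inter> chart_dom c)))"
    then show "S \<inter> T \<subseteq> points M" by blast
    assume c: "c \<in> M"
    have "chart_map c ` (S \<inter> T \<inter> chart_dom c)
        = chart_map c ` (S \<inter> chart_dom c) \<inter> chart_map c ` (T \<inter> chart_dom c)"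
      using c assms by (auto simp: chart_map_inj)
    then show "open (chart_map c ` (S \<inter> T \<inter> chart_dom c))" using S T c by auto
  next
    fix K c
    assume K: "\<forall>W\<in>K. W \<subseteq> points M \<and> (\<forall>c\<in>M. open (chart_map c ` (W \<inter> chart_dom c)))"
    then show "\<Union> K \<subseteq> points M" by blast
    assume c: "c \<in> M"
    have "chart_map c ` (\<Union>K \<inter> chart_dom c) = (\<Union>S\<in>K. chart_map c ` (S \<inter> chart_dom c))" by auto
    then show "open (chart_map c ` (\<Union>K \<inter> chart_dom c))" using K c by auto
  qed
  then show ?thesis
    unfolding manifold_topology_def by (simp add: topology_inverse')
qed

lemma topspace_manifold_topology:
  assumes "smooth_atlas M"
  shows "topspace (manifold_topology M) = points M"
proof -
  have "points M \<inter> chart_dom c = chart_dom c" if "c \<in> M" for c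
    using that by (auto simp: points_def)
  then have "openin (manifold_topology M) (points M)"
    using assms by (simp add: openin_manifold_topology open_chart_img)
  then show ?thesis
    using openin_manifold_topology[OF assms] openin_subset openin_topspace by blast
qed

lemma openin_chart_dom:
  assumes "smooth_atlas M" "c \<in> M"
  shows "openin (manifold_topology M) (chart_dom c)"
  unfolding openin_manifold_topology[OF assms(1)]
  using open_overlap[OF assms(1) _ assms(2)] assms by (auto simp: points_iff Int_commute)

text \<open>Seen in another chart \<open>d\<close>, the set is the preimage of \<open>O'\<close>
  under the transition from \<open>d\<close> to \<open>c\<close>, hence open by continuity.\<close>

lemma openin_chart_inv_image:
  assumes M: "smooth_atlas M" "c \<in> M" and O: "open O'" "O' \<subseteq> chart_img c"
  shows "openin (manifold_topology M) (chart_inv c ` O')"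
  unfolding openin_manifold_topology[OF M(1)]
proof (intro conjI ballI)
  show "chart_inv c ` O' \<subseteq> points M"
    using O(2) chart_inv_in_dom[of _ c] M(2) unfolding points_def by blast
  fix d assume d: "d \<in> M"
  have "chart_map d ` (chart_inv c ` O' \<inter> chart_dom d)
    = {y \<in> chart_map d ` (chart_dom d \<inter> chart_dom c). transition d c y \<in> O'}" (is "?L = ?R")
  proof (intro subset_antisym subsetI)
    fix y assume "y \<in> ?L"
    then obtain z where z: "z \<in> O'" "chart_inv c z \<in> chart_dom d" "y = chart_map d (chart_inv c z)" by auto
    then show "y \<in> ?R"
      using O chart_inv_in_dom[of z c] transition_chart_map[OF M(1) d] chart_map_chart_inv[of z c] by auto
  next
    fix y assume "y \<in> ?R"
    then obtain p where p: "p \<in> chart_dom d" "p \<in> chart_dom c" "y = chart_map d p" "transition d c y \<in> O'" by auto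
    then have "p = chart_inv c (chart_map c p)" "chart_map c p \<in> O'"
      by (auto simp: chart_inv_chart_map[OF M] transition_chart_map[OF M(1) d])
    then show "y \<in> ?L" using p by blast
  qed
  then show "open (chart_map d ` (chart_inv c ` O' \<inter> chart_dom d))"
    using open_preimage_smooth[OF smooth_on_transition open_overlap O(1)] M d by simp
qed

text \<open>A criterion that passes to the tangent bundle at once, because the tangent charts over
  countably many covering charts again cover. One direction is the Lindelof property applied to the
  chart domains; the other pulls a countable basis of the model space back through the countably
  many charts.\<close>

lemma second_countable_manifold_topology:
  assumes M: "smooth_atlas M"
  shows "second_countable (manifold_topology M) \<longleftrightarrow>
    (\<exists>K. countable K \<and> K \<subseteq> M \<and> points M \<subseteq> points K)"
proof
  assume "second_countable (manifold_topology M)"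
  then have "Lindelof_space (manifold_topology M)" by (rule second_countable_imp_Lindelof_space)
  moreover have "\<Union> (chart_dom ` M) = topspace (manifold_topology M)"
    by (simp add: topspace_manifold_topology[OF M] points_def)
  moreover have "\<forall>U\<in>chart_dom ` M. openin (manifold_topology M) U"
    using openin_chart_dom[OF M] by blast
  ultimately obtain V where V: "countable V" "V \<subseteq> chart_dom ` M" "\<Union>V = points M"
    unfolding Lindelof_space_def topspace_manifold_topology[OF M] by meson
  obtain K where K: "countable K" "K \<subseteq> M" "V = chart_dom ` K"
    using countable_subset_image[of V chart_dom M] V by auto
  have "points M = points K" using V(3) unfolding points_def[of K] K(3) by simp
  then show "\<exists>K. countable K \<and> K \<subseteq> M \<and> points M \<subseteq> points K"
    using K by blast
next
  assume "\<exists>K. countable K \<and> K \<subseteq> M \<and> points M \<subseteq> points K"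
  then obtain K where K: "countable K" "K \<subseteq> M" "points M \<subseteq> points K" by blast
  obtain B :: "'b set set" where B: "countable B" "topological_basis B"
    using ex_countable_basis by blast
  define U where "U = (\<lambda>(c, b). chart_inv c ` (b \<inter> chart_img c)) ` (K \<times> B)"
  have "openin (manifold_topology M) V" if "V \<in> U" for V
    using that B K unfolding U_def
    by (auto intro!: openin_chart_inv_image[OF M] open_Int open_chart_img[OF M] simp: topological_basis_open)
  moreover have "\<exists>V\<in>U. x \<in> V \<and> V \<subseteq> W" if W: "openin (manifold_topology M) W" "x \<in> W" for W x
  proof -
    obtain c where c: "c \<in> K" "x \<in> chart_dom c"
      using W(2) K(3) openin_subset[OF W(1)] unfolding topspace_manifold_topology[OF M] points_def by blast
    have "open (chart_map c ` (W \<inter> chart_dom c))" "chart_map c x \<in> chart_map c ` (W \<inter> chart_dom c)"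
      using W c subsetD[OF K(2) c(1)] unfolding openin_manifold_topology[OF M] by blast+
    then obtain b where b: "b \<in> B" "chart_map c x \<in> b" "b \<subseteq> chart_map c ` (W \<inter> chart_dom c)"
      using topological_basisE[OF B(2)] by metis
    have "x \<in> chart_inv c ` (b \<inter> chart_img c)"
      using b c K chart_inv_chart_map[OF M, of c x] by (intro image_eqI[of _ _ "chart_map c x"]) auto
    moreover have "chart_inv c ` (b \<inter> chart_img c) \<subseteq> W"
    proof
      fix q assume "q \<in> chart_inv c ` (b \<inter> chart_img c)"
      then obtain y where y: "q = chart_inv c y" "y \<in> b" by blast
      then obtain p where "p \<in> W \<inter> chart_dom c" "y = chart_map c p"
        using b(3) by (metis imageE subsetD)
      then have "p \<in> W" "p \<in> chart_dom c" "q = chart_inv c (chart_map c p)" using y by simp_all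
      then show "q \<in> W" using chart_inv_chart_map[OF M subsetD[OF K(2) c(1)]] by simp
    qed
    moreover have "chart_inv c ` (b \<inter> chart_img c) \<in> U" unfolding U_def
      by (rule image_eqI[of _ _ "(c, b)"]) (simp_all only: prod.case mem_Sigma_iff b(1) c(1) simp_thms)
    ultimately show ?thesis by (intro bexI conjI)
  qed
  moreover have "countable U" unfolding U_def using K B by blast
  ultimately show "second_countable (manifold_topology M)"
    unfolding second_countable_def by blast
qed

section \<open>Smooth maps between manifolds\<close>

text \<open>The definition quantifies over all pairs of charts and includes continuity. One good
  pair of charts around each point is enough, since any other pair differs from it by smooth
  transition maps on both sides.\<close>

lemma smooth_mapI_local:
  assumes M: "smooth_atlas M" and N: "smooth_atlas N"
    and local: "\<And>p. p \<in> points M \<Longrightarrow> \<exists>c\<in>M. \<exists>d\<in>N. \<exists>V. open V \<and> p \<in> chart_dom c \<and> chart_map c p \<in> V \<and>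
      V \<subseteq> chart_img c \<and> (\<forall>y\<in>V. f (chart_inv c y) \<in> chart_dom d) \<and>
      smooth_on V (\<lambda>y. chart_map d (f (chart_inv c y)))"
  shows "smooth_map M N f"
  unfolding smooth_map_def Let_def
proof (intro conjI ballI)
  have "f p \<in> points N" if "p \<in> points M" for p
    using local[OF that] chart_inv_chart_map[OF M] unfolding points_iff by metis
  then show "f ` points M \<subseteq> points N" by auto
  fix c' d' assume c': "c' \<in> M" and d': "d' \<in> N"
  define S where "S = chart_map c' ` (chart_dom c' \<inter> f -` chart_dom d')"
  have *: "\<exists>T. open T \<and> y \<in> T \<and> T \<subseteq> S \<and> smooth_on T (chart_map d' \<circ> f \<circ> chart_inv c')" if y: "y \<in> S" for y
  proof -
    obtain p where p: "p \<in> chart_dom c'" "f p \<in> chart_dom d'" "y = chart_map c' p"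
      using y unfolding S_def by blast
    then obtain c d V where cd: "c \<in> M" "d \<in> N" "open V" "p \<in> chart_dom c" "chart_map c p \<in> V"
      "V \<subseteq> chart_img c" "\<And>y. y \<in> V \<Longrightarrow> f (chart_inv c y) \<in> chart_dom d"
      "smooth_on V (\<lambda>y. chart_map d (f (chart_inv c y)))"
      using local[of p] p(1) c' unfolding points_iff by blast
    \<comment> \<open>The part of V whose values also lie in the target chart \<open>d'\<close>;
      below, \<open>T\<close> is the same set of points as seen in the source chart
      \<open>c'\<close>.\<close>
    define V' where "V' = {z \<in> V. chart_map d (f (chart_inv c z)) \<in> chart_map d ` (chart_dom d \<inter> chart_dom d')}"
    have V': "open V'" unfolding V'_def
      by (rule open_preimage_smooth[OF cd(8) cd(3) open_overlap[OF N cd(2) d']])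
    define T where "T = {z \<in> chart_map c' ` (chart_dom c' \<inter> chart_dom c). transition c' c z \<in> V'}"
    have T: "open T" unfolding T_def
      by (rule open_preimage_smooth[OF smooth_on_transition open_overlap V']) (use M c' cd in auto)
    have TE: "\<exists>q. z = chart_map c' q \<and> q \<in> chart_dom c' \<and> q \<in> chart_dom c \<and> chart_map c q \<in> V \<and>
        f q \<in> chart_dom d \<and> f q \<in> chart_dom d'" if z: "z \<in> T" for z
    proof -
      obtain q where q: "z = chart_map c' q" "q \<in> chart_dom c'" "q \<in> chart_dom c" "chart_map c q \<in> V'"
        using z unfolding T_def by (auto simp: transition_chart_map[OF M c'])
      moreover have "f q \<in> chart_dom d" "chart_map d (f q) \<in> chart_map d ` (chart_dom d \<inter> chart_dom d')"
        using q cd(7)[of "chart_map c q"] unfolding V'_def by (auto simp: chart_inv_chart_map[OF M cd(1)])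
      ultimately show ?thesis
        unfolding V'_def by (auto simp: chart_map_inj[OF N cd(2)])
    qed
    have "y \<in> T"
      using p cd cd(7)[of "chart_map c p"] chart_inv_chart_map[OF M cd(1,4)]
      unfolding T_def V'_def by (auto simp: transition_chart_map[OF M c'])
    moreover have "T \<subseteq> S" unfolding S_def using TE by blast
    \<comment> \<open>On \<open>T\<close> the expression of \<open>f\<close> in the charts
      \<open>c'\<close> and \<open>d'\<close> is the given one, preceded by the transition from
      \<open>c'\<close> to \<open>c\<close> and followed by that from \<open>d\<close> to
      \<open>d'\<close>.\<close>
    moreover have "smooth_on T (\<lambda>z. transition d d' (chart_map d (f (chart_inv c (transition c' c z)))))"
    proof (rule smooth_on_compose[OF T open_overlap[OF N cd(2) d'] smooth_on_transition[OF N cd(2) d']])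
      show "smooth_on T (\<lambda>z. chart_map d (f (chart_inv c (transition c' c z))))"
        by (rule smooth_on_compose[OF T cd(3,8)])
          (auto simp: T_def V'_def intro: smooth_on_subset[OF smooth_on_transition[OF M c' cd(1)]])
    qed (auto simp: T_def V'_def)
    then have "smooth_on T (chart_map d' \<circ> f \<circ> chart_inv c')"
    proof (rule smooth_on_cong[OF T, rotated])
      fix z assume "z \<in> T"
      with TE obtain q where "z = chart_map c' q" "q \<in> chart_dom c'" "q \<in> chart_dom c" "f q \<in> chart_dom d" by blast
      then show "transition d d' (chart_map d (f (chart_inv c (transition c' c z)))) = (chart_map d' \<circ> f \<circ> chart_inv c') z"
        using M N c' d' cd by (simp add: transition_chart_map chart_inv_chart_map)
    qed
    ultimately show ?thesis using T by blast
  qed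
  then show "open (chart_map c' ` (chart_dom c' \<inter> f -` chart_dom d'))"
    unfolding S_def[symmetric] using open_subopen by metis
  show "smooth_on (chart_map c' ` (chart_dom c' \<inter> f -` chart_dom d')) (chart_map d' \<circ> f \<circ> chart_inv c')"
    unfolding S_def[symmetric] using * by (intro smooth_on_locally) blast
qed

lemma smooth_mapD:
  assumes "smooth_map M N f" "c \<in> M" "d \<in> N"
  shows "open (chart_map c ` (chart_dom c \<inter> f -` chart_dom d))"
    "smooth_on (chart_map c ` (chart_dom c \<inter> f -` chart_dom d)) (\<lambda>y. chart_map d (f (chart_inv c y)))"
  using assms unfolding smooth_map_def Let_def by (auto simp: comp_def)

lemma smooth_map_in_points: "smooth_map M N f \<Longrightarrow> p \<in> points M \<Longrightarrow> f p \<in> points N"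
  unfolding smooth_map_def by blast

lemma smooth_map_compose:
  assumes M: "smooth_atlas M" and N: "smooth_atlas N" and L: "smooth_atlas L"
    and f: "smooth_map M N f" and g: "smooth_map N L g"
  shows "smooth_map M L (\<lambda>x. g (f x))"
proof (rule smooth_mapI_local[OF M L])
  fix p assume p: "p \<in> points M"
  obtain c where c: "c \<in> M" "p \<in> chart_dom c" using p by (auto simp: points_iff)
  obtain d where d: "d \<in> N" "f p \<in> chart_dom d"
    using smooth_map_in_points[OF f p] by (auto simp: points_iff)
  obtain e where e: "e \<in> L" "g (f p) \<in> chart_dom e"
    using smooth_map_in_points[OF g smooth_map_in_points[OF f p]] by (auto simp: points_iff)
  let ?S = "chart_map c ` (chart_dom c \<inter> f -` chart_dom d)"
  let ?T = "chart_map d ` (chart_dom d \<inter> g -` chart_dom e)"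
  define V where "V = {y \<in> ?S. chart_map d (f (chart_inv c y)) \<in> ?T}"
  have V: "open V" unfolding V_def
    using open_preimage_smooth smooth_mapD[OF f c(1) d(1)] smooth_mapD[OF g d(1) e(1)] by blast
  have VE: "\<exists>q. y = chart_map c q \<and> q \<in> chart_dom c \<and> f q \<in> chart_dom d \<and> g (f q) \<in> chart_dom e"
    if "y \<in> V" for y
    using that unfolding V_def by (auto simp: chart_inv_chart_map[OF M c(1)] chart_map_inj[OF N d(1)])
  have "smooth_on V (\<lambda>y. chart_map e (g (chart_inv d (chart_map d (f (chart_inv c y))))))"
    by (rule smooth_on_compose[OF V smooth_mapD[OF g d(1) e(1)]])
      (auto simp: V_def intro: smooth_on_subset[OF smooth_mapD(2)[OF f c(1) d(1)]])
  then have "smooth_on V (\<lambda>y. chart_map e (g (f (chart_inv c y))))"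
    by (rule smooth_on_cong[OF V, rotated])
      (use VE M N c d in \<open>fastforce simp: chart_inv_chart_map\<close>)
  moreover have "\<forall>y\<in>V. g (f (chart_inv c y)) \<in> chart_dom e"
    using VE chart_inv_chart_map[OF M c(1)] by fastforce
  moreover have "V \<subseteq> chart_img c" unfolding V_def by blast
  moreover have "chart_map c p \<in> V"
    unfolding V_def using c d e by (auto simp: chart_inv_chart_map[OF M c(1)])
  ultimately show "\<exists>c\<in>M. \<exists>d\<in>L. \<exists>V. open V \<and> p \<in> chart_dom c \<and> chart_map c p \<in> V \<and>
      V \<subseteq> chart_img c \<and> (\<forall>y\<in>V. g (f (chart_inv c y)) \<in> chart_dom d) \<and>
      smooth_on V (\<lambda>y. chart_map d (g (f (chart_inv c y))))"
    using V c e by blast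
qed

text \<open>For sections: these are extensional, so a composite of smooth maps has to be exchanged
  for its restriction to the points of the manifold.\<close>

lemma smooth_map_cong:
  assumes M: "smooth_atlas M" and N: "smooth_atlas N" and f: "smooth_map M N f"
    and eq: "\<And>p. p \<in> points M \<Longrightarrow> f p = g p"
  shows "smooth_map M N g"
  unfolding smooth_map_def Let_def
proof (intro conjI ballI)
  show "g ` points M \<subseteq> points N" using smooth_map_in_points[OF f] eq by fastforce
  fix c d assume c: "c \<in> M" and d: "d \<in> N"
  have p: "p \<in> points M" if "p \<in> chart_dom c" for p using that c unfolding points_def by blast
  have S: "chart_dom c \<inter> g -` chart_dom d = chart_dom c \<inter> f -` chart_dom d"
    using eq[OF p] by auto
  show "open (chart_map c ` (chart_dom c \<inter> g -` chart_dom d))"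
    unfolding S by (rule smooth_mapD(1)[OF f c d])
  show "smooth_on (chart_map c ` (chart_dom c \<inter> g -` chart_dom d)) (chart_map d \<circ> g \<circ> chart_inv c)"
    unfolding S
    by (rule smooth_on_cong[OF smooth_mapD(1)[OF f c d] _ smooth_mapD(2)[OF f c d]])
      (auto simp: eq p chart_inv_chart_map[OF M c])
qed

section \<open>The tangent bundle\<close>

text \<open>The inverse of the component map v \<mapsto> v c on the tangent space at p, when
  \<open>c\<close> is a chart around p. Letting p vary, it is the inverse of the local
  trivialization given by \<open>c\<close>.\<close>

definition tvec_of :: "('p, 'e::euclidean_space) atlas \<Rightarrow> ('p, 'e) chart \<Rightarrow> 'p \<Rightarrow> 'e \<Rightarrow> ('p, 'e) chart \<Rightarrow> 'e" where
  "tvec_of M c p w = (\<lambda>d. if d \<in> M \<and> p \<in> chart_dom d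
     then frechet_derivative (transition c d) (at (chart_map c p)) w else 0)"

lemma tvec_of_in_tangent_space:
  assumes M: "smooth_atlas M" and c: "c \<in> M" "p \<in> chart_dom c"
  shows "tvec_of M c p w \<in> tangent_space M p"
  unfolding tangent_space_def tvec_of_def using transition_derivative_compose[OF M c]
  by (smt (verit) IntD1 IntD2 mem_Collect_eq)

lemma tvec_of_component:
  assumes M: "smooth_atlas M" and c: "c \<in> M" "p \<in> chart_dom c"
  shows "tvec_of M c p w c = w"
  using transition_derivative_self[OF assms] c by (simp add: tvec_of_def)

lemma tangent_space_component:
  assumes "v \<in> tangent_space M p" "c \<in> M" "p \<in> chart_dom c" "d \<in> M" "p \<in> chart_dom d"
  shows "v d = frechet_derivative (transition c d) (at (chart_map c p)) (v c)"
  using assms unfolding tangent_space_def by blast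

lemma tangent_space_eq_tvec_of:
  assumes "v \<in> tangent_space M p" "c \<in> M" "p \<in> chart_dom c"
  shows "v = tvec_of M c p (v c)"
proof
  fix d show "v d = tvec_of M c p (v c) d"
  proof (cases "d \<in> M \<and> p \<in> chart_dom d")
    case True
    then show ?thesis using tangent_space_component[OF assms, of d] by (simp add: tvec_of_def)
  next
    case False
    have "v d = 0" using assms(1) False unfolding tangent_space_def by blast
    then show ?thesis using False by (auto simp: tvec_of_def)
  qed
qed

text \<open>The remaining components follow from one of them through the derivatives of the
  transition maps. Identities between tangent vectors can therefore be checked in a single chart
  around the base point.\<close>

lemma tangent_space_eqI:
  assumes "v \<in> tangent_space M p" "w \<in> tangent_space M p" "c \<in> M" "p \<in> chart_dom c" "v c = w c"
  shows "v = w"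
  using tangent_space_eq_tvec_of[OF assms(1,3,4)] tangent_space_eq_tvec_of[OF assms(2,3,4)] assms(5) by metis

lemma tangent_space_zero: "smooth_atlas M \<Longrightarrow> (\<lambda>_. 0) \<in> tangent_space M p"
  unfolding tangent_space_def using linear_0[OF linear_transition_derivative] by (smt (verit) IntD1 IntD2 mem_Collect_eq)

lemma tangent_space_lincomb:
  assumes M: "smooth_atlas M" and v: "v \<in> tangent_space M p" "w \<in> tangent_space M p"
  shows "(\<lambda>c. a *\<^sub>R v c + b *\<^sub>R w c) \<in> tangent_space M p"
  unfolding tangent_space_def mem_Collect_eq
proof (intro conjI allI impI ballI)
  fix c assume "\<not> (c \<in> M \<and> p \<in> chart_dom c)"
  then have "v c = 0" "w c = 0" using v unfolding tangent_space_def by blast+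
  then show "a *\<^sub>R v c + b *\<^sub>R w c = 0" by simp
next
  fix c d assume cd: "c \<in> M" "d \<in> M" "p \<in> chart_dom c \<inter> chart_dom d"
  have "linear (frechet_derivative (transition c d) (at (chart_map c p)))"
    using linear_transition_derivative[OF M cd(1,2)] cd(3) by blast
  then show "a *\<^sub>R v d + b *\<^sub>R w d =
      frechet_derivative (transition c d) (at (chart_map c p)) (a *\<^sub>R v c + b *\<^sub>R w c)"
    using tangent_space_component[OF v(1) cd(1) _ cd(2)] tangent_space_component[OF v(2) cd(1) _ cd(2)] cd(3)
    by (simp add: linear_add linear_scale)
qed

lemma tangent_space_add:
  "smooth_atlas M \<Longrightarrow> v \<in> tangent_space M p \<Longrightarrow> w \<in> tangent_space M p \<Longrightarrow> (\<lambda>c. v c + w c) \<in> tangent_space M p"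
  using tangent_space_lincomb[of M v p w 1 1] by simp

lemma tangent_space_scale:
  "smooth_atlas M \<Longrightarrow> v \<in> tangent_space M p \<Longrightarrow> (\<lambda>c. a *\<^sub>R v c) \<in> tangent_space M p"
  using tangent_space_lincomb[of M v p v a 0] by simp

section \<open>The atlas of the tangent bundle\<close>

lemma tangent_chart_simps:
  "chart_dom (tangent_chart M c) = Sigma (chart_dom c) (tangent_space M)"
  "chart_map (tangent_chart M c) \<xi> = (chart_map c (fst \<xi>), snd \<xi> c)"
  by (simp_all add: tangent_chart_def split_beta)

lemma tangent_chart_dom_iff:
  "x \<in> chart_dom (tangent_chart M c) \<longleftrightarrow> fst x \<in> chart_dom c \<and> snd x \<in> tangent_space M (fst x)"
  by (cases x) (simp add: tangent_chart_simps)

lemma points_tangent_manifold: "points (tangent_manifold M) = Sigma (points M) (tangent_space M)"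
  by (auto simp: points_def tangent_manifold_def tangent_chart_simps)

lemma points_tangent_manifold_iff:
  "x \<in> points (tangent_manifold M) \<longleftrightarrow> fst x \<in> points M \<and> snd x \<in> tangent_space M (fst x)"
  by (cases x) (simp add: points_tangent_manifold)

lemma tangent_chart_in: "c \<in> M \<Longrightarrow> tangent_chart M c \<in> tangent_manifold M"
  by (simp add: tangent_manifold_def)

lemma image_tangent_chart:
  assumes M: "smooth_atlas M" "c \<in> M" and W: "W \<subseteq> chart_dom c"
  shows "chart_map (tangent_chart M c) ` Sigma W (tangent_space M) = chart_map c ` W \<times> UNIV"
proof (intro subset_antisym subsetI)
  fix z :: "'b \<times> 'b" assume "z \<in> chart_map c ` W \<times> UNIV"
  then obtain p w where p: "p \<in> W" "z = (chart_map c p, w)" by auto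
  then have "p \<in> chart_dom c" using W by blast
  then show "z \<in> chart_map (tangent_chart M c) ` Sigma W (tangent_space M)"
    using p tvec_of_in_tangent_space[OF M, of p w] tvec_of_component[OF M, of p w]
    by (intro image_eqI[of _ _ "(p, tvec_of M c p w)"]) (auto simp: tangent_chart_simps)
qed (auto simp: tangent_chart_simps)

lemma tangent_chart_img:
  "smooth_atlas M \<Longrightarrow> c \<in> M \<Longrightarrow> chart_img (tangent_chart M c) = chart_img c \<times> UNIV"
  using image_tangent_chart[of M c "chart_dom c"] by (simp add: tangent_chart_simps(1))

lemma inj_on_tangent_chart:
  assumes "smooth_atlas M" "c \<in> M"
  shows "inj_on (chart_map (tangent_chart M c)) (chart_dom (tangent_chart M c))"
proof (rule inj_onI)
  fix x y
  assume x: "x \<in> chart_dom (tangent_chart M c)" and y: "y \<in> chart_dom (tangent_chart M c)"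
    and eq: "chart_map (tangent_chart M c) x = chart_map (tangent_chart M c) y"
  have "fst x = fst y"
    using x y eq chart_map_inj[OF assms, of "fst x" "fst y"] by (auto simp: tangent_chart_simps)
  moreover have "snd x = snd y"
    using x y eq calculation assms
    by (intro tangent_space_eqI[of "snd x" M "fst x" "snd y" c]) (auto simp: tangent_chart_simps)
  ultimately show "x = y" by (simp add: prod_eq_iff)
qed

lemma tangent_chart_inv:
  assumes M: "smooth_atlas M" "c \<in> M" and "y \<in> chart_img c"
  shows "chart_inv (tangent_chart M c) (y, w) = (chart_inv c y, tvec_of M c (chart_inv c y) w)"
proof -
  let ?x = "(chart_inv c y, tvec_of M c (chart_inv c y) w)"
  have "?x \<in> chart_dom (tangent_chart M c)"
    using chart_inv_in_dom[OF assms(3)] tvec_of_in_tangent_space[OF M chart_inv_in_dom[OF assms(3)]]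
    unfolding tangent_chart_simps by blast
  moreover have "chart_map (tangent_chart M c) ?x = (y, w)"
    using chart_map_chart_inv[OF assms(3)] tvec_of_component[OF M chart_inv_in_dom[OF assms(3)]]
    by (simp add: tangent_chart_simps)
  ultimately show ?thesis
    unfolding chart_inv_def[of "tangent_chart M c"]
    using inv_into_f_f[OF inj_on_tangent_chart[OF M]] by metis
qed

lemma overlap_tangent_chart:
  assumes M: "smooth_atlas M" "c \<in> M"
  shows "chart_map (tangent_chart M c) ` (chart_dom (tangent_chart M c) \<inter> chart_dom (tangent_chart M d))
    = chart_map c ` (chart_dom c \<inter> chart_dom d) \<times> UNIV"
proof -
  have "chart_dom (tangent_chart M c) \<inter> chart_dom (tangent_chart M d)
      = Sigma (chart_dom c \<inter> chart_dom d) (tangent_space M)"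
    by (auto simp: tangent_chart_simps)
  then show ?thesis using image_tangent_chart[OF M, of "chart_dom c \<inter> chart_dom d"] by simp
qed

lemma transition_tangent_chart:
  assumes M: "smooth_atlas M" "c \<in> M" "d \<in> M" and y: "y \<in> chart_map c ` (chart_dom c \<inter> chart_dom d)"
  shows "transition (tangent_chart M c) (tangent_chart M d) (y, w)
    = (transition c d y, frechet_derivative (transition c d) (at y) w)"
proof -
  have "chart_inv c y \<in> chart_dom d" "y \<in> chart_img c"
    using y chart_inv_chart_map[OF M(1,2)] by auto
  then show ?thesis
    using tangent_chart_inv[OF M(1,2), of y w] M chart_map_chart_inv[of y c]
    by (simp add: transition_def tangent_chart_simps tvec_of_def)
qed

lemma smooth_atlas_tangent_manifold:
  assumes M: "smooth_atlas M"
  shows "smooth_atlas (tangent_manifold M)"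
  unfolding smooth_atlas_def tangent_manifold_def ball_simps
proof (intro conjI ballI)
  fix c assume c: "c \<in> M"
  show "inj_on (chart_map (tangent_chart M c)) (chart_dom (tangent_chart M c))"
    by (rule inj_on_tangent_chart[OF M c])
  show "open (chart_img (tangent_chart M c))"
    by (simp add: tangent_chart_img[OF M c] open_Times open_chart_img[OF M c])
  fix d assume d: "d \<in> M"
  let ?S = "chart_map c ` (chart_dom c \<inter> chart_dom d)"
  have S: "open ?S" by (rule open_overlap[OF M c d])
  then have S2: "open (?S \<times> (UNIV :: 'b set))" by (simp add: open_Times)
  show "open (chart_map (tangent_chart M c) ` (chart_dom (tangent_chart M c) \<inter> chart_dom (tangent_chart M d)))"
    unfolding overlap_tangent_chart[OF M c] by (rule S2)
  have f: "smooth_on (?S \<times> (UNIV :: 'b set)) (\<lambda>z. fst z)" and s: "smooth_on (?S \<times> (UNIV :: 'b set)) (\<lambda>z. snd z)"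
    by (rule smooth_on_fst[OF S2 smooth_on_id[OF S2]], rule smooth_on_snd[OF S2 smooth_on_id[OF S2]])
  have "smooth_on (?S \<times> UNIV) (\<lambda>z. (transition c d (fst z),
      frechet_derivative (transition c d) (at (fst z)) (snd z)))"
    by (rule smooth_on_Pair[OF S2 smooth_on_compose[OF S2 S smooth_on_transition[OF M c d] f]
          smooth_on_frechet_derivative_apply[OF S2 S smooth_on_transition[OF M c d] f]]) (auto intro: s)
  then show "smooth_on (chart_map (tangent_chart M c) ` (chart_dom (tangent_chart M c) \<inter> chart_dom (tangent_chart M d)))
     (transition (tangent_chart M c) (tangent_chart M d))"
    unfolding overlap_tangent_chart[OF M c]
  proof (rule smooth_on_cong[OF S2, rotated])
    fix z :: "'b \<times> 'b" assume "z \<in> ?S \<times> UNIV"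
    then show "(transition c d (fst z), frechet_derivative (transition c d) (at (fst z)) (snd z))
        = transition (tangent_chart M c) (tangent_chart M d) z"
      using transition_tangent_chart[OF M c d, of "fst z" "snd z"] by auto
  qed
qed

section \<open>Topology of the tangent bundle\<close>

lemma openin_tangent_manifold_Sigma:
  assumes M: "smooth_atlas M" and W: "openin (manifold_topology M) W"
  shows "openin (manifold_topology (tangent_manifold M)) (Sigma W (tangent_space M))"
  unfolding openin_manifold_topology[OF smooth_atlas_tangent_manifold[OF M]] points_tangent_manifold
proof (intro conjI ballI)
  show "Sigma W (tangent_space M) \<subseteq> Sigma (points M) (tangent_space M)"
    using openin_subset[OF W] topspace_manifold_topology[OF M] by auto
  fix C assume "C \<in> tangent_manifold M"
  then obtain c where c: "c \<in> M" "C = tangent_chart M c" by (auto simp: tangent_manifold_def)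
  have "Sigma W (tangent_space M) \<inter> chart_dom C = Sigma (W \<inter> chart_dom c) (tangent_space M)"
    using c by (auto simp: tangent_chart_simps)
  moreover have "open (chart_map c ` (W \<inter> chart_dom c))"
    using W c openin_manifold_topology[OF M] by blast
  ultimately show "open (chart_map C ` (Sigma W (tangent_space M) \<inter> chart_dom C))"
    using image_tangent_chart[OF M c(1), of "W \<inter> chart_dom c"] c by (simp add: open_Times)
qed

text \<open>Vectors over different points are separated by the preimages of disjoint open sets of
  the base. Vectors over the same point lie in one common tangent chart, where the Hausdorff
  property of the model space applies.\<close>

lemma Hausdorff_tangent_manifold:
  assumes M: "smooth_atlas M" and H: "Hausdorff_space (manifold_topology M)"
  shows "Hausdorff_space (manifold_topology (tangent_manifold M))"
  unfolding Hausdorff_space_def topspace_manifold_topology[OF smooth_atlas_tangent_manifold[OF M]]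
proof (intro allI impI)
  fix x y assume xy: "x \<in> points (tangent_manifold M) \<and> y \<in> points (tangent_manifold M) \<and> x \<noteq> y"
  let ?T = "manifold_topology (tangent_manifold M)"
  have p: "fst x \<in> points M" "fst y \<in> points M" "snd x \<in> tangent_space M (fst x)" "snd y \<in> tangent_space M (fst y)"
    using xy by (auto simp: points_tangent_manifold)
  show "\<exists>U V. openin ?T U \<and> openin ?T V \<and> x \<in> U \<and> y \<in> V \<and> disjnt U V"
  proof (cases "fst x = fst y")
    case False
    then obtain U V where UV: "openin (manifold_topology M) U" "openin (manifold_topology M) V"
      "fst x \<in> U" "fst y \<in> V" "disjnt U V"
      using H p unfolding Hausdorff_space_def topspace_manifold_topology[OF M] by meson
    have "x \<in> Sigma U (tangent_space M)" "y \<in> Sigma V (tangent_space M)"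
      "disjnt (Sigma U (tangent_space M)) (Sigma V (tangent_space M))"
      using UV p by (auto simp: mem_Times_iff disjnt_def) (metis SigmaI prod.collapse)+
    then show ?thesis
      using openin_tangent_manifold_Sigma[OF M] UV by blast
  next
    case True
    obtain c where c: "c \<in> M" "fst x \<in> chart_dom c" using p by (auto simp: points_def)
    let ?C = "tangent_chart M c"
    have C: "?C \<in> tangent_manifold M" using c by (rule_tac tangent_chart_in)
    have xC: "x \<in> chart_dom ?C" "y \<in> chart_dom ?C"
      using c p True by (auto simp: tangent_chart_simps mem_Sigma_iff prod_eq_iff) (metis SigmaI prod.collapse)+
    have "chart_map ?C x \<noteq> chart_map ?C y"
      using inj_onD[OF inj_on_tangent_chart[OF M c(1)] _ xC] xy by blast
    then obtain A B where AB: "open A" "open B" "chart_map ?C x \<in> A" "chart_map ?C y \<in> B" "A \<inter> B = {}"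
      using hausdorff by metis
    let ?U = "\<lambda>A. chart_inv ?C ` (A \<inter> chart_img ?C)"
    have "openin ?T (?U A)" "openin ?T (?U B)"
      using AB open_chart_img[OF smooth_atlas_tangent_manifold[OF M] C]
      by (auto intro!: openin_chart_inv_image[OF smooth_atlas_tangent_manifold[OF M] C])
    moreover have "z \<in> ?U A" if "z \<in> chart_dom ?C" "chart_map ?C z \<in> A" for z A
      using that chart_inv_chart_map[OF smooth_atlas_tangent_manifold[OF M] C that(1)]
      by (intro image_eqI[of _ _ "chart_map ?C z"]) auto
    moreover have "disjnt (?U A) (?U B)"
      unfolding disjnt_iff
    proof (intro allI notI, elim conjE imageE)
      fix z a b assume ab: "z = chart_inv ?C a" "a \<in> A \<inter> chart_img ?C" "z = chart_inv ?C b" "b \<in> B \<inter> chart_img ?C"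
      then have "a = b" using chart_map_chart_inv[of a ?C] chart_map_chart_inv[of b ?C] by (metis IntD2)
      then show False using ab AB(5) by blast
    qed
    ultimately show ?thesis using xC AB by (intro exI[of _ "?U A"] exI[of _ "?U B"] conjI)
  qed
qed

lemma smooth_manifold_tangent_manifold:
  assumes "smooth_manifold M"
  shows "smooth_manifold (tangent_manifold M)"
proof -
  have M: "smooth_atlas M" and H: "Hausdorff_space (manifold_topology M)"
    and S: "second_countable (manifold_topology M)"
    using assms unfolding smooth_manifold_def by auto
  obtain K where K: "countable K" "K \<subseteq> M" "points M \<subseteq> points K"
    using S unfolding second_countable_manifold_topology[OF M] by blast
  have "points (tangent_manifold M) \<subseteq> points (tangent_chart M ` K)"
    using K(3) unfolding points_tangent_manifold by (auto simp: points_def tangent_chart_simps)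
  moreover have "countable (tangent_chart M ` K)" "tangent_chart M ` K \<subseteq> tangent_manifold M"
    using K by (auto simp: tangent_manifold_def)
  ultimately have "second_countable (manifold_topology (tangent_manifold M))"
    unfolding second_countable_manifold_topology[OF smooth_atlas_tangent_manifold[OF M]] by blast
  then show ?thesis
    unfolding smooth_manifold_def
    using smooth_atlas_tangent_manifold[OF M] Hausdorff_tangent_manifold[OF M H] by blast
qed

section \<open>Fibre operations and local triviality\<close>

lemma tangent_bundle_simps [simp]:
  "vb_base (tangent_bundle M) = M"
  "vb_total (tangent_bundle M) = tangent_manifold M"
  "vb_proj (tangent_bundle M) = fst"
  "vb_zero (tangent_bundle M) p = (p, \<lambda>_. 0)"
  "vb_add (tangent_bundle M) \<xi> \<eta> = (fst \<xi>, \<lambda>c. snd \<xi> c + snd \<eta> c)"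
  "vb_scale (tangent_bundle M) a \<xi> = (fst \<xi>, \<lambda>c. a *\<^sub>R snd \<xi> c)"
  by (simp_all add: tangent_bundle_def split_beta)

lemma tangent_fibre_iff:
  "\<xi> \<in> vb_fibre (tangent_bundle M) p \<longleftrightarrow> p \<in> points M \<and> fst \<xi> = p \<and> snd \<xi> \<in> tangent_space M p"
  by (cases \<xi>) (auto simp: vb_fibre_def points_tangent_manifold)

lemma smooth_atlas_open_submanifold:
  assumes M: "smooth_atlas M" and U: "\<And>c. c \<in> M \<Longrightarrow> open (chart_map c ` (chart_dom c \<inter> U))"
  shows "smooth_atlas (open_submanifold M U)"
  unfolding smooth_atlas_def open_submanifold_def ball_simps fst_conv snd_conv
proof (intro conjI ballI)
  fix c assume c: "c \<in> M"
  show "inj_on (chart_map c) (chart_dom c \<inter> U)"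
    using M c unfolding smooth_atlas_def by (meson inf_le1 inj_on_subset)
  show "open (chart_map c ` (chart_dom c \<inter> U))"
    by (rule U[OF c])
  fix d assume d: "d \<in> M"
  have eq: "chart_map c ` (chart_dom c \<inter> U \<inter> (chart_dom d \<inter> U))
      = chart_map c ` (chart_dom c \<inter> chart_dom d) \<inter> chart_map c ` (chart_dom c \<inter> U)"
    using chart_map_inj[OF M c] by auto
  show o: "open (chart_map c ` (chart_dom c \<inter> U \<inter> (chart_dom d \<inter> U)))"
    unfolding eq using open_overlap[OF M c d] \<open>open (chart_map c ` (chart_dom c \<inter> U))\<close> by blast
  show "smooth_on (chart_map c ` (chart_dom c \<inter> U \<inter> (chart_dom d \<inter> U)))
     (transition (chart_dom c \<inter> U, chart_map c) (chart_dom d \<inter> U, chart_map d))"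
  proof (rule smooth_on_cong[OF o _ smooth_on_subset[OF smooth_on_transition[OF M c d]]])
    fix y assume "y \<in> chart_map c ` (chart_dom c \<inter> U \<inter> (chart_dom d \<inter> U))"
    then obtain p where p: "p \<in> chart_dom c \<inter> U" "y = chart_map c p" by blast
    \<comment> \<open>Shrinking the domain of a chart changes its \<open>chart_inv\<close>, which is
      an inverse on the smaller set; the two inverses agree on the image of that set, where the
      transition maps are compared.\<close>
    have "chart_inv (chart_dom c \<inter> U, chart_map c) y = p"
      using inv_into_f_f[OF \<open>inj_on (chart_map c) (chart_dom c \<inter> U)\<close> p(1)] p(2) by (simp add: chart_inv_def)
    then show "transition c d y = transition (chart_dom c \<inter> U, chart_map c) (chart_dom d \<inter> U, chart_map d) y"
      using p chart_inv_chart_map[OF M c, of p] by (simp add: transition_def)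
  qed auto
qed

lemma smooth_atlas_euclidean: "smooth_atlas euclidean_atlas"
proof -
  have "inv_into UNIV (\<lambda>x::'a. x) = (\<lambda>x. x)" by (simp add: inv_equality)
  then show ?thesis
    by (simp add: smooth_atlas_def euclidean_atlas_def transition_def chart_inv_def comp_def smooth_on_id)
qed

lemma chart_inv_product:
  assumes "inj_on (chart_map c) (chart_dom c)" "inj_on (chart_map d) (chart_dom d)"
    and "y \<in> chart_img c" "z \<in> chart_img d"
  shows "chart_inv (chart_dom c \<times> chart_dom d, map_prod (chart_map c) (chart_map d)) (y, z)
    = (chart_inv c y, chart_inv d z)"
  using inv_into_f_f[OF map_prod_inj_on[OF assms(1,2)], of "(chart_inv c y, chart_inv d z)"]
    chart_inv_in_dom[OF assms(3)] chart_inv_in_dom[OF assms(4)]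
    chart_map_chart_inv[OF assms(3)] chart_map_chart_inv[OF assms(4)]
  by (simp add: chart_inv_def)

lemma smooth_atlas_product:
  assumes M: "smooth_atlas M" and N: "smooth_atlas N"
  shows "smooth_atlas (product_atlas M N)"
proof -
  let ?P = "\<lambda>c d. (chart_dom c \<times> chart_dom d, map_prod (chart_map c) (chart_map d))"
  have inj: "inj_on (chart_map c) (chart_dom c)" if "c \<in> M" for c
    using M that by (simp add: smooth_atlas_def)
  have inj': "inj_on (chart_map c) (chart_dom c)" if "c \<in> N" for c
    using N that by (simp add: smooth_atlas_def)
  have "inj_on (chart_map (?P c d)) (chart_dom (?P c d)) \<and> open (chart_img (?P c d))"
    if "c \<in> M" "d \<in> N" for c d
    using map_prod_inj_on[OF inj inj'] that open_chart_img[OF M] open_chart_img[OF N]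
    by (simp add: map_prod_surj_on[OF refl refl] open_Times)
  moreover have "open (chart_map (?P c d) ` (chart_dom (?P c d) \<inter> chart_dom (?P c' d'))) \<and>
      smooth_on (chart_map (?P c d) ` (chart_dom (?P c d) \<inter> chart_dom (?P c' d'))) (transition (?P c d) (?P c' d'))"
    if cd: "c \<in> M" "d \<in> N" "c' \<in> M" "d' \<in> N" for c d c' d'
  proof -
    let ?S = "chart_map c ` (chart_dom c \<inter> chart_dom c')" and ?T = "chart_map d ` (chart_dom d \<inter> chart_dom d')"
    have eq: "chart_map (?P c d) ` (chart_dom (?P c d) \<inter> chart_dom (?P c' d')) = ?S \<times> ?T"
      by (simp add: Times_Int_Times map_prod_surj_on[OF refl refl])
    have S: "open ?S" and T: "open ?T" using open_overlap M N cd by blast+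
    then have ST: "open (?S \<times> ?T)" by (rule open_Times)
    have "smooth_on (?S \<times> ?T) (\<lambda>z. (transition c c' (fst z), transition d d' (snd z)))"
      by (rule smooth_on_Pair[OF ST
            smooth_on_compose[OF ST S smooth_on_transition[OF M cd(1,3)] smooth_on_fst[OF ST smooth_on_id[OF ST]]]
            smooth_on_compose[OF ST T smooth_on_transition[OF N cd(2,4)] smooth_on_snd[OF ST smooth_on_id[OF ST]]]])
        auto
    then have "smooth_on (?S \<times> ?T) (transition (?P c d) (?P c' d'))"
    proof (rule smooth_on_cong[OF ST, rotated])
      fix z assume "z \<in> ?S \<times> ?T"
      then show "(transition c c' (fst z), transition d d' (snd z)) = transition (?P c d) (?P c' d') z"
        using chart_inv_product[OF inj[OF cd(1)] inj'[OF cd(2)], of "fst z" "snd z"]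
        by (auto simp: transition_def)
    qed
    then show ?thesis unfolding eq using ST by blast
  qed
  ultimately show ?thesis
    unfolding smooth_atlas_def product_atlas_def ball_simps split_beta by auto
qed

text \<open>With the tangent chart on one side and the product of \<open>c\<close> with the identity
  on the other, both the trivialization and its inverse read as the identity of the same open set
  \<open>?V\<close>. The work lies in identifying the inverses of the charts.\<close>

lemma diffeomorphism_tangent_chart:
  assumes M: "smooth_atlas M" and c: "c \<in> M"
  shows "diffeomorphism (open_submanifold (tangent_manifold M) (fst -` chart_dom c))
     (product_atlas (open_submanifold M (chart_dom c)) euclidean_atlas) (\<lambda>x. (fst x, snd x c))"
proof -
  let ?S = "open_submanifold (tangent_manifold M) (fst -` chart_dom c)"
  let ?T = "product_atlas (open_submanifold M (chart_dom c)) euclidean_atlas"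
  let ?C = "tangent_chart M c"
  let ?D = "(chart_dom c \<times> (UNIV :: 'b set), map_prod (chart_map c) (\<lambda>w::'b. w))"
  let ?f = "\<lambda>x. (fst x, snd x c)" and ?g = "\<lambda>(p, w). (p, tvec_of M c p w)"
  let ?V = "chart_img c \<times> (UNIV :: 'b set)"
  note TM = smooth_atlas_tangent_manifold[OF M]
  have S: "smooth_atlas ?S"
  proof (rule smooth_atlas_open_submanifold[OF TM])
    fix C assume "C \<in> tangent_manifold M"
    then obtain d where d: "d \<in> M" "C = tangent_chart M d" by (auto simp: tangent_manifold_def)
    then have "chart_dom C \<inter> fst -` chart_dom c = Sigma (chart_dom d \<inter> chart_dom c) (tangent_space M)"
      by (auto simp: tangent_chart_simps)
    then show "open (chart_map C ` (chart_dom C \<inter> fst -` chart_dom c))"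
      using image_tangent_chart[OF M d(1), of "chart_dom d \<inter> chart_dom c"] open_overlap[OF M d(1) c] d
      by (simp add: open_Times)
  qed
  have T: "smooth_atlas ?T"
    by (intro smooth_atlas_product smooth_atlas_euclidean smooth_atlas_open_submanifold[OF M])
      (simp add: open_overlap[OF M _ c])
  have "?C = (chart_dom ?C \<inter> fst -` chart_dom c, chart_map ?C)"
    by (auto simp: prod_eq_iff tangent_chart_simps)
  then have C: "?C \<in> ?S"
    unfolding open_submanifold_def using tangent_chart_in[OF c] by (rule image_eqI)
  have "c = (chart_dom c \<inter> chart_dom c, chart_map c)" by simp
  then have "c \<in> open_submanifold M (chart_dom c)"
    unfolding open_submanifold_def using c by (rule image_eqI)
  then have D: "?D \<in> ?T"
    unfolding product_atlas_def
    by (intro image_eqI[of _ _ "(c, (UNIV, \<lambda>w. w))"]) (auto simp: euclidean_atlas_def)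
  have pS: "points ?S = Sigma (chart_dom c) (tangent_space M)"
    using c by (fastforce simp: points_def open_submanifold_def tangent_manifold_def tangent_chart_simps)
  have pT: "points ?T = chart_dom c \<times> UNIV"
    using c by (fastforce simp: points_def open_submanifold_def product_atlas_def euclidean_atlas_def)
  have gf: "?g (?f x) = x" if "x \<in> Sigma (chart_dom c) (tangent_space M)" for x
    using that tangent_space_eq_tvec_of[of "snd x" M "fst x" c] c by (cases x) auto
  have fg: "?f (?g x) = x" if "x \<in> chart_dom c \<times> UNIV" for x
    using that tvec_of_component[OF M c, of "fst x" "snd x"] by (cases x) auto
  have bij: "bij_betw ?f (points ?S) (points ?T)"
    unfolding pS pT
    by (rule bij_betw_byWitness[of _ ?g]) (use gf fg tvec_of_in_tangent_space[OF M c] in auto)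
  have inv: "inv_into (points ?S) ?f x = ?g x" if "x \<in> chart_dom c \<times> UNIV" for x
    by (rule inv_into_f_eq[OF bij_betw_imp_inj_on[OF bij]])
      (use that fg[OF that] tvec_of_in_tangent_space[OF M c] in \<open>auto simp: pS\<close>)
  have V: "open ?V" by (simp add: open_Times open_chart_img[OF M c])
  have imgC: "chart_img ?C = ?V" by (rule tangent_chart_img[OF M c])
  have imgD: "chart_img ?D = ?V" by (simp add: map_prod_surj_on[OF refl refl])
  have fC: "?f (chart_inv ?C y) = (chart_inv c (fst y), snd y)" if "y \<in> ?V" for y
    using that tangent_chart_inv[OF M c, of "fst y" "snd y"]
      tvec_of_component[OF M c chart_inv_in_dom[of "fst y" c], of "snd y"] by auto
  have invD: "chart_inv ?D y = (chart_inv c (fst y), snd y)" if "y \<in> ?V" for y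
  proof -
    have "chart_inv (UNIV, \<lambda>w::'b. w) (snd y) = snd y" by (simp add: chart_inv_def inv_equality)
    then show ?thesis
      using that chart_inv_product[of c "(UNIV, \<lambda>w. w)" "fst y" "snd y"] M c
      by (auto simp: smooth_atlas_def)
  qed
  have id: "smooth_on ?V (\<lambda>y. y)" by (rule smooth_on_id[OF V])
  have "smooth_map ?S ?T ?f"
  proof (rule smooth_mapI_local[OF S T])
    fix x assume "x \<in> points ?S"
    then have x: "x \<in> chart_dom ?C" by (simp add: pS tangent_chart_simps)
    have "smooth_on ?V (\<lambda>y. chart_map ?D (?f (chart_inv ?C y)))"
      by (rule smooth_on_cong[OF V _ id]) (auto simp: fC chart_map_chart_inv)
    moreover have "\<forall>y\<in>?V. ?f (chart_inv ?C y) \<in> chart_dom ?D"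
      using fC chart_inv_in_dom[of _ c] by auto
    moreover have "chart_map ?C x \<in> ?V" using x imgC by blast
    moreover have "?V \<subseteq> chart_img ?C" using imgC by (rule equalityD2)
    ultimately show "\<exists>C\<in>?S. \<exists>D\<in>?T. \<exists>V. open V \<and> x \<in> chart_dom C \<and> chart_map C x \<in> V \<and> V \<subseteq> chart_img C \<and>
        (\<forall>y\<in>V. ?f (chart_inv C y) \<in> chart_dom D) \<and> smooth_on V (\<lambda>y. chart_map D (?f (chart_inv C y)))"
      using V x by (intro bexI[OF _ C] bexI[OF _ D] exI[of _ ?V] conjI)
  qed
  moreover have "smooth_map ?T ?S (inv_into (points ?S) ?f)"
  proof (rule smooth_mapI_local[OF T S])
    fix x :: "'a \<times> 'b" assume "x \<in> points ?T"
    then have x: "x \<in> chart_dom ?D" by (simp add: pT)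
    have eq: "inv_into (points ?S) ?f (chart_inv ?D y) = chart_inv ?C y" if "y \<in> chart_img ?C" for y
      using that chart_inv_in_dom[of "fst y" c] tangent_chart_inv[OF M c, of "fst y" "snd y"]
      by (subst invD[OF that[unfolded imgC]], subst inv) (auto simp: imgC)
    have "smooth_on ?V (\<lambda>y. chart_map ?C (inv_into (points ?S) ?f (chart_inv ?D y)))"
      by (rule smooth_on_cong[OF V _ id]) (simp only: eq imgC[symmetric] chart_map_chart_inv)
    moreover have "\<forall>y\<in>?V. inv_into (points ?S) ?f (chart_inv ?D y) \<in> chart_dom ?C"
      by (intro ballI) (simp only: eq imgC[symmetric] chart_inv_in_dom)
    moreover have "chart_map ?D x \<in> ?V" using x by auto
    moreover have "?V \<subseteq> chart_img ?D" using imgD by (rule equalityD2)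
    ultimately show "\<exists>D\<in>?T. \<exists>C\<in>?S. \<exists>V. open V \<and> x \<in> chart_dom D \<and> chart_map D x \<in> V \<and> V \<subseteq> chart_img D \<and>
        (\<forall>y\<in>V. inv_into (points ?S) ?f (chart_inv D y) \<in> chart_dom C) \<and>
        smooth_on V (\<lambda>y. chart_map C (inv_into (points ?S) ?f (chart_inv D y)))"
      using V x by (intro bexI[OF _ C] bexI[OF _ D] exI[of _ ?V] conjI)
  qed
  ultimately show ?thesis using bij by (simp add: diffeomorphism_def)
qed

lemma smooth_map_tangent_proj:
  assumes M: "smooth_atlas M"
  shows "smooth_map (tangent_manifold M) M fst"
proof (rule smooth_mapI_local[OF smooth_atlas_tangent_manifold[OF M] M])
  fix x assume "x \<in> points (tangent_manifold M)"
  then obtain c where c: "c \<in> M" "fst x \<in> chart_dom c" "snd x \<in> tangent_space M (fst x)"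
    unfolding points_tangent_manifold_iff unfolding points_def by blast
  let ?C = "tangent_chart M c" and ?V = "chart_img c \<times> (UNIV :: 'b set)"
  have V: "open ?V" by (simp add: open_Times open_chart_img[OF M c(1)])
  have inv: "fst (chart_inv ?C y) = chart_inv c (fst y)" if "y \<in> ?V" for y
    using that tangent_chart_inv[OF M c(1), of "fst y" "snd y"] by auto
  have "smooth_on ?V (\<lambda>y. chart_map c (fst (chart_inv ?C y)))"
    by (rule smooth_on_cong[OF V _ smooth_on_fst[OF V smooth_on_id[OF V]]]) (auto simp: inv chart_map_chart_inv)
  moreover have "x \<in> chart_dom ?C" "chart_map ?C x \<in> ?V"
    using c by (auto simp: tangent_chart_dom_iff tangent_chart_simps(2))
  moreover have "\<forall>y\<in>?V. fst (chart_inv ?C y) \<in> chart_dom c"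
    using inv chart_inv_in_dom[of _ c] by auto
  ultimately show "\<exists>C\<in>tangent_manifold M. \<exists>d\<in>M. \<exists>V. open V \<and> x \<in> chart_dom C \<and> chart_map C x \<in> V \<and>
      V \<subseteq> chart_img C \<and> (\<forall>y\<in>V. fst (chart_inv C y) \<in> chart_dom d) \<and>
      smooth_on V (\<lambda>y. chart_map d (fst (chart_inv C y)))"
    using V c tangent_chart_in[OF c(1)] tangent_chart_img[OF M c(1)]
    by (intro bexI[of _ ?C] bexI[of _ c] exI[of _ ?V] conjI) simp_all
qed

lemma vector_bundle_tangent_bundle:
  assumes "smooth_manifold M"
  shows "vector_bundle (tangent_bundle M)"
proof -
  have M: "smooth_atlas M" using assms by (simp add: smooth_manifold_def)
  have "\<exists>U \<Phi>. p \<in> U \<and> local_trivialization (tangent_bundle M) U \<Phi>" if "p \<in> points M" for p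
  proof -
    obtain c where c: "c \<in> M" "p \<in> chart_dom c" using \<open>p \<in> points M\<close> unfolding points_def by blast
    have "local_trivialization (tangent_bundle M) (chart_dom c) (\<lambda>x. snd x c)"
      using diffeomorphism_tangent_chart[OF M c(1)] openin_chart_dom[OF M c(1)]
      by (simp add: local_trivialization_def)
    then show ?thesis using c by blast
  qed
  moreover have "\<forall>p\<in>points M. vb_zero (tangent_bundle M) p \<in> vb_fibre (tangent_bundle M) p \<and>
      (\<forall>x\<in>vb_fibre (tangent_bundle M) p. \<forall>y\<in>vb_fibre (tangent_bundle M) p.
         vb_add (tangent_bundle M) x y \<in> vb_fibre (tangent_bundle M) p) \<and>
      (\<forall>x\<in>vb_fibre (tangent_bundle M) p. \<forall>a. vb_scale (tangent_bundle M) a x \<in> vb_fibre (tangent_bundle M) p)"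
    using tangent_space_zero[OF M] tangent_space_add[OF M] tangent_space_scale[OF M]
    by (simp add: tangent_fibre_iff)
  ultimately show ?thesis
    using assms smooth_manifold_tangent_manifold[OF assms] smooth_map_tangent_proj[OF M]
    unfolding vector_bundle_def by simp
qed

section \<open>Vector fields in charts\<close>

definition chart_rep :: "('p, 'e) chart \<Rightarrow> ('p \<Rightarrow> ('p, 'e) tvec) \<Rightarrow> 'e \<Rightarrow> 'e" where
  "chart_rep c A = (\<lambda>y. snd (A (chart_inv c y)) c)"

text \<open>In \<open>c\<close> and its tangent chart the field reads y \<mapsto> (y,
  \<open>chart_rep c A y\<close>), so smoothness is a condition on the second component
  alone.\<close>

lemma vector_fieldI:
  assumes M: "smooth_atlas M" and ext: "A \<in> extensional (points M)"
    and fib: "\<And>p. p \<in> points M \<Longrightarrow> A p \<in> vb_fibre (tangent_bundle M) p"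
    and sm: "\<And>c. c \<in> M \<Longrightarrow> smooth_on (chart_img c) (chart_rep c A)"
  shows "A \<in> vector_fields M"
proof -
  have "smooth_map M (tangent_manifold M) A"
  proof (rule smooth_mapI_local[OF M smooth_atlas_tangent_manifold[OF M]])
    fix p assume "p \<in> points M"
    then obtain c where c: "c \<in> M" "p \<in> chart_dom c" unfolding points_def by blast
    let ?C = "tangent_chart M c" and ?V = "chart_img c"
    have V: "open ?V" by (rule open_chart_img[OF M c(1)])
    have "smooth_on ?V (\<lambda>y. (y, chart_rep c A y))"
      by (rule smooth_on_Pair[OF V smooth_on_id[OF V] sm[OF c(1)]])
    have in_dom: "A q \<in> chart_dom ?C" and fst: "fst (A q) = q" if "q \<in> chart_dom c" for q
    proof -
      have "q \<in> points M" using that c(1) unfolding points_def by blast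
      from fib[OF this] have "fst (A q) = q" "snd (A q) \<in> tangent_space M q"
        by (simp_all add: tangent_fibre_iff)
      then show "A q \<in> chart_dom ?C" "fst (A q) = q"
        using that by (simp_all add: tangent_chart_dom_iff)
    qed
    have "smooth_on ?V (\<lambda>y. chart_map ?C (A (chart_inv c y)))"
      by (rule smooth_on_cong[OF V _ \<open>smooth_on ?V (\<lambda>y. (y, chart_rep c A y))\<close>])
        (simp add: tangent_chart_simps fst chart_inv_in_dom chart_map_chart_inv chart_rep_def)
    then show "\<exists>c\<in>M. \<exists>d\<in>tangent_manifold M. \<exists>V. open V \<and> p \<in> chart_dom c \<and> chart_map c p \<in> V \<and>
        V \<subseteq> chart_img c \<and> (\<forall>y\<in>V. A (chart_inv c y) \<in> chart_dom d) \<and>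
        smooth_on V (\<lambda>y. chart_map d (A (chart_inv c y)))"
      using V c tangent_chart_in[OF c(1)] in_dom[OF chart_inv_in_dom]
      by (intro bexI[of _ ?C] bexI[of _ c] exI[of _ ?V] conjI) simp_all
  qed
  then show ?thesis
    using ext fib by (simp add: sections_def tangent_fibre_iff)
qed

lemma vector_field_in_fibre:
  assumes "A \<in> vector_fields M" "p \<in> points M"
  shows "A p \<in> vb_fibre (tangent_bundle M) p"
  using assms smooth_map_in_points[of M "tangent_manifold M" A p]
  by (simp add: sections_def vb_fibre_def)

lemma vector_field_fst: "A \<in> vector_fields M \<Longrightarrow> p \<in> points M \<Longrightarrow> fst (A p) = p"
  and vector_field_snd: "A \<in> vector_fields M \<Longrightarrow> p \<in> points M \<Longrightarrow> snd (A p) \<in> tangent_space M p"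
  using vector_field_in_fibre[of A M p] by (simp_all add: tangent_fibre_iff)

lemma smooth_on_chart_rep:
  assumes M: "smooth_atlas M" and A: "A \<in> vector_fields M" and c: "c \<in> M"
  shows "smooth_on (chart_img c) (chart_rep c A)"
proof -
  let ?C = "tangent_chart M c"
  have sub: "chart_dom c \<subseteq> points M" using c unfolding points_def by blast
  have "chart_dom c \<inter> A -` chart_dom ?C = chart_dom c"
    using vector_field_fst[OF A] vector_field_snd[OF A] sub
    by (auto simp: tangent_chart_dom_iff subset_iff)
  moreover have "smooth_map M (tangent_manifold M) A" using A by (simp add: sections_def)
  ultimately have "smooth_on (chart_img c) (\<lambda>y. chart_map ?C (A (chart_inv c y)))"
    using smooth_mapD(2)[OF _ c tangent_chart_in[OF c]] by metis
  from smooth_on_snd[OF open_chart_img[OF M c] this] show ?thesis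
    by (simp add: tangent_chart_simps chart_rep_def)
qed

lemma vector_field_eqI:
  assumes A: "A \<in> vector_fields M" and B: "B \<in> vector_fields M"
    and eq: "\<And>p. p \<in> points M \<Longrightarrow> \<exists>c\<in>M. p \<in> chart_dom c \<and> snd (A p) c = snd (B p) c"
  shows "A = B"
proof (rule extensionalityI)
  show "A \<in> extensional (points M)" "B \<in> extensional (points M)"
    using A B by (auto simp: sections_def)
  fix p assume p: "p \<in> points M"
  obtain c where c: "c \<in> M" "p \<in> chart_dom c" "snd (A p) c = snd (B p) c" using eq[OF p] by blast
  have "snd (A p) = snd (B p)"
    by (rule tangent_space_eqI[OF vector_field_snd[OF A p] vector_field_snd[OF B p] c])
  then show "A p = B p" using vector_field_fst[OF A p] vector_field_fst[OF B p] by (simp add: prod_eq_iff)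
qed

lemma smooth_on_smooth_function:
  assumes M: "smooth_atlas M" and f: "f \<in> smooth_functions M" and c: "c \<in> M"
  shows "smooth_on (chart_img c) (\<lambda>y. f (chart_inv c y))"
proof -
  have "smooth_map M euclidean_atlas f" using f unfolding smooth_functions_def by blast
  moreover have "(UNIV, \<lambda>x. x) \<in> euclidean_atlas" by (simp add: euclidean_atlas_def)
  ultimately show ?thesis using smooth_mapD(2)[OF _ c] by fastforce
qed

section \<open>Pointwise operations on vector fields\<close>

abbreviation "vf_add M \<equiv> sec_add (tangent_bundle M)"
abbreviation "vf_mult M \<equiv> sec_mult (tangent_bundle M)"
abbreviation "vf_scale M \<equiv> sec_scale (tangent_bundle M)"
abbreviation "vf_diff M \<equiv> sec_diff (tangent_bundle M)"
abbreviation "vf_apply M \<equiv> sec_apply (tangent_bundle M)"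

lemma vf_apply_pt:
  assumes "p \<in> points M"
  shows "vf_add M A B p = (fst (A p), \<lambda>c. snd (A p) c + snd (B p) c)"
    "vf_mult M f A p = (fst (A p), \<lambda>c. f p *\<^sub>R snd (A p) c)"
    "vf_scale M a A p = (fst (A p), \<lambda>c. a *\<^sub>R snd (A p) c)"
    "vf_diff M A B p = (fst (A p), \<lambda>c. snd (A p) c - snd (B p) c)"
    "vf_apply M h A p = h (A p)"
    "sec_zero (tangent_bundle M) p = (p, \<lambda>c. 0)"
  using assms by (simp_all add: sec_add_def sec_mult_def sec_scale_def sec_diff_def sec_apply_def sec_zero_def)

lemma chart_rep_ops:
  assumes "c \<in> M" "y \<in> chart_img c"
  shows "chart_rep c (vf_add M A B) y = chart_rep c A y + chart_rep c B y"
    "chart_rep c (vf_mult M f A) y = f (chart_inv c y) *\<^sub>R chart_rep c A y"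
    "chart_rep c (vf_scale M a A) y = a *\<^sub>R chart_rep c A y"
    "chart_rep c (vf_diff M A B) y = chart_rep c A y - chart_rep c B y"
    "chart_rep c (sec_zero (tangent_bundle M)) y = 0"
proof -
  have "chart_inv c y \<in> points M" using chart_inv_in_dom[OF assms(2)] assms(1) unfolding points_def by blast
  then show "chart_rep c (vf_add M A B) y = chart_rep c A y + chart_rep c B y"
    "chart_rep c (vf_mult M f A) y = f (chart_inv c y) *\<^sub>R chart_rep c A y"
    "chart_rep c (vf_scale M a A) y = a *\<^sub>R chart_rep c A y"
    "chart_rep c (vf_diff M A B) y = chart_rep c A y - chart_rep c B y"
    "chart_rep c (sec_zero (tangent_bundle M)) y = 0"
    by (simp_all add: chart_rep_def vf_apply_pt)
qed

lemma vector_field_eqI_chart_rep: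
  assumes M: "smooth_atlas M" and A: "A \<in> vector_fields M" and B: "B \<in> vector_fields M"
    and eq: "\<And>c y. c \<in> M \<Longrightarrow> y \<in> chart_img c \<Longrightarrow> chart_rep c A y = chart_rep c B y"
  shows "A = B"
proof (rule vector_field_eqI[OF A B])
  fix p assume "p \<in> points M"
  then obtain c where c: "c \<in> M" "p \<in> chart_dom c" unfolding points_def by blast
  have "snd (A p) c = snd (B p) c"
    using eq[OF c(1), of "chart_map c p"] c by (simp add: chart_rep_def chart_inv_chart_map[OF M c])
  then show "\<exists>c\<in>M. p \<in> chart_dom c \<and> snd (A p) c = snd (B p) c" using c by blast
qed

lemma vf_add_closed:
  assumes M: "smooth_atlas M" and A: "A \<in> vector_fields M" and B: "B \<in> vector_fields M"
  shows "vf_add M A B \<in> vector_fields M"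
proof (rule vector_fieldI[OF M])
  fix p assume "p \<in> points M"
  then show "vf_add M A B p \<in> vb_fibre (tangent_bundle M) p"
    using vector_field_in_fibre[OF A] vector_field_in_fibre[OF B] tangent_space_add[OF M]
    by (simp add: vf_apply_pt tangent_fibre_iff)
next
  fix c assume c: "c \<in> M"
  show "smooth_on (chart_img c) (chart_rep c (vf_add M A B))"
    by (rule smooth_on_cong[OF open_chart_img[OF M c] _ smooth_on_add[OF open_chart_img[OF M c]
          smooth_on_chart_rep[OF M A c] smooth_on_chart_rep[OF M B c]]])
      (simp add: chart_rep_ops[OF c])
qed (simp add: sec_add_def)

text \<open>Makes scaling by a real number an instance of multiplication by a smooth function, so
  that the laws for scaling come from those for multiplication.\<close>

lemma smooth_functions_const: "smooth_atlas M \<Longrightarrow> (\<lambda>_. a) \<in> smooth_functions M"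
  by (simp add: smooth_functions_def smooth_map_def euclidean_atlas_def points_def
      open_chart_img comp_def smooth_on_const)

lemma sec_zero_closed:
  assumes M: "smooth_atlas M"
  shows "sec_zero (tangent_bundle M) \<in> vector_fields M"
proof (rule vector_fieldI[OF M])
  fix c assume c: "c \<in> M"
  show "smooth_on (chart_img c) (chart_rep c (sec_zero (tangent_bundle M)))"
    by (rule smooth_on_cong[OF open_chart_img[OF M c] _ smooth_on_const[OF open_chart_img[OF M c], of 0]])
      (simp add: chart_rep_ops[OF c])
qed (simp_all add: sec_zero_def tangent_fibre_iff tangent_space_zero[OF M])

lemma vf_mult_closed:
  assumes M: "smooth_atlas M" and f: "f \<in> smooth_functions M" and A: "A \<in> vector_fields M"
  shows "vf_mult M f A \<in> vector_fields M"
proof (rule vector_fieldI[OF M])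
  fix p assume "p \<in> points M"
  then show "vf_mult M f A p \<in> vb_fibre (tangent_bundle M) p"
    using vector_field_in_fibre[OF A] tangent_space_scale[OF M]
    by (simp add: vf_apply_pt tangent_fibre_iff)
next
  fix c assume c: "c \<in> M"
  show "smooth_on (chart_img c) (chart_rep c (vf_mult M f A))"
    by (rule smooth_on_cong[OF open_chart_img[OF M c] _ smooth_on_scaleR[OF open_chart_img[OF M c]
          smooth_on_smooth_function[OF M f c] smooth_on_chart_rep[OF M A c]]])
      (simp add: chart_rep_ops[OF c])
qed (simp add: sec_mult_def)

lemma vf_scale_closed:
  "smooth_atlas M \<Longrightarrow> A \<in> vector_fields M \<Longrightarrow> vf_scale M a A \<in> vector_fields M"
  unfolding sec_scale_def by (rule vf_mult_closed[OF _ smooth_functions_const])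

lemma vf_diff_closed:
  "smooth_atlas M \<Longrightarrow> A \<in> vector_fields M \<Longrightarrow> B \<in> vector_fields M \<Longrightarrow> vf_diff M A B \<in> vector_fields M"
  unfolding sec_diff_def by (intro vf_add_closed vf_scale_closed)

section \<open>Bundle endomorphisms acting on vector fields\<close>

lemma vbundle_map_in_fibre:
  assumes "vbundle_map (tangent_bundle M) (tangent_bundle M) h" "\<xi> \<in> vb_fibre (tangent_bundle M) p"
  shows "h \<xi> \<in> vb_fibre (tangent_bundle M) p"
  using assms smooth_map_in_points[of "tangent_manifold M" "tangent_manifold M" h \<xi>]
  unfolding vbundle_map_def vb_fibre_def by simp

lemma vbundle_map_add:
  assumes "vbundle_map (tangent_bundle M) (tangent_bundle M) h"
    "\<xi> \<in> vb_fibre (tangent_bundle M) p" "\<eta> \<in> vb_fibre (tangent_bundle M) p" "p \<in> points M"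
  shows "h (vb_add (tangent_bundle M) \<xi> \<eta>) = vb_add (tangent_bundle M) (h \<xi>) (h \<eta>)"
  using assms unfolding vbundle_map_def by simp

lemma vbundle_map_scale:
  assumes "vbundle_map (tangent_bundle M) (tangent_bundle M) h"
    "\<xi> \<in> vb_fibre (tangent_bundle M) p" "p \<in> points M"
  shows "h (vb_scale (tangent_bundle M) a \<xi>) = vb_scale (tangent_bundle M) a (h \<xi>)"
  using assms unfolding vbundle_map_def by simp

lemma vf_apply_closed:
  assumes M: "smooth_atlas M" and h: "vbundle_map (tangent_bundle M) (tangent_bundle M) h"
    and A: "A \<in> vector_fields M"
  shows "vf_apply M h A \<in> vector_fields M"
proof -
  have "smooth_map M (tangent_manifold M) (\<lambda>p. h (A p))"
    using smooth_map_compose[OF M smooth_atlas_tangent_manifold[OF M] smooth_atlas_tangent_manifold[OF M]] A h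
    by (simp add: sections_def vbundle_map_def)
  then have "smooth_map M (tangent_manifold M) (\<lambda>p\<in>points M. h (A p))"
    by (rule smooth_map_cong[OF M smooth_atlas_tangent_manifold[OF M]]) simp
  then show ?thesis
    using vbundle_map_in_fibre[OF h vector_field_in_fibre[OF A]]
    by (simp add: sections_def sec_apply_def tangent_fibre_iff)
qed

lemma vf_apply_add:
  assumes M: "smooth_atlas M" and h: "vbundle_map (tangent_bundle M) (tangent_bundle M) h"
    and A: "A \<in> vector_fields M" and B: "B \<in> vector_fields M"
  shows "vf_apply M h (vf_add M A B) = vf_add M (vf_apply M h A) (vf_apply M h B)"
proof (rule extensionalityI[of _ "points M"])
  fix p assume p: "p \<in> points M"
  have "h (vb_add (tangent_bundle M) (A p) (B p)) = vb_add (tangent_bundle M) (h (A p)) (h (B p))"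
    using h vector_field_in_fibre[OF A p] vector_field_in_fibre[OF B p] p unfolding vbundle_map_def by simp
  then show "vf_apply M h (vf_add M A B) p = vf_add M (vf_apply M h A) (vf_apply M h B) p"
    using p by (simp add: vf_apply_pt)
qed (simp_all add: sec_apply_def sec_add_def)

lemma vf_apply_mult:
  assumes M: "smooth_atlas M" and h: "vbundle_map (tangent_bundle M) (tangent_bundle M) h"
    and A: "A \<in> vector_fields M"
  shows "vf_apply M h (vf_mult M f A) = vf_mult M f (vf_apply M h A)"
proof (rule extensionalityI[of _ "points M"])
  fix p assume p: "p \<in> points M"
  have "h (vb_scale (tangent_bundle M) (f p) (A p)) = vb_scale (tangent_bundle M) (f p) (h (A p))"
    using h vector_field_in_fibre[OF A p] p unfolding vbundle_map_def by simp
  then show "vf_apply M h (vf_mult M f A) p = vf_mult M f (vf_apply M h A) p"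
    using p by (simp add: vf_apply_pt)
qed (simp_all add: sec_apply_def sec_mult_def)

lemma vf_apply_scale:
  assumes M: "smooth_atlas M" and h: "vbundle_map (tangent_bundle M) (tangent_bundle M) h" and A: "A \<in> vector_fields M"
  shows "vf_apply M h (vf_scale M a A) = vf_scale M a (vf_apply M h A)"
  unfolding sec_scale_def by (rule vf_apply_mult[OF M h A])

section \<open>The Lie bracket\<close>

text \<open>The coordinate expression of the Lie bracket, with the sign that matches [X, Y] f = X (Y
  f) - Y (X f).\<close>

definition local_bracket :: "('e::euclidean_space \<Rightarrow> 'e) \<Rightarrow> ('e \<Rightarrow> 'e) \<Rightarrow> 'e \<Rightarrow> 'e" where
  "local_bracket X Y y = frechet_derivative Y (at y) (X y) - frechet_derivative X (at y) (Y y)"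

lemma frechet_derivative_eqI: "(f has_derivative f') (at x) \<Longrightarrow> frechet_derivative f (at x) = f'"
  using frechet_derivative_at by metis

text \<open>Both sides are chosen from the same set of derivatives, so the equality holds even where
  that set is empty. This is why \<open>local_bracket_cong\<close> can do without
  smoothness.\<close>

lemma frechet_derivative_cong_open:
  assumes "open S" "y \<in> S" "\<And>z. z \<in> S \<Longrightarrow> f z = g z"
  shows "frechet_derivative f (at y) = frechet_derivative g (at y)"
proof -
  have "(f has_derivative h) (at y) \<longleftrightarrow> (g has_derivative h) (at y)" for h
    using has_derivative_transform_within_open[of f h y UNIV S g]
      has_derivative_transform_within_open[of g h y UNIV S f] assms by auto
  then show ?thesis by (simp add: frechet_derivative_def)
qed

lemma smooth_on_local_bracket:
  assumes S: "open S" and X: "smooth_on S X" and Y: "smooth_on S Y"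
  shows "smooth_on S (local_bracket X Y)"
  unfolding local_bracket_def[abs_def]
  by (intro smooth_on_diff[OF S] smooth_on_frechet_derivative_apply[OF S S _ smooth_on_id[OF S]] X Y) auto

text \<open>A product rule for z \<mapsto> Df(z)(Y z), where base point and direction both move: one
  term differentiates Df with the direction frozen at \<open>Y y\<close>, the other differentiates
  the direction. The basis expansion reduces it to derivatives of f along fixed vectors, the only
  ones whose differentiability is at hand.\<close>

lemma derivative_of_derivative_apply:
  fixes f :: "'a::euclidean_space \<Rightarrow> 'b::euclidean_space"
  assumes S: "open S" "y \<in> S" and f: "smooth_on S f" and Y: "smooth_on S Y"
  shows "((\<lambda>z. frechet_derivative f (at z) (Y z)) has_derivative
    (\<lambda>u. frechet_derivative (\<lambda>z. frechet_derivative f (at z) (Y y)) (at y) u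
       + frechet_derivative f (at y) (frechet_derivative Y (at y) u))) (at y)"
proof -
  let ?D = "\<lambda>z. frechet_derivative f (at z)"
  have lin: "linear (?D z)" if "z \<in> S" for z
    by (rule has_derivative_linear[OF smooth_on_has_derivative[OF f S(1) that]])
  have Db: "((\<lambda>z. ?D z b) has_derivative frechet_derivative (\<lambda>z. ?D z b) (at y)) (at y)" for b
    by (rule smooth_on_has_derivative[OF smooth_on_frechet_derivative[OF f] S])
  have DY: "(Y has_derivative frechet_derivative Y (at y)) (at y)"
    by (rule smooth_on_has_derivative[OF Y S])
  have sumD: "((\<lambda>z. ?D z v) has_derivative (\<lambda>u. \<Sum>b\<in>Basis. (v \<bullet> b) *\<^sub>R frechet_derivative (\<lambda>z. ?D z b) (at y) u)) (at y)" for v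
  proof (rule has_derivative_transform_within_open[OF _ S])
    show "((\<lambda>z. \<Sum>b\<in>Basis. (v \<bullet> b) *\<^sub>R ?D z b) has_derivative
      (\<lambda>u. \<Sum>b\<in>Basis. (v \<bullet> b) *\<^sub>R frechet_derivative (\<lambda>z. ?D z b) (at y) u)) (at y)"
      by (intro has_derivative_sum has_derivative_scaleR_right Db)
  qed (rule linear_euclidean_expand[OF lin, symmetric])
  have "((\<lambda>z. \<Sum>b\<in>Basis. (Y z \<bullet> b) *\<^sub>R ?D z b) has_derivative
      (\<lambda>u. \<Sum>b\<in>Basis. (Y y \<bullet> b) *\<^sub>R frechet_derivative (\<lambda>z. ?D z b) (at y) u
        + (frechet_derivative Y (at y) u \<bullet> b) *\<^sub>R ?D y b)) (at y)"
    by (intro has_derivative_sum has_derivative_scaleR Db has_derivative_inner_left DY)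
  then have "((\<lambda>z. ?D z (Y z)) has_derivative
      (\<lambda>u. \<Sum>b\<in>Basis. (Y y \<bullet> b) *\<^sub>R frechet_derivative (\<lambda>z. ?D z b) (at y) u
        + (frechet_derivative Y (at y) u \<bullet> b) *\<^sub>R ?D y b)) (at y)"
    by (rule has_derivative_transform_within_open[OF _ S]) (rule linear_euclidean_expand[OF lin, symmetric])
  moreover have "(\<Sum>b\<in>Basis. (Y y \<bullet> b) *\<^sub>R frechet_derivative (\<lambda>z. ?D z b) (at y) u
        + (frechet_derivative Y (at y) u \<bullet> b) *\<^sub>R ?D y b)
      = frechet_derivative (\<lambda>z. ?D z (Y y)) (at y) u + ?D y (frechet_derivative Y (at y) u)" for u
    unfolding sum.distrib frechet_derivative_eqI[OF sumD[of "Y y"]]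
      linear_euclidean_expand[OF lin[OF S(2)], of "frechet_derivative Y (at y) u"] by (rule refl)
  ultimately show ?thesis by simp
qed

text \<open>Each iterated derivative contributes a second derivative of f in the directions X and Y;
  by symmetry these cancel, and the first order terms that survive form the bracket.\<close>

lemma local_bracket_commutator:
  fixes f :: "'a::euclidean_space \<Rightarrow> 'b::euclidean_space"
  assumes S: "open S" "y \<in> S" and f: "smooth_on S f" and X: "smooth_on S X" and Y: "smooth_on S Y"
  shows "frechet_derivative f (at y) (local_bracket X Y y)
    = frechet_derivative (\<lambda>z. frechet_derivative f (at z) (Y z)) (at y) (X y)
    - frechet_derivative (\<lambda>z. frechet_derivative f (at z) (X z)) (at y) (Y y)"
  unfolding frechet_derivative_eqI[OF derivative_of_derivative_apply[OF S f Y]]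
    frechet_derivative_eqI[OF derivative_of_derivative_apply[OF S f X]] local_bracket_def
  using smooth_on_second_derivative_symmetric[OF S f, of "Y y" "X y"]
    linear_diff[OF has_derivative_linear[OF smooth_on_has_derivative[OF f S]]]
  by simp

lemma local_bracket_has_derivative:
  assumes S: "open S" "y \<in> S" and X: "smooth_on S X" and Y: "smooth_on S Y"
  shows "(local_bracket X Y has_derivative (\<lambda>u.
      (frechet_derivative (\<lambda>z. frechet_derivative Y (at z) (X y)) (at y) u
       + frechet_derivative Y (at y) (frechet_derivative X (at y) u))
    - (frechet_derivative (\<lambda>z. frechet_derivative X (at z) (Y y)) (at y) u
       + frechet_derivative X (at y) (frechet_derivative Y (at y) u)))) (at y)"
  unfolding local_bracket_def[abs_def]
  by (rule has_derivative_diff[OF derivative_of_derivative_apply[OF S Y X] derivative_of_derivative_apply[OF S X Y]])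

text \<open>Each double bracket expands into two second derivatives and four composites of first
  derivatives. In the cyclic sum the composites cancel in pairs by themselves, the second
  derivatives by their symmetry.\<close>

lemma local_bracket_jacobi:
  assumes S: "open S" "y \<in> S" and X: "smooth_on S X" and Y: "smooth_on S Y" and Z: "smooth_on S Z"
  shows "local_bracket X (local_bracket Y Z) y + (local_bracket Y (local_bracket Z X) y
    + local_bracket Z (local_bracket X Y) y) = 0"
proof -
  note lin = has_derivative_linear[OF smooth_on_has_derivative[OF _ S]]
  note sym = smooth_on_second_derivative_symmetric[OF S]
  have expand: "local_bracket A (local_bracket B C) y =
      frechet_derivative (\<lambda>z. frechet_derivative C (at z) (B y)) (at y) (A y)
      + frechet_derivative C (at y) (frechet_derivative B (at y) (A y))
      - frechet_derivative (\<lambda>z. frechet_derivative B (at z) (C y)) (at y) (A y)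
      - frechet_derivative B (at y) (frechet_derivative C (at y) (A y))
      - frechet_derivative A (at y) (frechet_derivative C (at y) (B y))
      + frechet_derivative A (at y) (frechet_derivative B (at y) (C y))"
    if "smooth_on S A" "smooth_on S B" "smooth_on S C" for A B C
    unfolding local_bracket_def[of A]
      frechet_derivative_eqI[OF local_bracket_has_derivative[OF S that(2,3)]]
    by (simp add: local_bracket_def linear_diff[OF lin[OF that(1)]])
  show ?thesis
    unfolding expand[OF X Y Z] expand[OF Y Z X] expand[OF Z X Y]
      sym[OF X, of "Y y" "Z y"] sym[OF Y, of "X y" "Z y"] sym[OF Z, of "X y" "Y y"]
    by (simp add: algebra_simps)
qed

lemma local_bracket_add:
  assumes S: "open S" "y \<in> S" and X: "smooth_on S X" and X': "smooth_on S X'" and Y: "smooth_on S Y"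
  shows "local_bracket (\<lambda>z. X z + X' z) Y y = local_bracket X Y y + local_bracket X' Y y"
  unfolding local_bracket_def
    frechet_derivative_eqI[OF has_derivative_add[OF smooth_on_has_derivative[OF X S] smooth_on_has_derivative[OF X' S]]]
  by (simp add: linear_add[OF has_derivative_linear[OF smooth_on_has_derivative[OF Y S]]])

lemma local_bracket_mult:
  assumes S: "open S" "y \<in> S" and X: "smooth_on S X" and Y: "smooth_on S Y" and f: "smooth_on S f"
  shows "local_bracket X (\<lambda>z. f z *\<^sub>R Y z) y
    = f y *\<^sub>R local_bracket X Y y + frechet_derivative f (at y) (X y) *\<^sub>R Y y"
  unfolding local_bracket_def
    frechet_derivative_eqI[OF has_derivative_scaleR[OF smooth_on_has_derivative[OF f S] smooth_on_has_derivative[OF Y S]]]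
  by (simp add: linear_scale[OF has_derivative_linear[OF smooth_on_has_derivative[OF X S]]] algebra_simps)

lemma local_bracket_antisym: "local_bracket X Y y = - local_bracket Y X y"
  by (simp add: local_bracket_def)

lemma local_bracket_cong:
  assumes S: "open S" "y \<in> S" and "\<And>z. z \<in> S \<Longrightarrow> X z = X' z" "\<And>z. z \<in> S \<Longrightarrow> Y z = Y' z"
  shows "local_bracket X Y y = local_bracket X' Y' y"
  using frechet_derivative_cong_open[OF S, of X X'] frechet_derivative_cong_open[OF S, of Y Y'] assms
  by (simp add: local_bracket_def)

text \<open>Independence of the chart that \<open>derivation\<close> happens to choose: the change
  of coordinates in f is undone by the transformation law of v. Differentiability at one point is
  all that is asked of f, so that the lemma also applies to functions x \<mapsto>
  \<open>derivation M (Y x) f\<close>.\<close>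

lemma derivation_chart:
  assumes M: "smooth_atlas M" and c: "c \<in> M" "p \<in> chart_dom c" and v: "v \<in> tangent_space M p"
    and f: "(\<lambda>y. f (chart_inv c y)) differentiable (at (chart_map c p))"
  shows "derivation M (p, v) f = frechet_derivative (\<lambda>y. f (chart_inv c y)) (at (chart_map c p)) (v c)"
proof -
  define d where "d = chart_at M p"
  have "p \<in> points M" using c unfolding points_def by blast
  then have d: "d \<in> M" "p \<in> chart_dom d" unfolding d_def by (rule chart_at)+
  let ?f = "\<lambda>y. f (chart_inv c y)"
  have "((\<lambda>y. ?f (transition d c y)) has_derivative (\<lambda>w. frechet_derivative ?f (at (chart_map c p))
      (frechet_derivative (transition d c) (at (chart_map d p)) w))) (at (chart_map d p))"
    by (rule has_derivative_compose[OF transition_has_derivative[OF M d(1) c(1) d(2) c(2)]])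
      (use f in \<open>simp add: transition_chart_map[OF M d] frechet_derivative_works\<close>)
  then have "(f \<circ> chart_inv d has_derivative (\<lambda>w. frechet_derivative ?f (at (chart_map c p))
      (frechet_derivative (transition d c) (at (chart_map d p)) w))) (at (chart_map d p))"
  proof (rule has_derivative_transform_within_open[OF _ open_overlap[OF M d(1) c(1)]])
    show "chart_map d p \<in> chart_map d ` (chart_dom d \<inter> chart_dom c)" using c d by blast
    fix y assume "y \<in> chart_map d ` (chart_dom d \<inter> chart_dom c)"
    then obtain q where "q \<in> chart_dom d" "q \<in> chart_dom c" "y = chart_map d q" by blast
    then show "f (chart_inv c (transition d c y)) = (f \<circ> chart_inv d) y"
      by (simp add: transition_chart_map[OF M d(1)] chart_inv_chart_map[OF M c(1)] chart_inv_chart_map[OF M d(1)])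
  qed
  from frechet_derivative_eqI[OF this] show ?thesis
    using tangent_space_component[OF v d c] by (simp add: derivation_def Let_def d_def)
qed

text \<open>The vector with components \<open>local_bracket\<close> has the property that defines
  the Lie bracket. All derivations are read in \<open>c\<close>, over the open set on which both the
  chart and f are defined, where the claim is \<open>local_bracket_commutator\<close>.\<close>

lemma derivation_commutator_chart:
  assumes M: "smooth_atlas M" and X: "X \<in> vector_fields M" and Y: "Y \<in> vector_fields M"
    and U: "openin (manifold_topology M) U" and f: "f \<in> smooth_functions (open_submanifold M U)"
    and c: "c \<in> M" "p \<in> chart_dom c" and p: "p \<in> U"
    and xi: "\<xi> \<in> vb_fibre (tangent_bundle M) p"
    and xi_c: "snd \<xi> c = local_bracket (chart_rep c X) (chart_rep c Y) (chart_map c p)"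
  shows "derivation M \<xi> f = derivation M (X p) (\<lambda>x. derivation M (Y x) f)
      - derivation M (Y p) (\<lambda>x. derivation M (X x) f)"
proof -
  let ?S = "chart_map c ` (chart_dom c \<inter> U)" and ?f = "\<lambda>y. f (chart_inv c y)"
  have S: "open ?S" using U c(1) unfolding openin_manifold_topology[OF M] by (simp add: Int_commute)
  have y: "chart_map c p \<in> ?S" using c p by blast
  have sub: "?S \<subseteq> chart_img c" by blast
  let ?c = "(chart_dom c \<inter> U, chart_map c)"
  have inv: "chart_inv ?c z = chart_inv c z" if z: "z \<in> ?S" for z
  proof -
    obtain q where q: "q \<in> chart_dom c \<inter> U" "z = chart_map c q" using z by blast
    have "inj_on (chart_map c) (chart_dom c \<inter> U)"
      using M c(1) unfolding smooth_atlas_def by (meson inf_le1 inj_on_subset)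
    from inv_into_f_f[OF this q(1)] show ?thesis
      using q chart_inv_chart_map[OF M c(1), of q] by (simp add: chart_inv_def)
  qed
  have fs: "smooth_on ?S ?f"
  proof -
    have "?c \<in> open_submanifold M U" using c(1) unfolding open_submanifold_def by (rule imageI)
    moreover have "smooth_map (open_submanifold M U) euclidean_atlas f" using f unfolding smooth_functions_def by blast
    moreover have "(UNIV, \<lambda>x. x) \<in> euclidean_atlas" by (simp add: euclidean_atlas_def)
    ultimately have "smooth_on ?S (\<lambda>y. f (chart_inv ?c y))" using smooth_mapD(2) by fastforce
    then show ?thesis by (rule smooth_on_cong[OF S, rotated]) (simp add: inv)
  qed
  have SS: "chart_inv c z \<in> chart_dom c" "chart_map c (chart_inv c z) = z" "chart_inv c z \<in> points M"
    if z: "z \<in> ?S" for z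
    using chart_inv_in_dom[OF subsetD[OF sub z]] chart_map_chart_inv[OF subsetD[OF sub z]] c(1)
    unfolding points_def by blast+
  have pM: "p \<in> points M" using c unfolding points_def by blast
  have der: "derivation M (Z (chart_inv c z)) f = frechet_derivative ?f (at z) (chart_rep c Z z)"
    if Z: "Z \<in> vector_fields M" and z: "z \<in> ?S" for Z z
  proof -
    have "?f differentiable (at z)"
      using smooth_on_has_derivative[OF fs S z] by (rule differentiableI)
    then have "derivation M (fst (Z (chart_inv c z)), snd (Z (chart_inv c z))) f
        = frechet_derivative ?f (at z) (chart_rep c Z z)"
      using derivation_chart[OF M c(1) SS(1)[OF z] vector_field_snd[OF Z SS(3)[OF z]], of f]
      by (simp add: SS[OF z] vector_field_fst[OF Z SS(3)[OF z]] chart_rep_def)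
    then show ?thesis by simp
  qed
  have smZ: "smooth_on ?S (chart_rep c Z)" if "Z \<in> vector_fields M" for Z
    by (rule smooth_on_subset[OF smooth_on_chart_rep[OF M that c(1)] sub])
  \<comment> \<open>The inner derivation is known in coordinates only on \<open>?S\<close>. That set
    is an open neighbourhood of the point in question, which determines the outer derivative
    there.\<close>
  have der2: "derivation M (W p) (\<lambda>x. derivation M (Z x) f)
      = frechet_derivative (\<lambda>z. frechet_derivative ?f (at z) (chart_rep c Z z)) (at (chart_map c p))
         (chart_rep c W (chart_map c p))"
    if Z: "Z \<in> vector_fields M" and W: "W \<in> vector_fields M" for Z W
  proof -
    let ?g = "\<lambda>z. frechet_derivative ?f (at z) (chart_rep c Z z)"
    have "smooth_on ?S ?g"
      by (rule smooth_on_frechet_derivative_apply[OF S S fs smooth_on_id[OF S] _ smZ[OF Z]]) simp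
    from smooth_on_has_derivative[OF this S y]
    have "((\<lambda>z. derivation M (Z (chart_inv c z)) f) has_derivative
        frechet_derivative ?g (at (chart_map c p))) (at (chart_map c p))"
      by (rule has_derivative_transform_within_open[OF _ S y]) (simp add: der[OF Z])
    then have "derivation M (fst (W p), snd (W p)) (\<lambda>x. derivation M (Z x) f)
      = frechet_derivative ?g (at (chart_map c p)) (chart_rep c W (chart_map c p))"
      using derivation_chart[OF M c vector_field_snd[OF W pM], of "\<lambda>x. derivation M (Z x) f"]
        frechet_derivative_eqI differentiableI
      by (metis (no_types, lifting) chart_inv_chart_map[OF M c] chart_rep_def vector_field_fst[OF W pM])
    then show ?thesis by simp
  qed
  have "derivation M (fst \<xi>, snd \<xi>) f = frechet_derivative ?f (at (chart_map c p)) (snd \<xi> c)"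
    using derivation_chart[OF M c, of "snd \<xi>" f] xi smooth_on_has_derivative[OF fs S y]
    by (simp add: tangent_fibre_iff differentiableI)
  then show ?thesis
    unfolding der2[OF X Y] der2[OF Y X] xi_c
    using local_bracket_commutator[OF S y fs smZ[OF X] smZ[OF Y]] by simp
qed

text \<open>The test functions are the coordinates of one chart around p. They are smooth on the
  open chart domain, and their derivations return the components of the vector.\<close>

lemma tangent_vector_eqI_derivation:
  assumes M: "smooth_atlas M" and xi: "\<xi> \<in> vb_fibre (tangent_bundle M) p" and eta: "\<eta> \<in> vb_fibre (tangent_bundle M) p"
    and eq: "\<And>U f. openin (manifold_topology M) U \<Longrightarrow> p \<in> U \<Longrightarrow> f \<in> smooth_functions (open_submanifold M U)
      \<Longrightarrow> derivation M \<xi> f = derivation M \<eta> f"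
  shows "\<xi> = \<eta>"
proof -
  have p: "fst \<xi> = p" "fst \<eta> = p" "snd \<xi> \<in> tangent_space M p" "snd \<eta> \<in> tangent_space M p" "p \<in> points M"
    using xi eta by (simp_all add: tangent_fibre_iff)
  then obtain c where c: "c \<in> M" "p \<in> chart_dom c" unfolding points_def by blast
  have img: "open (chart_img c)" by (rule open_chart_img[OF M c(1)])
  have y: "chart_map c p \<in> chart_img c" using c by blast
  let ?N = "open_submanifold M (chart_dom c)"
  have N: "smooth_atlas ?N"
    by (rule smooth_atlas_open_submanifold[OF M open_overlap[OF M _ c(1)]])
  have "c = (chart_dom c \<inter> chart_dom c, chart_map c)" by simp
  then have cN: "c \<in> ?N" unfolding open_submanifold_def using c(1) by (rule image_eqI)
  have dom: "q \<in> chart_dom c" if "q \<in> points ?N" for q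
    using that unfolding points_def open_submanifold_def by auto
  have comp: "snd \<xi> c \<bullet> b = snd \<eta> c \<bullet> b" for b
  proof -
    let ?f = "\<lambda>q. chart_map c q \<bullet> b"
    have sm: "smooth_on (chart_img c) (\<lambda>y. ?f (chart_inv c y))"
      by (rule smooth_on_cong[OF img _ smooth_on_linear[OF img bounded_linear_inner_left smooth_on_id[OF img]]])
        (simp add: chart_map_chart_inv)
    have E: "(UNIV, \<lambda>x. x) \<in> euclidean_atlas" by (simp add: euclidean_atlas_def)
    have "smooth_map ?N euclidean_atlas ?f"
      by (rule smooth_mapI_local[OF N smooth_atlas_euclidean],
          intro bexI[OF _ cN] bexI[OF _ E] exI[of _ "chart_img c"] conjI)
        (use img dom sm in auto)
    then have "?f \<in> smooth_functions ?N" by (simp add: smooth_functions_def)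
    then have "derivation M \<xi> ?f = derivation M \<eta> ?f" using eq openin_chart_dom[OF M c(1)] c(2) by blast
    moreover have "derivation M \<zeta> ?f = snd \<zeta> c \<bullet> b" if z: "fst \<zeta> = p" "snd \<zeta> \<in> tangent_space M p" for \<zeta>
    proof -
      have "((\<lambda>y. y \<bullet> b) has_derivative (\<lambda>w. w \<bullet> b)) (at (chart_map c p))"
        by (intro has_derivative_inner_left has_derivative_ident)
      then have "((\<lambda>y. ?f (chart_inv c y)) has_derivative (\<lambda>w. w \<bullet> b)) (at (chart_map c p))"
        by (rule has_derivative_transform_within_open[OF _ img y]) (simp add: chart_map_chart_inv)
      then have "derivation M (p, snd \<zeta>) ?f = snd \<zeta> c \<bullet> b"
        using derivation_chart[OF M c z(2), of ?f] frechet_derivative_eqI differentiableI by metis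
      then show ?thesis using z(1) by (metis prod.collapse)
    qed
    ultimately show ?thesis using p by simp
  qed
  have "snd \<xi> = snd \<eta>"
    by (rule tangent_space_eqI[OF p(3,4) c]) (rule euclidean_eqI, rule comp)
  then show ?thesis using p by (simp add: prod_eq_iff)
qed

text \<open>Resolves the definite description: existence is
  \<open>derivation_commutator_chart\<close>, uniqueness is
  \<open>tangent_vector_eqI_derivation\<close>.\<close>

lemma lie_bracket_chart:
  assumes M: "smooth_atlas M" and X: "X \<in> vector_fields M" and Y: "Y \<in> vector_fields M"
    and c: "c \<in> M" "p \<in> chart_dom c"
  shows "lie_bracket M X Y p
    = (p, tvec_of M c p (local_bracket (chart_rep c X) (chart_rep c Y) (chart_map c p)))"
proof -
  let ?xi = "(p, tvec_of M c p (local_bracket (chart_rep c X) (chart_rep c Y) (chart_map c p)))"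
  have p: "p \<in> points M" using c unfolding points_def by blast
  have fib: "?xi \<in> vb_fibre (tangent_bundle M) p"
    using tvec_of_in_tangent_space[OF M c] p by (simp add: tangent_fibre_iff)
  have comp: "snd ?xi c = local_bracket (chart_rep c X) (chart_rep c Y) (chart_map c p)"
    by (simp add: tvec_of_component[OF M c])
  note comm = derivation_commutator_chart[OF M X Y _ _ c _ fib comp]
  have "(THE \<xi>. \<xi> \<in> vb_fibre (tangent_bundle M) p \<and>
     (\<forall>U f. openin (manifold_topology M) U \<and> p \<in> U \<and> f \<in> smooth_functions (open_submanifold M U) \<longrightarrow>
        derivation M \<xi> f = derivation M (X p) (\<lambda>x. derivation M (Y x) f) -
          derivation M (Y p) (\<lambda>x. derivation M (X x) f))) = ?xi"
  proof (rule the_equality, intro conjI allI impI fib, elim conjE, erule (1) comm[rotated], assumption)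
    fix \<xi> assume xi: "\<xi> \<in> vb_fibre (tangent_bundle M) p \<and>
     (\<forall>U f. openin (manifold_topology M) U \<and> p \<in> U \<and> f \<in> smooth_functions (open_submanifold M U) \<longrightarrow>
        derivation M \<xi> f = derivation M (X p) (\<lambda>x. derivation M (Y x) f) -
          derivation M (Y p) (\<lambda>x. derivation M (X x) f))"
    show "\<xi> = ?xi"
      by (rule tangent_vector_eqI_derivation[OF M _ fib]) (use xi comm in auto)
  qed
  then show ?thesis using p by (simp add: lie_bracket_def)
qed

lemma chart_rep_lie_bracket:
  assumes M: "smooth_atlas M" and X: "X \<in> vector_fields M" and Y: "Y \<in> vector_fields M"
    and c: "c \<in> M" and y: "y \<in> chart_img c"
  shows "chart_rep c (lie_bracket M X Y) y = local_bracket (chart_rep c X) (chart_rep c Y) y"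
  using lie_bracket_chart[OF M X Y c chart_inv_in_dom[OF y]] tvec_of_component[OF M c chart_inv_in_dom[OF y]]
  by (simp add: chart_rep_def[of c "lie_bracket M X Y"] chart_map_chart_inv[OF y])

lemma lie_bracket_closed:
  assumes M: "smooth_atlas M" and X: "X \<in> vector_fields M" and Y: "Y \<in> vector_fields M"
  shows "lie_bracket M X Y \<in> vector_fields M"
proof (rule vector_fieldI[OF M])
  fix p assume p: "p \<in> points M"
  then obtain c where c: "c \<in> M" "p \<in> chart_dom c" unfolding points_def by blast
  show "lie_bracket M X Y p \<in> vb_fibre (tangent_bundle M) p"
    using lie_bracket_chart[OF M X Y c] tvec_of_in_tangent_space[OF M c] p by (simp add: tangent_fibre_iff)
next
  fix c assume c: "c \<in> M"
  note S = open_chart_img[OF M c]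
  show "smooth_on (chart_img c) (chart_rep c (lie_bracket M X Y))"
    by (rule smooth_on_cong[OF S _ smooth_on_local_bracket[OF S smooth_on_chart_rep[OF M X c] smooth_on_chart_rep[OF M Y c]]])
      (simp add: chart_rep_lie_bracket[OF M X Y c])
qed (simp add: lie_bracket_def)

section \<open>Lie algebra laws and the Leibniz rule for vector fields\<close>

lemma lie_bracket_self:
  assumes M: "smooth_atlas M" and X: "X \<in> vector_fields M"
  shows "lie_bracket M X X = sec_zero (tangent_bundle M)"
  by (rule vector_field_eqI_chart_rep[OF M lie_bracket_closed[OF M X X] sec_zero_closed[OF M]])
    (simp add: chart_rep_lie_bracket[OF M X X] chart_rep_ops local_bracket_def)

lemma lie_bracket_antisym:
  assumes M: "smooth_atlas M" and X: "X \<in> vector_fields M" and Y: "Y \<in> vector_fields M"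
  shows "lie_bracket M X Y = vf_scale M (-1) (lie_bracket M Y X)"
  by (rule vector_field_eqI_chart_rep[OF M lie_bracket_closed[OF M X Y] vf_scale_closed[OF M lie_bracket_closed[OF M Y X]]])
    (simp add: chart_rep_lie_bracket[OF M] X Y chart_rep_ops local_bracket_antisym[of "chart_rep _ Y"])

lemma lie_bracket_add_left:
  assumes M: "smooth_atlas M" and X: "X \<in> vector_fields M" and X': "X' \<in> vector_fields M" and Y: "Y \<in> vector_fields M"
  shows "lie_bracket M (vf_add M X X') Y = vf_add M (lie_bracket M X Y) (lie_bracket M X' Y)"
proof (rule vector_field_eqI_chart_rep[OF M])
  fix c y assume c: "c \<in> M" and y: "y \<in> chart_img c"
  note S = open_chart_img[OF M c]
  have "local_bracket (chart_rep c (vf_add M X X')) (chart_rep c Y) y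
      = local_bracket (\<lambda>z. chart_rep c X z + chart_rep c X' z) (chart_rep c Y) y"
    by (rule local_bracket_cong[OF S y]) (simp_all add: chart_rep_ops[OF c])
  also have "\<dots> = local_bracket (chart_rep c X) (chart_rep c Y) y + local_bracket (chart_rep c X') (chart_rep c Y) y"
    by (rule local_bracket_add[OF S y]) (simp_all add: smooth_on_chart_rep[OF M _ c] X X' Y)
  finally show "chart_rep c (lie_bracket M (vf_add M X X') Y) y = chart_rep c (vf_add M (lie_bracket M X Y) (lie_bracket M X' Y)) y"
    by (simp add: chart_rep_lie_bracket[OF M _ _ c y] chart_rep_ops[OF c y] X X' Y vf_add_closed[OF M])
qed (intro lie_bracket_closed vf_add_closed M X X' Y)+

lemma lie_bracket_mult_right:
  assumes M: "smooth_atlas M" and X: "X \<in> vector_fields M" and Y: "Y \<in> vector_fields M" and f: "f \<in> smooth_functions M"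
  shows "lie_bracket M X (vf_mult M f Y)
    = vf_add M (vf_mult M f (lie_bracket M X Y)) (vf_mult M (\<lambda>p. derivation M (X p) f) Y)"
    (is "_ = ?R")
proof (rule extensionalityI[of _ "points M"])
  fix p assume p: "p \<in> points M"
  then obtain c where c: "c \<in> M" "p \<in> chart_dom c" unfolding points_def by blast
  note S = open_chart_img[OF M c(1)]
  let ?y = "chart_map c p"
  have y: "?y \<in> chart_img c" using c by blast
  note fs = smooth_on_smooth_function[OF M f c(1)]
  have "derivation M (fst (X p), snd (X p)) f = frechet_derivative (\<lambda>y. f (chart_inv c y)) (at ?y) (chart_rep c X ?y)"
    using derivation_chart[OF M c vector_field_snd[OF X p], of f] smooth_on_has_derivative[OF fs S y]
    by (simp add: differentiableI vector_field_fst[OF X p] chart_rep_def chart_inv_chart_map[OF M c])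
  then have D: "derivation M (X p) f = frechet_derivative (\<lambda>y. f (chart_inv c y)) (at ?y) (chart_rep c X ?y)" by simp
  have "local_bracket (chart_rep c X) (chart_rep c (vf_mult M f Y)) ?y
      = local_bracket (chart_rep c X) (\<lambda>z. f (chart_inv c z) *\<^sub>R chart_rep c Y z) ?y"
    by (rule local_bracket_cong[OF S y]) (simp_all add: chart_rep_ops[OF c(1)])
  also have "\<dots> = f p *\<^sub>R local_bracket (chart_rep c X) (chart_rep c Y) ?y + derivation M (X p) f *\<^sub>R chart_rep c Y ?y"
    unfolding D
    by (subst local_bracket_mult[OF S y])
      (simp_all add: smooth_on_chart_rep[OF M _ c(1)] X Y fs chart_inv_chart_map[OF M c])
  finally have eq: "chart_rep c (lie_bracket M X (vf_mult M f Y)) ?y = chart_rep c ?R ?y"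
    by (simp add: chart_rep_lie_bracket[OF M _ _ c(1) y] chart_rep_ops[OF c(1) y] X Y vf_mult_closed[OF M f]
        chart_inv_chart_map[OF M c])
  \<comment> \<open>The comparison is made inside the fibre over p, because
    \<open>vector_field_eqI_chart_rep\<close> would ask for \<open>?R\<close> to be a vector field,
    hence for smoothness of p \<mapsto> \<open>derivation M (X p) f\<close>.\<close>
  have L: "lie_bracket M X (vf_mult M f Y) p \<in> vb_fibre (tangent_bundle M) p"
    by (intro vector_field_in_fibre lie_bracket_closed vf_mult_closed M f X Y p)
  have "lie_bracket M X Y p \<in> vb_fibre (tangent_bundle M) p"
    by (intro vector_field_in_fibre lie_bracket_closed M X Y p)
  then have R: "?R p \<in> vb_fibre (tangent_bundle M) p"
    using vector_field_in_fibre[OF Y p] p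
    by (simp add: tangent_fibre_iff vf_apply_pt tangent_space_add[OF M] tangent_space_scale[OF M])
  have "snd (lie_bracket M X (vf_mult M f Y) p) = snd (?R p)"
    using L R eq by (intro tangent_space_eqI[OF _ _ c])
      (simp_all add: tangent_fibre_iff chart_rep_def chart_inv_chart_map[OF M c])
  then show "lie_bracket M X (vf_mult M f Y) p = ?R p"
    using L R by (simp add: tangent_fibre_iff prod_eq_iff)
qed (simp_all add: lie_bracket_def sec_add_def)

lemma lie_bracket_jacobi:
  assumes M: "smooth_atlas M" and X: "X \<in> vector_fields M" and Y: "Y \<in> vector_fields M" and Z: "Z \<in> vector_fields M"
  shows "vf_add M (lie_bracket M X (lie_bracket M Y Z)) (vf_add M (lie_bracket M Y (lie_bracket M Z X))
    (lie_bracket M Z (lie_bracket M X Y))) = sec_zero (tangent_bundle M)"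
proof (rule vector_field_eqI_chart_rep[OF M])
  fix c y assume c: "c \<in> M" and y: "y \<in> chart_img c"
  note S = open_chart_img[OF M c]
  have "chart_rep c (lie_bracket M A (lie_bracket M B C)) y
      = local_bracket (chart_rep c A) (local_bracket (chart_rep c B) (chart_rep c C)) y"
    if A: "A \<in> vector_fields M" and B: "B \<in> vector_fields M" and C: "C \<in> vector_fields M" for A B C
    unfolding chart_rep_lie_bracket[OF M A lie_bracket_closed[OF M B C] c y]
    by (rule local_bracket_cong[OF S y]) (simp_all add: chart_rep_lie_bracket[OF M B C c])
  then show "chart_rep c (vf_add M (lie_bracket M X (lie_bracket M Y Z)) (vf_add M (lie_bracket M Y (lie_bracket M Z X))
    (lie_bracket M Z (lie_bracket M X Y)))) y = chart_rep c (sec_zero (tangent_bundle M)) y"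
    using local_bracket_jacobi[OF S y smooth_on_chart_rep[OF M X c] smooth_on_chart_rep[OF M Y c] smooth_on_chart_rep[OF M Z c]]
    by (simp add: X Y Z chart_rep_ops[OF c y])
qed (intro lie_bracket_closed vf_add_closed sec_zero_closed M X Y Z)+

lemma lie_bracket_add_right:
  assumes M: "smooth_atlas M" and X: "X \<in> vector_fields M" and Y: "Y \<in> vector_fields M" and Y': "Y' \<in> vector_fields M"
  shows "lie_bracket M X (vf_add M Y Y') = vf_add M (lie_bracket M X Y) (lie_bracket M X Y')"
  unfolding lie_bracket_antisym[OF M X vf_add_closed[OF M Y Y']] lie_bracket_antisym[OF M X Y]
    lie_bracket_antisym[OF M X Y'] lie_bracket_add_left[OF M Y Y' X]
  by (rule extensionalityI[of _ "points M"])
    (simp_all add: vf_apply_pt scaleR_add_right, simp_all add: sec_scale_def sec_mult_def sec_add_def)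

lemma derivation_const: "derivation M \<xi> (\<lambda>_. a) = 0"
  by (simp add: derivation_def split_beta Let_def comp_def)

lemma lie_bracket_scale_right:
  assumes M: "smooth_atlas M" and X: "X \<in> vector_fields M" and Y: "Y \<in> vector_fields M"
  shows "lie_bracket M X (vf_scale M a Y) = vf_scale M a (lie_bracket M X Y)"
  unfolding sec_scale_def lie_bracket_mult_right[OF M X Y smooth_functions_const[OF M]] derivation_const
  by (rule extensionalityI[of _ "points M"])
    (simp_all add: vf_apply_pt, simp_all add: sec_mult_def sec_add_def)

lemma lie_bracket_scale_left:
  assumes M: "smooth_atlas M" and X: "X \<in> vector_fields M" and Y: "Y \<in> vector_fields M"
  shows "lie_bracket M (vf_scale M a X) Y = vf_scale M a (lie_bracket M X Y)"
  unfolding lie_bracket_antisym[OF M X Y] lie_bracket_antisym[OF M vf_scale_closed[OF M X] Y]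
    lie_bracket_scale_right[OF M Y X]
  by (rule extensionalityI[of _ "points M"])
    (simp_all add: vf_apply_pt, simp_all add: sec_scale_def sec_mult_def)

section \<open>The algebroid of an involutive almost product structure\<close>

text \<open>After expansion the terms under \<open>h\<close> group into three Jacobi sums, in each of which exactly
  one argument is left unprojected.\<close>

lemma projected_bracket_jacobi:
  fixes X :: "'x::ab_group_add set"
  assumes X_add: "\<And>x y. x \<in> X \<Longrightarrow> y \<in> X \<Longrightarrow> x + y \<in> X" and X_diff: "\<And>x y. x \<in> X \<Longrightarrow> y \<in> X \<Longrightarrow> x - y \<in> X"
    and br_X: "\<And>x y. x \<in> X \<Longrightarrow> y \<in> X \<Longrightarrow> br x y \<in> X" and h_X: "\<And>x. x \<in> X \<Longrightarrow> h x \<in> X"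
    and br_add: "\<And>x y z. x \<in> X \<Longrightarrow> y \<in> X \<Longrightarrow> z \<in> X \<Longrightarrow> br z (x + y) = br z x + br z y"
    and jacobi: "\<And>x y z. x \<in> X \<Longrightarrow> y \<in> X \<Longrightarrow> z \<in> X \<Longrightarrow> br x (br y z) + (br y (br z x) + br z (br x y)) = 0"
    and h_add: "\<And>x y. x \<in> X \<Longrightarrow> y \<in> X \<Longrightarrow> h (x + y) = h x + h y"
    and hh: "\<And>x. x \<in> X \<Longrightarrow> h (h x) = h x"
    and inv: "\<And>x y. x \<in> X \<Longrightarrow> y \<in> X \<Longrightarrow> h (br (x - h x) (y - h y)) = 0"
    and K: "\<And>x y. K x y = br (x - h x) (y - h y) + (h (br (x - h x) y) + h (br x (y - h y)))"
    and xyz: "x \<in> X" "y \<in> X" "z \<in> X"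
  shows "K x (K y z) + (K y (K z x) + K z (K x y)) = 0"
proof -
  define v where "v x = x - h x" for x
  note cl = X_add X_diff br_X h_X
  have v_X: "v x \<in> X" if "x \<in> X" for x using that by (simp add: v_def cl)
  have h_diff: "h (x - y) = h x - h y" if "x \<in> X" "y \<in> X" for x y
    using h_add[of "x - y" y] that by (simp add: cl)
  have br_diff: "br z (x - y) = br z x - br z y" if "x \<in> X" "y \<in> X" "z \<in> X" for x y z
    using br_add[of "x - y" y z] that by (simp add: cl)
  have Kv: "K x y = br (v x) (v y) + (h (br (v x) y) + h (br x (v y)))" for x y
    by (simp add: K v_def)
  have inv': "h (br (v x) (v y)) = 0" if "x \<in> X" "y \<in> X" for x y
    using inv[OF that] by (simp add: v_def)
  have v_br: "v (br (v x) (v y)) = br (v x) (v y)" if "x \<in> X" "y \<in> X" for x y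
    using inv'[OF that] by (simp add: v_def[of "br _ _"])
  have vh: "v (h x) = 0" if "x \<in> X" for x using hh[OF that] by (simp add: v_def)
  have v_add: "v (x + y) = v x + v y" if "x \<in> X" "y \<in> X" for x y
    using that by (simp add: v_def h_add)
  \<comment> \<open>Thus \<open>v\<close> carries \<open>K\<close> to the original bracket: it kills
    the two summands in the image of \<open>h\<close> and fixes the first one.\<close>
  have vK: "v (K x y) = br (v x) (v y)" if "x \<in> X" "y \<in> X" for x y
    using that by (simp add: Kv v_add cl v_X v_br vh)
  \<comment> \<open>Writing \<open>w\<close> as \<open>h w + v w\<close>, the second part
    contributes a bracket of vertical elements, which \<open>h\<close> annihilates. In the
    semidirect product picture, a vertical element acts through the horizontal part only.\<close>
  have br_h: "h (br (v x) (h w)) = h (br (v x) w)" if "x \<in> X" "w \<in> X" for x w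
  proof -
    have "h (br (v x) w) = h (br (v x) (h w) + br (v x) (v w))"
      using that br_add[of "h w" "v w" "v x"] by (simp add: cl v_X) (simp add: v_def)
    then show ?thesis using that by (simp add: h_add cl v_X inv')
  qed
  have expand: "K x (K y z) = br (v x) (br (v y) (v z))
      + h (br (v x) (br (v y) z) + (br (v x) (br y (v z)) + br x (br (v y) (v z))))"
    if "x \<in> X" "y \<in> X" "z \<in> X" for x y z
  proof -
    \<comment> \<open>The vertical summand of \<open>K y z\<close> disappears under
      \<open>h\<close>, and in the other two summands \<open>br_h\<close> strips off the inner
      \<open>h\<close>.\<close>
    have "h (br (v x) (br (v y) (v z))) = 0"
      using inv'[of x "br (v y) (v z)"] that by (simp add: v_br v_X cl)
    then have "h (br (v x) (K y z)) = h (br (v x) (br (v y) z)) + h (br (v x) (br y (v z)))"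
      using that by (simp add: Kv[of y z] br_add h_add cl v_X br_h)
    then show ?thesis
      using that by (simp add: Kv[of x "K y z"] vK h_add cl v_X add.assoc)
  qed
  have "K x (K y z) + (K y (K z x) + K z (K x y))
    = (br (v x) (br (v y) (v z)) + (br (v y) (br (v z) (v x)) + br (v z) (br (v x) (v y))))
    + (h (br x (br (v y) (v z)) + (br (v y) (br (v z) x) + br (v z) (br x (v y))))
    + (h (br (v x) (br y (v z)) + (br y (br (v z) (v x)) + br (v z) (br (v x) y)))
    + h (br (v x) (br (v y) z) + (br (v y) (br z (v x)) + br z (br (v x) (v y))))))"
    using xyz by (simp add: expand h_add cl v_X ac_simps)
  \<comment> \<open>Each of the four groups is a Jacobi sum up to the outer \<open>h\<close>;
    \<open>h_diff\<close> at equal arguments gives \<open>h 0 = 0\<close>.\<close>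
  also have "\<dots> = 0"
    using xyz h_diff[of x x] by (simp add: jacobi v_X)
  finally show ?thesis .
qed

text \<open>One definition for both projections: \<open>s = 1\<close> gives h and
  \<open>s = -1\<close> gives v, so their smoothness and linearity are proved together.\<close>

definition half_sum :: "real \<Rightarrow> (('p, 'e::euclidean_space) tvec \<Rightarrow> ('p, 'e) tvec) \<Rightarrow> ('p, 'e) tvec \<Rightarrow> ('p, 'e) tvec" where
  "half_sum s N \<xi> = (fst \<xi>, \<lambda>c. (1/2) *\<^sub>R (snd \<xi> c + s *\<^sub>R snd (N \<xi>) c))"

section \<open>The half sums as bundle endomorphisms\<close>

lemma half_sum_in_fibre:
  assumes M: "smooth_atlas M" and N: "vbundle_map (tangent_bundle M) (tangent_bundle M) N"
    and xi: "\<xi> \<in> vb_fibre (tangent_bundle M) p"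
  shows "half_sum s N \<xi> \<in> vb_fibre (tangent_bundle M) p"
proof -
  have "(\<lambda>c. (1/2) *\<^sub>R snd \<xi> c + (1/2 * s) *\<^sub>R snd (N \<xi>) c) \<in> tangent_space M p"
    using vbundle_map_in_fibre[OF N xi] xi by (intro tangent_space_lincomb[OF M]) (simp_all add: tangent_fibre_iff)
  then show ?thesis using xi by (simp add: half_sum_def tangent_fibre_iff scaleR_add_right)
qed

lemma smooth_map_half_sum:
  assumes M: "smooth_atlas M" and N: "vbundle_map (tangent_bundle M) (tangent_bundle M) N"
  shows "smooth_map (tangent_manifold M) (tangent_manifold M) (half_sum s N)"
proof (rule smooth_mapI_local[OF smooth_atlas_tangent_manifold[OF M] smooth_atlas_tangent_manifold[OF M]])
  fix x assume "x \<in> points (tangent_manifold M)"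
  then obtain c where c: "c \<in> M" "fst x \<in> chart_dom c" "snd x \<in> tangent_space M (fst x)"
    unfolding points_tangent_manifold_iff unfolding points_def by blast
  let ?C = "tangent_chart M c" and ?V = "chart_img (tangent_chart M c)"
  note C = tangent_chart_in[OF c(1)]
  have V: "open ?V" by (rule open_chart_img[OF smooth_atlas_tangent_manifold[OF M] C])
  have fib: "\<xi> \<in> vb_fibre (tangent_bundle M) (fst \<xi>)" if "\<xi> \<in> chart_dom ?C" for \<xi>
    using that c(1) unfolding tangent_fibre_iff tangent_chart_dom_iff points_def by blast
  have stay: "\<eta> \<in> chart_dom ?C" if "\<xi> \<in> chart_dom ?C" "\<eta> \<in> vb_fibre (tangent_bundle M) (fst \<xi>)" for \<xi> \<eta>
    using that unfolding tangent_fibre_iff tangent_chart_dom_iff by simp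
  have N_stay: "N \<xi> \<in> chart_dom ?C" if "\<xi> \<in> chart_dom ?C" for \<xi>
    by (rule stay[OF that vbundle_map_in_fibre[OF N fib[OF that]]])
  then have "chart_dom ?C \<inter> N -` chart_dom ?C = chart_dom ?C" by blast
  moreover have "smooth_map (tangent_manifold M) (tangent_manifold M) N" using N by (simp add: vbundle_map_def)
  ultimately have sN: "smooth_on ?V (\<lambda>y. chart_map ?C (N (chart_inv ?C y)))"
    using smooth_mapD(2)[OF _ C C, of N] by simp
  have "smooth_on ?V (\<lambda>y. (fst y, (1/2) *\<^sub>R (snd y + s *\<^sub>R snd (chart_map ?C (N (chart_inv ?C y))))))"
    by (intro smooth_on_Pair[OF V] smooth_on_scaleR[OF V] smooth_on_const[OF V] smooth_on_add[OF V]
        smooth_on_fst[OF V smooth_on_id[OF V]] smooth_on_snd[OF V smooth_on_id[OF V]] smooth_on_snd[OF V sN])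
  then have "smooth_on ?V (\<lambda>y. chart_map ?C (half_sum s N (chart_inv ?C y)))"
  proof (rule smooth_on_cong[OF V, rotated])
    fix y assume y: "y \<in> ?V"
    have "y = chart_map ?C (chart_inv ?C y)" by (rule chart_map_chart_inv[OF y, symmetric])
    then have "fst y = chart_map c (fst (chart_inv ?C y))" "snd y = snd (chart_inv ?C y) c"
      unfolding tangent_chart_simps(2) by (metis fst_conv, metis snd_conv)
    then show "(fst y, (1/2) *\<^sub>R (snd y + s *\<^sub>R snd (chart_map ?C (N (chart_inv ?C y)))))
      = chart_map ?C (half_sum s N (chart_inv ?C y))"
      by (simp add: half_sum_def tangent_chart_simps(2))
  qed
  moreover have "\<forall>y\<in>?V. half_sum s N (chart_inv ?C y) \<in> chart_dom ?C"
    using stay half_sum_in_fibre[OF M N fib] chart_inv_in_dom[of _ ?C] by blast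
  moreover have "x \<in> chart_dom ?C" using c by (simp add: tangent_chart_dom_iff)
  moreover from this have "chart_map ?C x \<in> ?V" by (rule imageI)
  ultimately show "\<exists>C\<in>tangent_manifold M. \<exists>d\<in>tangent_manifold M. \<exists>V. open V \<and> x \<in> chart_dom C \<and> chart_map C x \<in> V \<and>
      V \<subseteq> chart_img C \<and> (\<forall>y\<in>V. half_sum s N (chart_inv C y) \<in> chart_dom d) \<and>
      smooth_on V (\<lambda>y. chart_map d (half_sum s N (chart_inv C y)))"
    using V by (intro bexI[OF _ C] exI[of _ ?V] conjI order_refl)
qed

lemma vbundle_map_half_sum:
  assumes M: "smooth_atlas M" and N: "vbundle_map (tangent_bundle M) (tangent_bundle M) N"
  shows "vbundle_map (tangent_bundle M) (tangent_bundle M) (half_sum s N)"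
  unfolding vbundle_map_def
proof (intro conjI ballI allI)
  show "smooth_map (vb_total (tangent_bundle M)) (vb_total (tangent_bundle M)) (half_sum s N)"
    using smooth_map_half_sum[OF M N] by simp
  fix p assume p: "p \<in> points (vb_base (tangent_bundle M))"
  fix \<xi> assume xi: "\<xi> \<in> vb_fibre (tangent_bundle M) p"
  have f: "fst (N \<zeta>) = p" "fst \<zeta> = p" if "\<zeta> \<in> vb_fibre (tangent_bundle M) p" for \<zeta>
    using vbundle_map_in_fibre[OF N that] that by (simp_all add: tangent_fibre_iff)
  {
    fix \<eta> assume eta: "\<eta> \<in> vb_fibre (tangent_bundle M) p"
    show "half_sum s N (vb_add (tangent_bundle M) \<xi> \<eta>) = vb_add (tangent_bundle M) (half_sum s N \<xi>) (half_sum s N \<eta>)"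
      using vbundle_map_add[OF N xi eta] p by (simp add: half_sum_def algebra_simps)
  next
    fix a show "half_sum s N (vb_scale (tangent_bundle M) a \<xi>) = vb_scale (tangent_bundle M) a (half_sum s N \<xi>)"
      using vbundle_map_scale[OF N xi] p by (simp add: half_sum_def algebra_simps)
  }
qed (simp_all add: half_sum_def)

text \<open>The form in which the algebroid axioms are verified; its agreement with the formula in
  contracted bracket and torsion is \<open>K_formula\<close>.\<close>

definition projected_bracket ::
  "('p, 'e::euclidean_space) atlas \<Rightarrow> (('p, 'e) tvec \<Rightarrow> ('p, 'e) tvec) \<Rightarrow>
   ('p \<Rightarrow> ('p, 'e) tvec) \<Rightarrow> ('p \<Rightarrow> ('p, 'e) tvec) \<Rightarrow> 'p \<Rightarrow> ('p, 'e) tvec" where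
  "projected_bracket M N A B =
     (let h = vf_apply M (half_sum 1 N); v = vf_apply M (half_sum (-1) N) in
      vf_add M (lie_bracket M (v A) (v B)) (vf_add M (h (lie_bracket M (v A) B)) (h (lie_bracket M A (v B)))))"

lemma vf_apply_half_sum:
  "vf_apply M (half_sum s N) A = vf_scale M (1/2) (vf_add M A (vf_scale M s (vf_apply M N A)))"
  by (rule extensionalityI[of _ "points M"])
    (simp_all add: vf_apply_pt half_sum_def, simp_all add: sec_apply_def sec_scale_def sec_mult_def)

text \<open>Embeds the vector fields into a type of class \<open>ab_group_add\<close>.\<close>

definition vf_components :: "('p, 'e::euclidean_space) atlas \<Rightarrow> ('p \<Rightarrow> ('p, 'e) tvec) \<Rightarrow> 'p \<times> ('p, 'e) chart \<Rightarrow> 'e" where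
  "vf_components M A = (\<lambda>(p, c). if p \<in> points M then snd (A p) c else 0)"

lemma vf_components_ops:
  "vf_components M (vf_add M A B) = vf_components M A + vf_components M B"
  "vf_components M (vf_diff M A B) = vf_components M A - vf_components M B"
  "vf_components M (sec_zero (tangent_bundle M)) = 0"
  by (auto simp: vf_components_def fun_eq_iff vf_apply_pt)

lemma vf_components_inj: "inj_on (vf_components M) (vector_fields M)"
proof (rule inj_onI)
  fix A B assume A: "A \<in> vector_fields M" and B: "B \<in> vector_fields M" and eq: "vf_components M A = vf_components M B"
  show "A = B"
  proof (rule vector_field_eqI[OF A B])
    fix p assume p: "p \<in> points M"
    then obtain c where "c \<in> M" "p \<in> chart_dom c" unfolding points_def by blast
    then show "\<exists>c\<in>M. p \<in> chart_dom c \<and> snd (A p) c = snd (B p) c"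
      using fun_cong[OF eq, of "(p, c)"] p by (intro bexI[of _ c]) (auto simp: vf_components_def)
  qed
qed

lemma half_sum_vb: "half_sum s N \<xi> = vb_scale (tangent_bundle M) (1/2) (vb_add (tangent_bundle M) \<xi> (vb_scale (tangent_bundle M) s (N \<xi>)))"
  by (simp add: half_sum_def)

text \<open>Isolates what the algebroid rests on. The involution \<open>N\<close> splits the tangent
  bundle into its eigenbundles for 1 and -1, and \<open>involutive\<close> says, by means of the
  projection onto the former, that fields in the latter are closed under the bracket.\<close>

locale involutive_product_structure =
  fixes M :: "('p, 'e::euclidean_space) atlas" and N :: "('p, 'e) tvec \<Rightarrow> ('p, 'e) tvec"
  assumes manifold: "smooth_manifold M"
    and N: "vbundle_map (tangent_bundle M) (tangent_bundle M) N"
    and NN: "\<And>\<xi>. \<xi> \<in> points (tangent_manifold M) \<Longrightarrow> N (N \<xi>) = \<xi>"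
    and involutive: "\<And>A B. A \<in> vector_fields M \<Longrightarrow> B \<in> vector_fields M \<Longrightarrow>
      vf_apply M (half_sum 1 N) (lie_bracket M (vf_apply M (half_sum (-1) N) A) (vf_apply M (half_sum (-1) N) B))
        = sec_zero (tangent_bundle M)"
begin

abbreviation "E \<equiv> tangent_bundle M"
abbreviation "h \<equiv> vf_apply M (half_sum 1 N)"
abbreviation "v \<equiv> vf_apply M (half_sum (-1) N)"
abbreviation "K \<equiv> projected_bracket M N"

lemma atlas: "smooth_atlas M"
  using manifold by (simp add: smooth_manifold_def)

lemmas half_sum_map = vbundle_map_half_sum[OF atlas N]

lemma N_half_sum:
  assumes xi: "\<xi> \<in> vb_fibre E p"
  shows "snd (N (half_sum s N \<xi>)) c = (1/2) *\<^sub>R (snd (N \<xi>) c + s *\<^sub>R snd \<xi> c)"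
proof -
  have p: "p \<in> points M" using xi by (simp add: tangent_fibre_iff)
  note N_xi = vbundle_map_in_fibre[OF N xi]
  have sN: "vb_scale E s (N \<xi>) \<in> vb_fibre E p"
    using N_xi tangent_space_scale[OF atlas] by (simp add: tangent_fibre_iff)
  then have "vb_add E \<xi> (vb_scale E s (N \<xi>)) \<in> vb_fibre E p"
    using xi tangent_space_add[OF atlas] by (simp add: tangent_fibre_iff)
  then have "N (half_sum s N \<xi>) = vb_scale E (1/2) (vb_add E (N \<xi>) (vb_scale E s (N (N \<xi>))))"
    unfolding half_sum_vb[of s N \<xi> M]
    by (simp only: vbundle_map_scale[OF N _ p] vbundle_map_add[OF N xi sN p] N_xi)
  moreover have "N (N \<xi>) = \<xi>" using NN xi by (simp add: vb_fibre_def)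
  ultimately show ?thesis by simp
qed

lemma half_sum_half_sum:
  assumes "\<xi> \<in> vb_fibre E p"
  shows "half_sum 1 N (half_sum 1 N \<xi>) = half_sum 1 N \<xi>"
    "half_sum 1 N (half_sum (-1) N \<xi>) = (p, \<lambda>c. 0)"
proof -
  have "(1/2) *\<^sub>R ((1/2) *\<^sub>R (a + b) + (1/2) *\<^sub>R (b + a)) = (1/2) *\<^sub>R (a + b)" for a b :: 'e
    by (simp add: algebra_simps flip: scaleR_add_left)
  then show "half_sum 1 N (half_sum 1 N \<xi>) = half_sum 1 N \<xi>"
    by (simp add: half_sum_def[of 1 N "half_sum 1 N \<xi>"] N_half_sum[OF assms]) (simp add: half_sum_def)
  show "half_sum 1 N (half_sum (-1) N \<xi>) = (p, \<lambda>c. 0)"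
    using assms by (simp add: half_sum_def[of 1 N "half_sum (-1) N \<xi>"] N_half_sum[OF assms])
      (simp add: half_sum_def tangent_fibre_iff algebra_simps)
qed

lemma h_closed: "A \<in> vector_fields M \<Longrightarrow> h A \<in> vector_fields M"
  and v_closed: "A \<in> vector_fields M \<Longrightarrow> v A \<in> vector_fields M"
  by (rule vf_apply_closed[OF atlas half_sum_map], assumption)+

lemma h_h:
  assumes A: "A \<in> vector_fields M"
  shows "h (h A) = h A" "h (v A) = sec_zero E"
proof -
  note pt = half_sum_half_sum[OF vector_field_in_fibre[OF A]]
  show "h (h A) = h A"
    by (rule extensionalityI[of _ "points M"]) (simp_all add: vf_apply_pt pt, simp_all add: sec_apply_def)
  show "h (v A) = sec_zero E"
    by (rule extensionalityI[of _ "points M"]) (simp_all add: vf_apply_pt pt, simp_all add: sec_apply_def sec_zero_def)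
qed

text \<open>The zero section on the right restricts \<open>A\<close> to the points of the manifold:
  the left-hand side is extensional by construction, while \<open>A\<close> is arbitrary
  here.\<close>

lemma h_plus_v: "vf_add M (h A) (v A) = vf_add M A (sec_zero E)"
proof (rule extensionalityI[of _ "points M"])
  fix p assume p: "p \<in> points M"
  have "(1/2) *\<^sub>R (a + b) + (1/2) *\<^sub>R (a - b) = a" for a b :: 'e
    by (simp add: algebra_simps flip: scaleR_add_left)
  then show "vf_add M (h A) (v A) p = vf_add M A (sec_zero E) p"
    using p by (simp add: vf_apply_pt half_sum_def)
qed (simp_all add: sec_add_def)

section \<open>Algebroid axioms for the projected bracket\<close>

lemma K_eq: "K A B = vf_add M (lie_bracket M (v A) (v B)) (vf_add M (h (lie_bracket M (v A) B)) (h (lie_bracket M A (v B))))"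
  by (simp add: projected_bracket_def Let_def)

lemmas closed = lie_bracket_closed[OF atlas] vf_add_closed[OF atlas] vf_scale_closed[OF atlas] vf_diff_closed[OF atlas]
  h_closed v_closed vf_apply_closed[OF atlas N] vf_mult_closed[OF atlas]

lemma K_closed: "A \<in> vector_fields M \<Longrightarrow> B \<in> vector_fields M \<Longrightarrow> K A B \<in> vector_fields M"
  by (simp add: K_eq closed)

lemma K_add:
  assumes A: "A \<in> vector_fields M" and B: "B \<in> vector_fields M" and C: "C \<in> vector_fields M"
  shows "K (vf_add M A B) C = vf_add M (K A C) (K B C)" "K C (vf_add M A B) = vf_add M (K C A) (K C B)"
proof -
  note rules = vf_apply_add[OF atlas half_sum_map] lie_bracket_add_left[OF atlas] lie_bracket_add_right[OF atlas] closed A B C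
  have swap: "vf_add M (vf_add M P P') (vf_add M (vf_add M Q Q') (vf_add M R R'))
      = vf_add M (vf_add M P (vf_add M Q R)) (vf_add M P' (vf_add M Q' R'))" for P P' Q Q' R R'
    by (rule extensionalityI[of _ "points M"]) (simp_all add: vf_apply_pt ac_simps, simp_all add: sec_add_def)
  show "K (vf_add M A B) C = vf_add M (K A C) (K B C)" "K C (vf_add M A B) = vf_add M (K C A) (K C B)"
    by (simp_all add: K_eq rules swap)
qed

text \<open>The bracket of \<open>v A\<close> with itself vanishes, and the two terms under
  \<open>h\<close> cancel by antisymmetry of the Lie bracket.\<close>

lemma K_self:
  assumes A: "A \<in> vector_fields M"
  shows "K A A = sec_zero E"
proof -
  have "h (lie_bracket M A (v A)) = vf_scale M (-1) (h (lie_bracket M (v A) A))"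
    unfolding lie_bracket_antisym[OF atlas A v_closed[OF A]]
    by (rule vf_apply_scale[OF atlas half_sum_map]) (simp add: closed A)
  then show ?thesis
    unfolding K_eq lie_bracket_self[OF atlas v_closed[OF A]]
    using vector_field_fst[OF lie_bracket_closed[OF atlas v_closed[OF A] A]]
    by (intro extensionalityI[of _ "points M"])
      (simp_all add: vf_apply_pt, simp_all add: sec_add_def sec_zero_def)
qed

text \<open>Multiplying B by f creates three derivative terms: (vA)(f) vB, (vA)(f) hB and A(f)
  h(vB). The last is zero, and the first two combine to (vA)(f) B since h + v is the
  identity.\<close>

lemma K_mult_right:
  assumes A: "A \<in> vector_fields M" and B: "B \<in> vector_fields M" and f: "f \<in> smooth_functions M"
  shows "K A (vf_mult M f B) = vf_add M (vf_mult M f (K A B)) (vf_mult M (\<lambda>p. derivation M (half_sum (-1) N (A p)) f) B)"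
proof (rule extensionalityI[of _ "points M"])
  fix p assume p: "p \<in> points M"
  note fib = vector_field_in_fibre[OF _ p]
  let ?a = "derivation M (A p) f" and ?b = "derivation M (v A p) f"
  have scale_fib: "vb_scale E t \<xi> \<in> vb_fibre E p" if "\<xi> \<in> vb_fibre E p" for t \<xi>
    using that tangent_space_scale[OF atlas] by (simp add: tangent_fibre_iff)
  \<comment> \<open>Linearity within the fibre over p, in place of \<open>vf_apply_add\<close>: the
    latter needs vector fields as arguments, and the coefficients produced by
    \<open>derivation\<close> have not been shown to be smooth.\<close>
  have h_lin: "half_sum 1 N (vb_add E (vb_scale E s \<xi>) (vb_scale E t \<eta>))
      = vb_add E (vb_scale E s (half_sum 1 N \<xi>)) (vb_scale E t (half_sum 1 N \<eta>))"
    if "\<xi> \<in> vb_fibre E p" "\<eta> \<in> vb_fibre E p" for s t \<xi> \<eta>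
    using vbundle_map_add[OF half_sum_map scale_fib[OF that(1)] scale_fib[OF that(2)] p]
      vbundle_map_scale[OF half_sum_map that(1) p] vbundle_map_scale[OF half_sum_map that(2) p] by simp
  have pt: "vf_add M (vf_mult M f P) (vf_mult M g Q) p = vb_add E (vb_scale E (f p) (P p)) (vb_scale E (g p) (Q p))" for P g Q
    using p by (simp add: vf_apply_pt)
  have vB: "v (vf_mult M f B) = vf_mult M f (v B)"
    by (rule vf_apply_mult[OF atlas half_sum_map B])
  have 1: "lie_bracket M (v A) (v (vf_mult M f B)) p
      = vb_add E (vb_scale E (f p) (lie_bracket M (v A) (v B) p)) (vb_scale E ?b (v B p))"
    unfolding vB lie_bracket_mult_right[OF atlas v_closed[OF A] v_closed[OF B] f] pt ..
  have 2: "h (lie_bracket M (v A) (vf_mult M f B)) p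
      = vb_add E (vb_scale E (f p) (h (lie_bracket M (v A) B) p)) (vb_scale E ?b (h B p))"
    unfolding lie_bracket_mult_right[OF atlas v_closed[OF A] B f] vf_apply_pt(5)[OF p] pt
    by (rule h_lin) (intro fib closed A B)+
  have "h (v B) p = (p, \<lambda>c. 0)" by (simp add: h_h[OF B] vf_apply_pt p)
  then have 3: "h (lie_bracket M A (v (vf_mult M f B))) p
      = vb_add E (vb_scale E (f p) (h (lie_bracket M A (v B)) p)) (vb_scale E ?a (p, \<lambda>c. 0))"
    unfolding vB lie_bracket_mult_right[OF atlas A v_closed[OF B] f] vf_apply_pt(5)[OF p, of "half_sum 1 N"] pt
    by (metis h_lin fib closed A B)
  have vAp: "half_sum (-1) N (A p) = v A p" using p by (simp add: vf_apply_pt)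
  have "snd (h B p) c + snd (v B p) c = snd (B p) c" for c
    using fun_cong[OF fun_cong[OF h_plus_v[of B], of p, THEN arg_cong[of _ _ snd]], of c] p by (simp add: vf_apply_pt)
  then have "snd (B p) c = snd (v B p) c + snd (h B p) c" for c by (simp add: add.commute)
  moreover note vector_field_fst[OF v_closed[OF B] p] vector_field_fst[OF h_closed[OF B] p] vector_field_fst[OF B p]
  moreover have "fst (lie_bracket M (v A) (v B) p) = p"
    by (intro vector_field_fst[OF _ p] closed A B)
  ultimately show "K A (vf_mult M f B) p
      = vf_add M (vf_mult M f (K A B)) (vf_mult M (\<lambda>p. derivation M (half_sum (-1) N (A p)) f) B) p"
    unfolding K_eq pt vAp unfolding vf_apply_pt(1)[OF p] 1 2 3
    by (simp add: fun_eq_iff algebra_simps flip: scaleR_add_right)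
qed (simp_all add: K_eq sec_add_def)

lemma K_scale_right:
  assumes A: "A \<in> vector_fields M" and B: "B \<in> vector_fields M"
  shows "K A (vf_scale M a B) = vf_scale M a (K A B)"
  unfolding sec_scale_def K_mult_right[OF A B smooth_functions_const[OF atlas]] derivation_const
  by (rule extensionalityI[of _ "points M"])
    (simp_all add: vf_apply_pt, simp_all add: sec_mult_def sec_add_def)

lemma K_scale_left:
  assumes A: "A \<in> vector_fields M" and B: "B \<in> vector_fields M"
  shows "K (vf_scale M a A) B = vf_scale M a (K A B)"
proof -
  note rules = vf_apply_scale[OF atlas half_sum_map] lie_bracket_scale_left[OF atlas] closed A B
  have "vf_add M (vf_scale M a P) (vf_add M (vf_scale M a Q) (vf_scale M a R))
      = vf_scale M a (vf_add M P (vf_add M Q R))" for P Q R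
    by (rule extensionalityI[of _ "points M"])
      (simp_all add: vf_apply_pt scaleR_add_right, simp_all add: sec_add_def sec_scale_def sec_mult_def)
  then show ?thesis by (simp add: K_eq rules)
qed

text \<open>The shape x - h x in which the complementary projection occurs in
  \<open>projected_bracket_jacobi\<close>.\<close>

lemma v_eq_diff: "v A = vf_diff M A (h A)"
proof (rule extensionalityI[of _ "points M"])
  fix p assume p: "p \<in> points M"
  have "(1/2) *\<^sub>R (a - b) = a - (1/2) *\<^sub>R (a + b)" for a b :: 'e
    by (rule euclidean_eqI) (simp add: inner_diff_left inner_add_left field_simps)
  then show "v A p = vf_diff M A (h A) p"
    using p by (simp add: vf_apply_pt half_sum_def)
qed (simp_all add: sec_apply_def sec_diff_def sec_add_def)

text \<open>Vector fields carry their addition as an operation on a set, whereas the abstract Jacobi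
  lemma computes in a type of abelian groups. Bracket and projection are therefore transported along
  the injective additive map \<open>vf_components\<close>, and the resulting identity is pulled
  back.\<close>

lemma K_jacobi:
  assumes A: "A \<in> vector_fields M" and B: "B \<in> vector_fields M" and C: "C \<in> vector_fields M"
  shows "vf_add M (K A (K B C)) (vf_add M (K B (K C A)) (K C (K A B))) = sec_zero E"
proof -
  let ?c = "vf_components M" and ?X = "vf_components M ` vector_fields M"
  let ?i = "inv_into (vector_fields M) ?c"
  have ic: "?i (?c P) = P" if "P \<in> vector_fields M" for P
    by (rule inv_into_f_f[OF vf_components_inj that])
  define br where "br x y = ?c (lie_bracket M (?i x) (?i y))" for x y
  define hc where "hc x = ?c (h (?i x))" for x
  \<comment> \<open>Defined by the very formula that \<open>projected_bracket_jacobi\<close> expects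
    for all arguments; on images of vector fields the fact \<open>Kc\<close> below identifies it
    with \<open>K\<close>.\<close>
  define Kc where "Kc x y = br (x - hc x) (y - hc y) + (hc (br (x - hc x) y) + hc (br x (y - hc y)))" for x y
  have br: "br (?c P) (?c Q) = ?c (lie_bracket M P Q)" if "P \<in> vector_fields M" "Q \<in> vector_fields M" for P Q
    using that by (simp add: br_def ic)
  have hc: "hc (?c P) = ?c (h P)" if "P \<in> vector_fields M" for P
    using that by (simp add: hc_def ic)
  have vc: "?c P - ?c (h P) = ?c (v P)" for P by (simp add: v_eq_diff vf_components_ops)
  have add: "?c P + ?c Q = ?c (vf_add M P Q)" for P Q by (simp add: vf_components_ops)
  have diff: "?c P - ?c Q = ?c (vf_diff M P Q)" for P Q by (simp add: vf_components_ops)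
  have Kc: "Kc (?c P) (?c Q) = ?c (K P Q)" if "P \<in> vector_fields M" "Q \<in> vector_fields M" for P Q
    using that by (simp add: Kc_def hc vc br closed add K_eq)
  have "Kc (?c A) (Kc (?c B) (?c C)) + (Kc (?c B) (Kc (?c C) (?c A)) + Kc (?c C) (Kc (?c A) (?c B))) = 0"
  proof (rule projected_bracket_jacobi[of ?X br hc, OF _ _ _ _ _ _ _ _ _ Kc_def])
    fix x y assume "x \<in> ?X" "y \<in> ?X"
    then obtain P Q where P: "x = ?c P" "P \<in> vector_fields M" and Q: "y = ?c Q" "Q \<in> vector_fields M" by blast
    show "x + y \<in> ?X" unfolding P(1) Q(1) add by (intro imageI closed P Q)
    show "x - y \<in> ?X" unfolding P(1) Q(1) diff by (intro imageI closed P Q)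
    show "br x y \<in> ?X" unfolding P(1) Q(1) br[OF P(2) Q(2)] by (intro imageI closed P Q)
    show "hc (x + y) = hc x + hc y"
      unfolding P(1) Q(1) add hc[OF P(2)] hc[OF Q(2)] hc[OF vf_add_closed[OF atlas P(2) Q(2)]]
        vf_apply_add[OF atlas half_sum_map P(2) Q(2)] ..
    show "hc (br (x - hc x) (y - hc y)) = 0"
      by (simp add: P Q hc vc br closed involutive vf_components_ops)
  next
    fix x assume "x \<in> ?X"
    then obtain P where P: "x = ?c P" "P \<in> vector_fields M" by blast
    show "hc x \<in> ?X" unfolding P(1) hc[OF P(2)] by (intro imageI closed P)
    show "hc (hc x) = hc x" by (simp add: P hc closed h_h)
  next
    fix x y z assume "x \<in> ?X" "y \<in> ?X" "z \<in> ?X"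
    then obtain P Q R where P: "x = ?c P" "P \<in> vector_fields M" and Q: "y = ?c Q" "Q \<in> vector_fields M"
      and R: "z = ?c R" "R \<in> vector_fields M" by blast
    show "br z (x + y) = br z x + br z y"
      unfolding P(1) Q(1) R(1) add br[OF R(2) P(2)] br[OF R(2) Q(2)] br[OF R(2) vf_add_closed[OF atlas P(2) Q(2)]]
        lie_bracket_add_right[OF atlas R(2) P(2) Q(2)] ..
    show "br x (br y z) + (br y (br z x) + br z (br x y)) = 0"
      by (simp add: P Q R br closed add lie_bracket_jacobi[OF atlas]) (simp add: vf_components_ops)
  qed (intro imageI A B C)+
  then have "?c (vf_add M (K A (K B C)) (vf_add M (K B (K C A)) (K C (K A B)))) = ?c (sec_zero E)"
    by (simp add: Kc K_closed A B C vf_components_ops)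
  then show ?thesis
    by (rule inj_onD[OF vf_components_inj]) (intro closed K_closed A B C sec_zero_closed atlas)+
qed

section \<open>Comparison with the contracted bracket and the Nijenhuis torsion\<close>

lemma N_N:
  assumes A: "A \<in> vector_fields M"
  shows "vf_apply M N (vf_apply M N A) = A"
proof (rule extensionalityI[of _ "points M"])
  fix p assume p: "p \<in> points M"
  have "A p \<in> points (tangent_manifold M)"
    using vector_field_in_fibre[OF A p] by (simp add: vb_fibre_def)
  then show "vf_apply M N (vf_apply M N A) p = A p" using p by (simp add: vf_apply_pt NN)
next
  show "A \<in> extensional (points M)" using A by (simp add: sections_def)
qed (simp add: sec_apply_def)

text \<open>In terms of P = [A, B], Q = [NA, B], R = [A, NB] and S = [NA, NB] both sides equal 3/4 P
  - 1/2 Q - 1/2 R + 1/4 S + 1/2 NP - 1/4 NQ - 1/4 NR. On the right, the coefficient of P is 1/2 from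
  the bracket plus 1/4 from the torsion term N(NP), which is P because N is an involution.\<close>

lemma K_formula:
  assumes A: "A \<in> vector_fields M" and B: "B \<in> vector_fields M"
  shows "K A B = vf_add M (vf_scale M (1/2) (vf_diff M (lie_bracket M A B) (contracted_bracket M N A B)))
    (vf_scale M (1/4) (nijenhuis_torsion M N A B))"
proof -
  note rules = lie_bracket_scale_left[OF atlas] lie_bracket_scale_right[OF atlas] lie_bracket_add_left[OF atlas]
    lie_bracket_add_right[OF atlas] vf_apply_add[OF atlas N] vf_apply_scale[OF atlas N] N_N closed A B
  let ?G = "vf_apply M N"
  define P Q R S where "P = lie_bracket M A B" and "Q = lie_bracket M (?G A) B"
    and "R = lie_bracket M A (?G B)" and "S = lie_bracket M (?G A) (?G B)"
  have PQRS: "P \<in> vector_fields M" "Q \<in> vector_fields M" "R \<in> vector_fields M" "S \<in> vector_fields M"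
    by (simp_all add: P_def Q_def R_def S_def closed A B)
  have vAB: "lie_bracket M (v A) B = vf_scale M (1/2) (vf_add M P (vf_scale M (-1) Q))"
    unfolding vf_apply_half_sum P_def Q_def by (simp add: rules)
  have AvB: "lie_bracket M A (v B) = vf_scale M (1/2) (vf_add M P (vf_scale M (-1) R))"
    unfolding vf_apply_half_sum P_def R_def by (simp add: rules)
  have "lie_bracket M (?G A) (v B) = vf_scale M (1/2) (vf_add M Q (vf_scale M (-1) S))"
    unfolding vf_apply_half_sum Q_def S_def by (simp add: rules)
  moreover have "lie_bracket M (v A) (v B)
      = vf_scale M (1/2) (vf_add M (lie_bracket M A (v B)) (vf_scale M (-1) (lie_bracket M (?G A) (v B))))"
    unfolding vf_apply_half_sum[of M "-1" N A] by (simp add: rules)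
  ultimately have vAvB: "lie_bracket M (v A) (v B) = vf_scale M (1/2)
      (vf_add M (vf_scale M (1/2) (vf_add M P (vf_scale M (-1) R)))
        (vf_scale M (-1) (vf_scale M (1/2) (vf_add M Q (vf_scale M (-1) S)))))"
    unfolding AvB by simp
  have G: "?G (vf_scale M (1/2) (vf_add M X (vf_scale M (-1) Y)))
      = vf_scale M (1/2) (vf_add M (?G X) (vf_scale M (-1) (?G Y)))"
    if "X \<in> vector_fields M" "Y \<in> vector_fields M" for X Y
    using that by (simp add: vf_apply_add[OF atlas N] vf_apply_scale[OF atlas N] closed)
  \<comment> \<open>Passing to inner products with basis vectors turns the comparison of
    coefficients into real arithmetic.\<close>
  have arith: "a = b" if "\<And>e. e \<in> Basis \<Longrightarrow> a \<bullet> e = b \<bullet> e" for a b :: 'e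
    by (rule euclidean_eqI) (rule that)
  show ?thesis
  proof (rule extensionalityI[of _ "points M"])
    fix p assume p: "p \<in> points M"
    have fst: "fst (X p) = p" if "X \<in> vector_fields M" for X by (rule vector_field_fst[OF that p])
    show "K A B p = vf_add M (vf_scale M (1/2) (vf_diff M (lie_bracket M A B) (contracted_bracket M N A B)))
        (vf_scale M (1/4) (nijenhuis_torsion M N A B)) p"
      unfolding K_eq vAB AvB vAvB contracted_bracket_def nijenhuis_torsion_def Let_def
        P_def[symmetric] Q_def[symmetric] R_def[symmetric] S_def[symmetric]
      unfolding vf_apply_half_sum[of M 1] G[OF PQRS(1,2)] G[OF PQRS(1,3)] N_N[OF PQRS(1)]
      unfolding vf_apply_pt(1-4)[OF p] fst_conv snd_conv fst[OF PQRS(1)] fst[OF PQRS(2)] fst[OF PQRS(4)] prod.inject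
      by (intro conjI refl ext arith) (simp add: inner_add_left inner_diff_left field_simps)
  qed (simp_all add: K_eq sec_add_def)
qed

lemma lie_algebroid: "lie_algebroid E (half_sum (-1) N) K"
  unfolding lie_algebroid_def lie_algebra_on_sections_def tangent_bundle_simps(1)
  using vector_bundle_tangent_bundle[OF manifold] half_sum_map
    K_closed K_add K_scale_left K_scale_right K_self K_jacobi K_mult_right
  by (intro conjI ballI allI) assumption+

end

section \<open>Vertical vectors and connections\<close>

text \<open>For a transition \<phi> the tangent atlas has the transition (y, w) \<mapsto>
  (\<phi>(y), D\<phi>(y) w), whose derivative is block triangular; second derivatives of \<phi>
  occur in one off-diagonal block only. Hence being vertical does not depend on the tangent chart.
  Both parts avoid that block: one composes with \<open>fst\<close>, the other restricts to a
  fibre.\<close>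

lemma tangent_transition_derivative:
  assumes M: "smooth_atlas M" and c: "c \<in> M" "p \<in> chart_dom c" and d: "d \<in> M" "p \<in> chart_dom d"
    and v: "v \<in> tangent_space M p"
  shows "fst (frechet_derivative (transition (tangent_chart M c) (tangent_chart M d))
        (at (chart_map (tangent_chart M c) (p, v))) z)
      = frechet_derivative (transition c d) (at (chart_map c p)) (fst z)"
    "frechet_derivative (transition (tangent_chart M c) (tangent_chart M d))
        (at (chart_map (tangent_chart M c) (p, v))) (0, w)
      = (0, frechet_derivative (transition c d) (at (chart_map c p)) w)"
proof -
  let ?T = "transition (tangent_chart M c) (tangent_chart M d)" and ?z = "chart_map (tangent_chart M c) (p, v)"
  let ?S = "chart_map c ` (chart_dom c \<inter> chart_dom d)"
  have z: "?z = (chart_map c p, v c)" by (simp add: tangent_chart_simps)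
  have S: "open ?S" by (rule open_overlap[OF M c(1) d(1)])
  then have S2: "open (?S \<times> (UNIV :: 'b set))" by (simp add: open_Times)
  have y: "chart_map c p \<in> ?S" using c d by blast
  have D: "(?T has_derivative frechet_derivative ?T (at ?z)) (at ?z)"
    by (rule transition_has_derivative[OF smooth_atlas_tangent_manifold[OF M] tangent_chart_in[OF c(1)] tangent_chart_in[OF d(1)]])
      (use c d v in \<open>simp_all add: tangent_chart_dom_iff\<close>)
  have Tc: "(transition c d has_derivative frechet_derivative (transition c d) (at (chart_map c p))) (at (fst ?z))"
    using transition_has_derivative[OF M c(1) d(1) c(2) d(2)] by (simp add: z)
  have "((\<lambda>z. transition c d (fst z)) has_derivative
      (\<lambda>z. frechet_derivative (transition c d) (at (chart_map c p)) (fst z))) (at ?z)"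
    by (rule has_derivative_compose[OF bounded_linear_imp_has_derivative[OF bounded_linear_fst] Tc])
  then have "((\<lambda>z. fst (?T z)) has_derivative
      (\<lambda>z. frechet_derivative (transition c d) (at (chart_map c p)) (fst z))) (at ?z)"
    by (rule has_derivative_transform_within_open[OF _ S2])
      (use y in \<open>auto simp: z transition_tangent_chart[OF M c(1) d(1)]\<close>)
  from has_derivative_unique[OF bounded_linear.has_derivative[OF bounded_linear_fst D] this]
  show "fst (frechet_derivative ?T (at ?z) z) = frechet_derivative (transition c d) (at (chart_map c p)) (fst z)"
    by (rule fun_cong)
  have lin: "bounded_linear (frechet_derivative (transition c d) (at (chart_map c p)))"
    using transition_has_derivative[OF M c(1) d(1) c(2) d(2)] by (rule has_derivative_bounded_linear)
  \<comment> \<open>Restriction to the fibre over p, where the transition is linear in w and so is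
    its own derivative in the second component.\<close>
  have "((\<lambda>w. (chart_map c p, w)) has_derivative (\<lambda>w. (0, w))) (at (v c))"
    by (intro has_derivative_Pair has_derivative_const has_derivative_ident)
  moreover have "(?T has_derivative frechet_derivative ?T (at ?z)) (at (chart_map c p, v c))"
    using D unfolding z .
  ultimately have D1: "((\<lambda>w. ?T (chart_map c p, w)) has_derivative (\<lambda>w. frechet_derivative ?T (at ?z) (0, w))) (at (v c))"
    by (rule has_derivative_compose)
  have D2: "((\<lambda>w. ?T (chart_map c p, w)) has_derivative
      (\<lambda>w. (0, frechet_derivative (transition c d) (at (chart_map c p)) w))) (at (v c))"
    unfolding transition_tangent_chart[OF M c(1) d(1) y]
    by (intro has_derivative_Pair has_derivative_const bounded_linear_imp_has_derivative[OF lin])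
  show "frechet_derivative ?T (at ?z) (0, w) = (0, frechet_derivative (transition c d) (at (chart_map c p)) w)"
    by (rule fun_cong[OF has_derivative_unique[OF D1 D2]])
qed

text \<open>The projection is the first coordinate in every tangent chart. The chart chosen inside
  \<open>tangent_map\<close> is exchanged for \<open>tangent_chart M d\<close> by the transformation
  law of \<xi> and the block form of the transition derivative.\<close>

lemma tt_split_component:
  assumes M: "smooth_atlas M" and u: "u \<in> points (tangent_manifold M)"
    and xi: "\<xi> \<in> tangent_space (tangent_manifold M) u" and d: "d \<in> M" "fst u \<in> chart_dom d"
  shows "snd (snd (tt_split M (u, \<xi>))) d = fst (\<xi> (tangent_chart M d))"
proof -
  define C where "C = chart_at (tangent_manifold M) u"
  have "C \<in> tangent_manifold M" "u \<in> chart_dom C" unfolding C_def by (rule chart_at[OF u])+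
  then obtain c where c: "c \<in> M" "C = tangent_chart M c" "fst u \<in> chart_dom c" "snd u \<in> tangent_space M (fst u)"
    by (auto simp: tangent_manifold_def tangent_chart_dom_iff)
  let ?S = "chart_map c ` (chart_dom c \<inter> chart_dom d)"
  have z: "chart_map C u = (chart_map c (fst u), snd u c)" by (simp add: c(2) tangent_chart_simps)
  have S: "open ?S" by (rule open_overlap[OF M c(1) d(1)])
  then have S2: "open (?S \<times> (UNIV :: 'b set))" by (simp add: open_Times)
  have Tc: "(transition c d has_derivative frechet_derivative (transition c d) (at (chart_map c (fst u))))
      (at (fst (chart_map C u)))"
    using transition_has_derivative[OF M c(1) d(1) c(3) d(2)] by (simp add: z)
  have "((\<lambda>z. transition c d (fst z)) has_derivative
      (\<lambda>z. frechet_derivative (transition c d) (at (chart_map c (fst u))) (fst z))) (at (chart_map C u))"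
    by (rule has_derivative_compose[OF bounded_linear_imp_has_derivative[OF bounded_linear_fst] Tc])
  then have "((chart_map d \<circ> fst \<circ> chart_inv C) has_derivative
      (\<lambda>z. frechet_derivative (transition c d) (at (chart_map c (fst u))) (fst z))) (at (chart_map C u))"
  proof (rule has_derivative_transform_within_open[OF _ S2])
    show "chart_map C u \<in> ?S \<times> UNIV" unfolding z using c(1,3) d by auto
    fix z :: "'b \<times> 'b" assume z: "z \<in> ?S \<times> UNIV"
    then have "fst z \<in> chart_img c" by auto
    from tangent_chart_inv[OF M c(1) this, of "snd z"]
    show "transition c d (fst z) = (chart_map d \<circ> fst \<circ> chart_inv C) z"
      by (simp add: c(2) transition_def)
  qed
  from frechet_derivative_eqI[OF this]
  have "snd (snd (tt_split M (u, \<xi>))) d = frechet_derivative (transition c d) (at (chart_map c (fst u))) (fst (\<xi> C))"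
    using d by (simp add: tt_split_def tangent_map_def split_beta Let_def C_def)
  also have "\<dots> = fst (\<xi> (tangent_chart M d))"
    using tangent_space_component[OF xi tangent_chart_in[OF c(1)] _ tangent_chart_in[OF d(1)]]
      tangent_transition_derivative(1)[OF M c(1,3) d c(4), of "\<xi> C"] c d
    by (simp add: tangent_chart_dom_iff)
  finally show ?thesis .
qed

text \<open>The coordinate form (a, b) \<mapsto> (0, a) of J: the curve u + t w has a constant base
  point and is affine in the fibre coordinate, with slope the component of w.\<close>

lemma vertical_endomorphism_component:
  assumes M: "smooth_atlas M" and u: "u \<in> points (tangent_manifold M)"
    and xi: "\<xi> \<in> tangent_space (tangent_manifold M) u" and d: "d \<in> M" "fst u \<in> chart_dom d"
  shows "snd (vertical_endomorphism M (u, \<xi>)) (tangent_chart M d) = (0, fst (\<xi> (tangent_chart M d)))"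
proof -
  define w where "w = snd (snd (tt_split M (u, \<xi>)))"
  have w: "w d = fst (\<xi> (tangent_chart M d))" unfolding w_def by (rule tt_split_component[OF assms])
  let ?D = "tangent_chart M d"
  have uD: "u \<in> chart_dom ?D" using u d by (simp add: tangent_chart_dom_iff points_tangent_manifold_iff)
  have "((\<lambda>t. (chart_map d (fst u), snd u d + t *\<^sub>R w d)) has_vector_derivative (0, w d)) (at 0)"
    by (auto intro!: derivative_eq_intros simp: has_vector_derivative_def)
  from vector_derivative_at[OF this]
  have "vector_derivative (chart_map ?D \<circ> (\<lambda>t. (fst u, \<lambda>c. snd u c + t *\<^sub>R w c))) (at 0) = (0, w d)"
    by (simp add: comp_def tangent_chart_simps(2))
  then have "snd (vertical_endomorphism M (u, \<xi>)) ?D = (0, w d)"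
    using uD tangent_chart_in[OF d(1)]
    by (simp add: vertical_endomorphism_def vertical_lift_def velocity_def split_beta tt_split_def w_def)
  then show ?thesis by (simp add: w)
qed

lemma fst_vertical_endomorphism: "fst (vertical_endomorphism M \<xi>) = fst \<xi>"
  by (simp add: vertical_endomorphism_def vertical_lift_def velocity_def split_beta tt_split_def)

text \<open>The components are velocities taken chart by chart; their compatibility is the statement
  that transition derivatives map (0, w) to (0, D\<phi> w).\<close>

lemma vertical_endomorphism_in_tangent_space:
  assumes M: "smooth_atlas M" and u: "u \<in> points (tangent_manifold M)"
    and xi: "\<xi> \<in> tangent_space (tangent_manifold M) u"
  shows "snd (vertical_endomorphism M (u, \<xi>)) \<in> tangent_space (tangent_manifold M) u"
  unfolding tangent_space_def[of "tangent_manifold M"] mem_Collect_eq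
proof (intro conjI allI impI ballI)
  fix C assume "\<not> (C \<in> tangent_manifold M \<and> u \<in> chart_dom C)"
  then show "snd (vertical_endomorphism M (u, \<xi>)) C = 0"
    by (auto simp: vertical_endomorphism_def vertical_lift_def velocity_def split_beta tt_split_def)
next
  fix C D assume CD: "C \<in> tangent_manifold M" "D \<in> tangent_manifold M" "u \<in> chart_dom C \<inter> chart_dom D"
  obtain c where c: "c \<in> M" "C = tangent_chart M c" "fst u \<in> chart_dom c"
    using CD by (auto simp: tangent_manifold_def tangent_chart_dom_iff)
  obtain d where d: "d \<in> M" "D = tangent_chart M d" "fst u \<in> chart_dom d"
    using CD by (auto simp: tangent_manifold_def tangent_chart_dom_iff)
  have su: "snd u \<in> tangent_space M (fst u)" using u by (simp add: points_tangent_manifold_iff)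
  have "fst (\<xi> D) = frechet_derivative (transition c d) (at (chart_map c (fst u))) (fst (\<xi> C))"
    using tangent_space_component[OF xi CD(1) _ CD(2)] CD(3)
      tangent_transition_derivative(1)[OF M c(1,3) d(1,3) su, of "\<xi> C"]
    by (simp add: c(2) d(2))
  then show "snd (vertical_endomorphism M (u, \<xi>)) D
      = frechet_derivative (transition C D) (at (chart_map C u)) (snd (vertical_endomorphism M (u, \<xi>)) C)"
    using tangent_transition_derivative(2)[OF M c(1,3) d(1,3) su]
    unfolding c(2) d(2)
    by (simp add: vertical_endomorphism_component[OF M u xi c(1,3)] vertical_endomorphism_component[OF M u xi d(1,3)])
qed

text \<open>The image of J is the full vertical bundle, so an identity on this image, such as
  \<open>\<Gamma> \<circ> J = -J\<close>, holds for every vertical vector.\<close>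

lemma vertical_endomorphism_surj_vertical:
  assumes M: "smooth_atlas M" and eta: "\<eta> \<in> vb_fibre (tangent_bundle (tangent_manifold M)) u"
    and c: "c \<in> M" "fst u \<in> chart_dom c" and vert: "fst (snd \<eta> (tangent_chart M c)) = 0"
  obtains \<xi> where "\<xi> \<in> vb_fibre (tangent_bundle (tangent_manifold M)) u" "vertical_endomorphism M \<xi> = \<eta>"
proof -
  let ?TM = "tangent_manifold M" and ?C = "tangent_chart M c"
  have u: "u \<in> points ?TM" "fst \<eta> = u" "snd \<eta> \<in> tangent_space ?TM u"
    using eta by (simp_all add: tangent_fibre_iff)
  have C: "?C \<in> ?TM" "u \<in> chart_dom ?C"
    using tangent_chart_in[OF c(1)] u(1) c(2) by (simp_all add: tangent_chart_dom_iff points_tangent_manifold_iff)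
  \<comment> \<open>Since J sends (a, b) to (0, a), the fibre component of \<eta> is taken as the
    base component of the preimage; its own fibre component may be anything and is set to 0.\<close>
  define \<xi> where "\<xi> = tvec_of ?TM ?C u (snd (snd \<eta> ?C), 0)"
  have xi: "\<xi> \<in> tangent_space ?TM u"
    unfolding \<xi>_def by (rule tvec_of_in_tangent_space[OF smooth_atlas_tangent_manifold[OF M] C])
  have "snd (vertical_endomorphism M (u, \<xi>)) ?C = snd \<eta> ?C"
    unfolding vertical_endomorphism_component[OF M u(1) xi c]
    using vert tvec_of_component[OF smooth_atlas_tangent_manifold[OF M] C]
    by (simp add: \<xi>_def prod_eq_iff)
  then have "snd (vertical_endomorphism M (u, \<xi>)) = snd \<eta>"
    by (rule tangent_space_eqI[OF vertical_endomorphism_in_tangent_space[OF M u(1) xi] u(3) C])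
  then have "vertical_endomorphism M (u, \<xi>) = \<eta>"
    using fst_vertical_endomorphism[of M "(u, \<xi>)"] u(2) by (simp add: prod_eq_iff)
  then show thesis using that[of "(u, \<xi>)"] u xi by (simp add: tangent_fibre_iff)
qed

section \<open>Consequences of the connection identities\<close>

context
  fixes M :: "('p, 'e::euclidean_space) atlas" and \<Gamma>
  assumes M: "smooth_atlas M" and conn: "tm_connection M \<Gamma>"
begin

lemma connection_vbundle_map:
  "vbundle_map (tangent_bundle (tangent_manifold M)) (tangent_bundle (tangent_manifold M)) \<Gamma>"
  using conn by (simp add: tm_connection_def Let_def)

text \<open>J retains exactly the first component of a vector and discards the second, so
  \<open>J \<circ> \<Gamma> = J\<close> amounts to this equality.\<close>

lemma connection_horizontal_component:
  assumes xi: "\<xi> \<in> vb_fibre (tangent_bundle (tangent_manifold M)) u" and c: "c \<in> M" "fst u \<in> chart_dom c"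
  shows "fst (snd (\<Gamma> \<xi>) (tangent_chart M c)) = fst (snd \<xi> (tangent_chart M c))"
proof -
  have u: "u \<in> points (tangent_manifold M)" "\<xi> = (u, snd \<xi>)" "snd \<xi> \<in> tangent_space (tangent_manifold M) u"
    using xi by (auto simp: tangent_fibre_iff)
  have G: "\<Gamma> \<xi> = (u, snd (\<Gamma> \<xi>))" "snd (\<Gamma> \<xi>) \<in> tangent_space (tangent_manifold M) u"
    using vbundle_map_in_fibre[OF connection_vbundle_map xi] by (auto simp: tangent_fibre_iff)
  have "vertical_endomorphism M (\<Gamma> \<xi>) = vertical_endomorphism M \<xi>"
    using conn xi by (simp add: tm_connection_def Let_def vb_fibre_def)
  then show ?thesis
    using vertical_endomorphism_component[OF M u(1,3) c] vertical_endomorphism_component[OF M u(1) G(2) c]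
    by (metis G(1) u(2) snd_conv)
qed

lemma connection_vertical:
  assumes eta: "\<eta> \<in> vb_fibre (tangent_bundle (tangent_manifold M)) u" and c: "c \<in> M" "fst u \<in> chart_dom c"
    and vert: "fst (snd \<eta> (tangent_chart M c)) = 0"
  shows "\<Gamma> \<eta> = vb_scale (tangent_bundle (tangent_manifold M)) (-1) \<eta>"
proof -
  let ?E = "tangent_bundle (tangent_manifold M)"
  obtain \<xi> where xi: "\<xi> \<in> vb_fibre ?E u" "vertical_endomorphism M \<xi> = \<eta>"
    using vertical_endomorphism_surj_vertical[OF M eta c vert] .
  have "\<eta> = vb_scale ?E (-1) (\<Gamma> \<eta>)"
    using conn xi unfolding tm_connection_def Let_def by (metis (no_types, lifting) mem_Collect_eq vb_fibre_def)
  then have "fst \<eta> = fst (\<Gamma> \<eta>)" "snd \<eta> = (\<lambda>c. - snd (\<Gamma> \<eta>) c)"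
    by (simp_all add: prod_eq_iff)
  then show ?thesis by (simp add: prod_eq_iff)
qed

text \<open>The vector \<xi> - \<Gamma> \<xi> is vertical, so \<Gamma> maps it to its negative. By
  linearity \<Gamma> \<xi> - \<Gamma> (\<Gamma> \<xi>) = \<Gamma> \<xi> - \<xi>, and cancelling
  \<Gamma> \<xi> leaves the claim.\<close>

lemma connection_involution:
  assumes "\<xi> \<in> points (tangent_manifold (tangent_manifold M))"
  shows "\<Gamma> (\<Gamma> \<xi>) = \<xi>"
proof -
  let ?E = "tangent_bundle (tangent_manifold M)"
  define u where "u = fst \<xi>"
  have xi: "\<xi> \<in> vb_fibre ?E u" using assms by (simp add: vb_fibre_def u_def)
  then have u: "u \<in> points (tangent_manifold M)" by (simp add: tangent_fibre_iff)
  then have "fst u \<in> points M" by (simp add: points_tangent_manifold_iff)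
  then obtain c where c: "c \<in> M" "fst u \<in> chart_dom c" unfolding points_def by blast
  note G = vbundle_map_in_fibre[OF connection_vbundle_map xi]
  note GG = vbundle_map_in_fibre[OF connection_vbundle_map G]
  have mG: "vb_scale ?E (-1) (\<Gamma> \<xi>) \<in> vb_fibre ?E u"
    using G tangent_space_scale[OF smooth_atlas_tangent_manifold[OF M], of _ _ "-1"] by (simp add: tangent_fibre_iff)
  let ?\<eta> = "vb_add ?E \<xi> (vb_scale ?E (-1) (\<Gamma> \<xi>))"
  have eta: "?\<eta> \<in> vb_fibre ?E u"
    using xi G tangent_space_lincomb[OF smooth_atlas_tangent_manifold[OF M], of "snd \<xi>" u "snd (\<Gamma> \<xi>)" 1 "-1"]
    by (simp add: tangent_fibre_iff)
  have "\<Gamma> ?\<eta> = vb_scale ?E (-1) ?\<eta>"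
    by (rule connection_vertical[OF eta c]) (simp add: connection_horizontal_component[OF xi c])
  moreover have "\<Gamma> ?\<eta> = vb_add ?E (\<Gamma> \<xi>) (vb_scale ?E (-1) (\<Gamma> (\<Gamma> \<xi>)))"
    unfolding vbundle_map_add[OF connection_vbundle_map xi mG u] vbundle_map_scale[OF connection_vbundle_map G u] ..
  ultimately have "(\<lambda>c. snd (\<Gamma> \<xi>) c - snd (\<Gamma> (\<Gamma> \<xi>)) c) = (\<lambda>c. - (snd \<xi> c - snd (\<Gamma> \<xi>) c))"
    by (simp add: prod_eq_iff)
  then have "snd (\<Gamma> (\<Gamma> \<xi>)) = snd \<xi>" by (simp add: fun_eq_iff)
  moreover have "fst (\<Gamma> (\<Gamma> \<xi>)) = fst \<xi>" using GG xi by (simp add: tangent_fibre_iff)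
  ultimately show ?thesis by (simp add: prod_eq_iff)
qed

text \<open>For involutivity, the first components of both vertical fields vanish on the whole image
  of a tangent chart. Their derivatives then have vanishing first component, and so has the
  coordinate bracket; on such a vector \<Gamma> is -1, hence h is 0.\<close>

lemma connection_involutive_product_structure:
  assumes manifold: "smooth_manifold M"
  shows "involutive_product_structure (tangent_manifold M) \<Gamma>"
proof
  let ?Q = "tangent_manifold M"
  let ?E = "tangent_bundle ?Q"
  note Q = smooth_atlas_tangent_manifold[OF M]
  show "smooth_manifold ?Q" by (rule smooth_manifold_tangent_manifold[OF manifold])
  show "vbundle_map ?E ?E \<Gamma>" by (rule connection_vbundle_map)
  show "\<Gamma> (\<Gamma> \<xi>) = \<xi>" if "\<xi> \<in> points (tangent_manifold ?Q)" for \<xi>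
    by (rule connection_involution[OF that])
  fix A B assume A: "A \<in> vector_fields ?Q" and B: "B \<in> vector_fields ?Q"
  let ?v = "vf_apply ?Q (half_sum (-1) \<Gamma>)"
  have v: "?v X \<in> vector_fields ?Q" if "X \<in> vector_fields ?Q" for X
    by (rule vf_apply_closed[OF Q vbundle_map_half_sum[OF Q connection_vbundle_map] that])
  have W: "lie_bracket ?Q (?v A) (?v B) \<in> vector_fields ?Q" by (intro lie_bracket_closed Q v A B)
  show "vf_apply ?Q (half_sum 1 \<Gamma>) (lie_bracket ?Q (?v A) (?v B)) = sec_zero ?E"
  proof (rule extensionalityI[of _ "points ?Q"])
    fix u assume u: "u \<in> points ?Q"
    then have "fst u \<in> points M" by (simp add: points_tangent_manifold_iff)
    then obtain c where c: "c \<in> M" "fst u \<in> chart_dom c" unfolding points_def by blast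
    let ?C = "tangent_chart M c" and ?S = "chart_img (tangent_chart M c)"
    have C: "?C \<in> ?Q" "u \<in> chart_dom ?C"
      using tangent_chart_in[OF c(1)] u c(2) by (simp_all add: tangent_chart_dom_iff points_tangent_manifold_iff)
    have S: "open ?S" by (rule open_chart_img[OF Q C(1)])
    let ?y = "chart_map ?C u"
    have y: "?y \<in> ?S" using C(2) by (rule imageI)
    have vert: "fst (chart_rep ?C (?v X) z) = 0" if X: "X \<in> vector_fields ?Q" and z: "z \<in> ?S" for X z
    proof -
      let ?q = "chart_inv ?C z"
      have q: "?q \<in> chart_dom ?C" by (rule chart_inv_in_dom[OF z])
      have qp: "?q \<in> points ?Q" using q C(1) unfolding points_def by blast
      have "fst ?q \<in> chart_dom c" using q by (simp only: tangent_chart_dom_iff)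
      from connection_horizontal_component[OF vector_field_in_fibre[OF X qp] c(1) this]
      show ?thesis by (simp add: chart_rep_def vf_apply_pt(5)[OF qp] half_sum_def)
    qed
    \<comment> \<open>The first component of the derivative is the derivative of the first
      component, which is constantly zero near the point; uniqueness of derivatives
      concludes.\<close>
    have D0: "fst (frechet_derivative (chart_rep ?C (?v X)) (at ?y) w) = 0" if X: "X \<in> vector_fields ?Q" for X w
    proof -
      have D1: "((\<lambda>z. fst (chart_rep ?C (?v X) z)) has_derivative
          (\<lambda>w. fst (frechet_derivative (chart_rep ?C (?v X)) (at ?y) w))) (at ?y)"
        by (rule bounded_linear.has_derivative[OF bounded_linear_fst
            smooth_on_has_derivative[OF smooth_on_chart_rep[OF Q v[OF X] C(1)] S y]])
      have D2: "((\<lambda>z. fst (chart_rep ?C (?v X) z)) has_derivative (\<lambda>w. 0)) (at ?y)"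
        by (rule has_derivative_transform_within_open[OF has_derivative_const S y]) (simp add: vert[OF X])
      show ?thesis by (rule fun_cong[OF has_derivative_unique[OF D1 D2]])
    qed
    have "snd (lie_bracket ?Q (?v A) (?v B) u) ?C = local_bracket (chart_rep ?C (?v A)) (chart_rep ?C (?v B)) ?y"
      using chart_rep_lie_bracket[OF Q v[OF A] v[OF B] C(1) y] chart_inv_chart_map[OF Q C]
      by (simp add: chart_rep_def)
    then have "fst (snd (lie_bracket ?Q (?v A) (?v B) u) ?C) = 0"
      by (simp add: local_bracket_def D0 A B)
    from connection_vertical[OF vector_field_in_fibre[OF W u] c this]
    show "vf_apply ?Q (half_sum 1 \<Gamma>) (lie_bracket ?Q (?v A) (?v B)) u = sec_zero ?E u"
      using u vector_field_fst[OF W u] by (simp add: vf_apply_pt half_sum_def)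
  qed (simp_all add: sec_apply_def sec_zero_def)
qed

end

theorem theorem9p1:
  fixes M :: "('p, 'e::euclidean_space) atlas"
    and \<Gamma> :: "(('p, 'e) tvec, 'e \<times> 'e) tvec \<Rightarrow> (('p, 'e) tvec, 'e \<times> 'e) tvec"
  assumes "smooth_manifold M"
    and "tm_connection M \<Gamma>"
  shows "let TM = tangent_manifold M; TTM = tangent_bundle TM in
    \<exists>q br. lie_algebroid TTM q br \<and>
      (\<forall>\<xi>\<in>points (vb_total TTM). q \<xi> = vb_scale TTM (1/2) (vb_diff TTM \<xi> (\<Gamma> \<xi>))) \<and>
      (\<forall>A\<in>vector_fields TM. \<forall>B\<in>vector_fields TM.
         br A B =
           sec_add TTM
             (sec_scale TTM (1/2) (sec_diff TTM (lie_bracket TM A B) (contracted_bracket TM \<Gamma> A B)))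
             (sec_scale TTM (1/4) (nijenhuis_torsion TM \<Gamma> A B)))"
proof -
  have "smooth_atlas M" using assms(1) by (simp add: smooth_manifold_def)
  then interpret involutive_product_structure "tangent_manifold M" \<Gamma>
    by (rule connection_involutive_product_structure[OF _ assms(2,1)])
  show ?thesis
    unfolding Let_def
    using lie_algebroid K_formula
    by (intro exI[of _ "half_sum (-1) \<Gamma>"] exI[of _ K] conjI) (simp_all add: half_sum_def vb_diff_def)
qed

end
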